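(* Let $f$ be an arbitrary entire function. Then for all $z,u\in\mathbb{C}$, $$f(z)=\sum_{n=0}^{\infty}\mathcal{K}^n[f](u)\,\mathcal{K}^n_u[\mathrm{sinc}(z-u)]=\sum_{n=0}^{\infty}(-1)^n\mathcal{K}^n[f](u)\,\mathcal{K}^n[\mathrm{sinc}](z-u)=\sum_{n=0}^{\infty}\mathcal{K}^n[f](u)\,\sqrt{2n+1}\,\mathrm{j}_n(\pi(z-u)).$$ If (the restriction to $\mathbb{R}$ of) $f$ belongs to $\mathbf{BL}(\pi)$, then the series converges uniformly on $\mathbb{R}$ and in the space $\mathbf{BL}(\pi)$ (i.e. in $L^2$).
   Context: $\mathbf{BL}(\pi)$ is the space of continuous $L^2(\mathbb{R})$ functions whose Fourier transform $\widehat f(\omega)=\int_{-\infty}^{\infty} f(t)e^{-i\omega t}\,dt$ is supported within $[-\pi,\pi]$; every such function is the restriction to $\mathbb{R}$ of an entire function. Let $P^{L}_n(\omega)=\sqrt{2n+1}\,L_n(\omega/\pi)$, where $L_n$ is the Legendre polynomial of degree $n$; thus $\frac{1}{2\pi}\int_{-\pi}^{\pi}P^L_n(\omega)P^L_m(\omega)\,d\omega=\delta(m-n)$, where $\delta(0)=1$ and $\delta(j)=0$ for $j\ne 0$. The chromatic derivatives associated with the Legendre polynomials are the linear differential operators $\mathcal{K}^{n}_t=(-i)^nP^L_n\!\left(i\,\frac{d}{dt}\right)$, i.e. each $\omega^k$ in $P_n^L(\omega)$ is replaced by $i^k\frac{d^k}{dt^k}$ and the result is multiplied by $(-i)^n$;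 the subscript indicates the variable of differentiation and is dropped for functions of one variable. Here $\mathrm{sinc}\,t=\frac{\sin \pi t}{\pi t}$ (extended to an entire function), and $\mathrm{j}_n$ is the spherical Bessel function of the first kind of order $n$. *)

theory Defs
  imports "HOL-Complex_Analysis.Complex_Analysis" "HOL-Computational_Algebra.Polynomial"
begin

text \<open>Legendre polynomials, by Rodrigues' formula.\<close>
definition legendre_poly :: "nat \<Rightarrow> real poly" where
  "legendre_poly n = smult (1 / (2 ^ n * fact n)) ((pderiv ^^ n) ([:-1, 0, 1:] ^ n))"

text \<open>\<open>PL n\<close> is the polynomial \<open>sqrt (2 n + 1) L_n(\<omega> / \<pi>)\<close> in \<open>\<omega>\<close>.\<close>
definition PL :: "nat \<Rightarrow> real poly" where
  "PL n = smult (sqrt (2 * real n + 1)) (pcompose (legendre_poly n) [:0, 1 / pi:])"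

definition chromatic_deriv :: "nat \<Rightarrow> (complex \<Rightarrow> complex) \<Rightarrow> complex \<Rightarrow> complex" where
  "chromatic_deriv n f u =
     (- \<i>) ^ n * (\<Sum>k\<le>degree (PL n). complex_of_real (coeff (PL n) k) * \<i> ^ k * (deriv ^^ k) f u)"

definition csinc :: "complex \<Rightarrow> complex" where
  "csinc z = (if z = 0 then 1 else sin (of_real pi * z) / (of_real pi * z))"

definition bessel_J :: "complex \<Rightarrow> complex \<Rightarrow> complex" where
  "bessel_J \<nu> z =
     (z / 2) powr \<nu> * (\<Sum>k. (- 1) ^ k / fact k * rGamma (\<nu> + of_nat k + 1) * (z / 2) ^ (2 * k))"

text \<open>The usual definition \<open>sqrt (\<pi> / (2 z)) J_{n + 1/2}(z)\<close>.  The square root is split as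
  \<open>sqrt (\<pi> / 2) z powr (- 1/2)\<close> so that its branch matches that of \<^const>\<open>bessel_J\<close> on the
  negative real axis as well, and the value at the removable singularity \<open>0\<close> is filled in;
  the result is entire.\<close>
definition spherical_bessel_j :: "nat \<Rightarrow> complex \<Rightarrow> complex" where
  "spherical_bessel_j n z =
     (if z = 0 then (if n = 0 then 1 else 0)
      else of_real (sqrt (pi / 2)) * z powr (- 1 / 2) * bessel_J (of_nat n + 1 / 2) z)"

definition square_integrable :: "(real \<Rightarrow> complex) \<Rightarrow> bool" where
  "square_integrable f \<longleftrightarrow>
     f \<in> borel_measurable lborel \<and> integrable lborel (\<lambda>t. (cmod (f t))\<^sup>2)"

text \<open>The squared distance is an extended nonnegative integral, so that a difference that is not
  square integrable counts as infinitely far from zero.\<close>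
definition L2_tendsto :: "('i \<Rightarrow> real \<Rightarrow> complex) \<Rightarrow> (real \<Rightarrow> complex) \<Rightarrow> 'i filter \<Rightarrow> bool" where
  "L2_tendsto g f \<F> \<longleftrightarrow>
     ((\<lambda>i. \<integral>\<^sup>+ t. ennreal ((cmod (g i t - f t))\<^sup>2) \<partial>lborel) \<longlongrightarrow> 0) \<F>"

text \<open>The Fourier integral of a square integrable function need not converge absolutely; as usual
  it is understood as the limit in \<open>L\<^sup>2\<close> of the integrals over \<open>[-T, T]\<close>, which determines the
  transform \<open>F\<close> up to a null set.\<close>
definition has_fourier_transform :: "(real \<Rightarrow> complex) \<Rightarrow> (real \<Rightarrow> complex) \<Rightarrow> bool" where
  "has_fourier_transform f F \<longleftrightarrow>
     square_integrable f \<and> square_integrable F \<and>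
     L2_tendsto (\<lambda>T \<omega>. LINT t:{-T..T}|lborel. f t * exp (- \<i> * of_real \<omega> * of_real t)) F at_top"

definition BL :: "real \<Rightarrow> (real \<Rightarrow> complex) set" where
  "BL a = {f. continuous_on UNIV f \<and> square_integrable f \<and>
     (\<exists>F. has_fourier_transform f F \<and> (AE \<omega> in lborel. \<omega> \<notin> {-a..a} \<longrightarrow> F \<omega> = 0))}"

definition converges_in_BL :: "real \<Rightarrow> (nat \<Rightarrow> real \<Rightarrow> complex) \<Rightarrow> (real \<Rightarrow> complex) \<Rightarrow> bool" where
  "converges_in_BL a g f \<longleftrightarrow> (\<forall>N. g N \<in> BL a) \<and> f \<in> BL a \<and> L2_tendsto g f sequentially"

end

theory Submission
  imports Defs "HOL-Probability.Probability" "HOL-Real_Asymp.Real_Asymp"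
begin

text \<open>
  Write \<open>\<phi>\<^sub>n(z) = (-\<i>)\<^sup>n / (2\<pi>) \<integral> P\<^sub>n(\<omega>) e\<^sup>i\<^sup>\<omega>\<^sup>z d\<omega>\<close>, the integral running over
  \<open>[-\<pi>, \<pi>]\<close>.  Differentiating Fourier integrals under the integral sign identifies \<open>\<phi>\<^sub>n\<close> with
  \<open>(-1)\<^sup>n K\<^sup>n[sinc]\<close>, and the closed form of the moments \<open>M(p,n)\<close> of \<open>P\<^sub>n\<close> identifies it with
  \<open>sqrt (2 n + 1) j\<^sub>n(\<pi> z)\<close>, so all three series are \<open>\<Sum>n. K\<^sup>n[f](u) \<phi>\<^sub>n(z - u)\<close>.

  For entire \<open>f\<close>, expand \<open>\<phi>\<^sub>n\<close> in powers of \<open>h = z - u\<close>.  Cauchy's inequality on a circle of radius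
  greater than \<open>|h|\<close> makes the double series absolutely convergent, so the order of summation may be
  exchanged; since \<open>\<omega>\<^sup>p = \<Sum>n\<le>p. M(p,n) P\<^sub>n(\<omega>)\<close>, the coefficient of \<open>h\<^sup>p\<close> collapses to the Taylor
  coefficient of \<open>f\<close> at \<open>u\<close>.

  For \<open>f\<close> in \<open>BL(\<pi>)\<close>, Fourier inversion turns \<open>K\<^sup>n[f](u)\<close> into Legendre coefficients of an \<open>L\<^sup>2\<close>
  function, which are square summable by Bessel's inequality.  By Plancherel and Cauchy-Schwarz the
  partial sums are then Cauchy, both uniformly on the real line and in \<open>L\<^sup>2\<close>; the limit is known
  pointwise from the first part, so neither completeness of \<open>L\<^sup>2\<close> nor of the Legendre polynomials
  is needed.
\<close>

section \<open>Legendre polynomials: moments, orthonormality, expansion of polynomials\<close>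

text \<open>For entire f, Cauchy's inequality only bounds the k-th derivative by a multiple of
  k!/R^k, while the coefficients of P_n are large. What saves the double series is a cancellation:
  |coefficient of omega^k in P_n| times k!/R^k times the leading Taylor term of phi_n at |h| is at
  most (|h|/R)^n exp((pi R)^2), so the rows are dominated by (n+1)(|h|/R)^n. All moments are
  nonnegative, so taking absolute values costs nothing. In BL(pi) the transform is only an L2 limit,
  and f is not known to be bounded or integrable. Gaussian factors make every double integral
  absolutely convergent: Plancherel is proved for cutoffs of continuous functions, where approximate
  identities converge almost everywhere, and inversion comes from pairing with Gaussians that
  concentrate in time. As u may be complex, inversion on the real line must be carried to the plane
  by the identity theorem. On the band the factor exp(i omega u) is bounded, which is the origin of
  the constant exp(2 pi |Im u|).\<close>

definition poly_int :: "real poly \<Rightarrow> real" where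
  "poly_int p = integral {-1..1} (poly p)"

lemma poly_int_has_integral: "(poly p has_integral poly_int p) {-1..1}"
  unfolding poly_int_def
  by (intro integrable_integral integrable_continuous_real continuous_intros)

lemma poly_int_add: "poly_int (p + q) = poly_int p + poly_int q"
  using has_integral_unique[OF poly_int_has_integral[of "p + q"]]
        has_integral_add[OF poly_int_has_integral[of p] poly_int_has_integral[of q]]
  by (simp add: poly_add[abs_def])

lemma poly_int_smult: "poly_int (smult c p) = c * poly_int p"
  using has_integral_unique[OF poly_int_has_integral[of "smult c p"]]
        has_integral_mult_right[OF poly_int_has_integral[of p], of c]
  by (simp add: poly_smult[abs_def])

lemma poly_int_0 [simp]: "poly_int 0 = 0"
  using poly_int_smult[of 0 0] by simp

lemma poly_int_diff: "poly_int (p - q) = poly_int p - poly_int q"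
  using poly_int_add[of p "smult (-1) q"] poly_int_smult[of "-1" q] by simp

lemma poly_int_pderiv: "poly_int (pderiv p) = poly p 1 - poly p (-1)"
proof -
  have "(poly (pderiv p) has_integral (poly p 1 - poly p (-1))) {-1..1}"
    by (intro fundamental_theorem_of_calculus)
       (auto simp flip: has_real_derivative_iff_has_vector_derivative
             intro: has_field_derivative_at_within poly_DERIV)
  with poly_int_has_integral[of "pderiv p"] show ?thesis
    by (auto intro: has_integral_unique)
qed

lemma poly_int_monom: "poly_int (monom 1 m) = (1 - (-1) ^ (m + 1)) / real (m + 1)"
  using poly_int_pderiv[of "monom 1 (m + 1)"] poly_int_smult[of "real (m + 1)" "monom 1 m"]
  by (simp add: pderiv_monom poly_monom smult_monom field_simps)

text \<open>The even case is the Beta integral B(k + 1/2, n + 1) written with factorials. Splitting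
  off one factor 1 - x^2 gives I(n+1,k) = I(n,k) - I(n,k+1), so the induction on n must run over all
  k at once.\<close>

lemma poly_int_even_odd:
  shows "poly_int (monom 1 (2 * k) * [:1, 0, -1:] ^ n) =
           fact n * fact (2 * k) * 4 ^ (n + 1) * fact (n + k + 1) / (fact k * fact (2 * n + 2 * k + 2))"
    and "poly_int (monom 1 (2 * k + 1) * [:1, 0, -1:] ^ n) = 0"
proof (induction n arbitrary: k)
  case 0
  {
    case 1
    have "fact (2 * k + 2) = (2 * real k + 1) * (2 * real k + 2) * fact (2 * k)"
      by (simp add: fact_reduce algebra_simps)
    then show ?case by (simp add: poly_int_monom divide_simps) (simp add: algebra_simps)
  next
    case 2
    show ?case by (simp add: poly_int_monom)
  }
next
  case (Suc n)
  have rec: "poly_int (monom 1 m * [:1, 0, -1:] ^ Suc n) =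
      poly_int (monom 1 m * [:1, 0, -1:] ^ n) - poly_int (monom 1 (m + 2) * [:1, 0, -1:] ^ n)" for m
  proof -
    have *: "[:1, 0, -1 :: real:] = 1 - monom 1 2"
      by (simp add: monom_altdef power2_eq_square one_pCons)
    have "monom 1 m * [:1, 0, -1 :: real:] ^ Suc n =
        monom 1 m * [:1, 0, -1:] ^ n - monom 1 (m + 2) * [:1, 0, -1:] ^ n"
      by (simp add: algebra_simps mult_monom * del: monom_Suc)
    then show ?thesis by (simp add: poly_int_diff)
  qed
  {
    case 1
    have e: "2 * k + 2 = 2 * (k + 1)" by simp
    have f1: "fact (n + (k + 1) + 1) = (real n + k + 2) * fact (n + k + 1)"
      by (simp add: fact_reduce)
    have f2: "fact (2 * n + 2 * (k + 1) + 2) = (2 * real n + 2 * k + 4) * (2 * real n + 2 * k + 3) * fact (2 * n + 2 * k + 2)"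
      by (simp add: fact_reduce algebra_simps)
    have f3: "fact (2 * (k + 1)) = (2 * real k + 2) * (2 * real k + 1) * fact (2 * k)"
      by (simp add: fact_reduce algebra_simps)
    have f4: "fact (k + 1) = (real k + 1) * fact k"
      by (simp add: algebra_simps)
    have f5: "fact (Suc n) = (real n + 1) * fact n"
      by (simp add: algebra_simps)
    have g: "Suc n + k + 1 = n + (k + 1) + 1" "2 * Suc n + 2 * k + 2 = 2 * n + 2 * (k + 1) + 2" by simp_all
    define a b c d e' y z w K :: real where "a = fact n" and "b = fact (2 * k)" and "c = fact (n + k + 1)"
      and "d = fact k" and "e' = fact (2 * n + 2 * k + 2)" and "y = real n + k + 2"
      and "z = 2 * real n + 2 * k + 3" and "w = real k + 1" and "K = 2 * real k + 1"
    have nz: "d > 0" "e' > 0" "y > 0" "z > 0" "w > 0"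
      by (auto simp: d_def e'_def y_def z_def w_def)
    have F: "2 * real n + 2 * k + 4 = 2 * y" "2 * real k + 2 = 2 * w" "real n + k + 2 = y"
        "2 * real n + 2 * k + 3 = z" "real k + 1 = w" "2 * real k + 1 = K"
      by (simp_all add: y_def w_def z_def K_def)
    \<comment> \<open>\<open>?X\<close> is the closed form at (n, k). Those at (n, k+1) and (n+1, k)
      are \<open>?X\<close> times (2k+1)/z and (2n+2)/z with z = 2n+2k+3; these factors add up to 1,
      which is the recursion.\<close>
    let ?X = "a * b * 4 ^ (n + 1) * c / (d * e')"
    have "a * (2 * w * K * b) * 4 ^ (n + 1) * (y * c) / (w * d * (2 * y * z * e')) = ?X * (K / z)"
      using nz by (simp add: divide_simps)
    moreover have "(real n + 1) * a * b * 4 ^ (Suc n + 1) * (y * c) / (d * (2 * y * z * e')) = ?X * ((2 * real n + 2) / z)"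
      using nz by (simp add: divide_simps)
    moreover have "K / z + (2 * real n + 2) / z = 1"
      using nz by (simp add: K_def z_def divide_simps)
    then have "?X = ?X * (K / z) + ?X * ((2 * real n + 2) / z)"
      by (metis mult.right_neutral distrib_left)
    ultimately show ?case
      unfolding rec e Suc.IH(1) g f1 f2 f3 f4 f5 a_def[symmetric] b_def[symmetric] c_def[symmetric]
        d_def[symmetric] e'_def[symmetric] F by linarith
  next
    case 2
    have e: "2 * k + 1 + 2 = 2 * (k + 1) + 1" by simp
    show ?case unfolding rec e Suc.IH(2) by simp
  }
qed

text \<open>By the product rule each differentiation costs at most one factor
  \<open>q\<close>.\<close>

lemma power_dvd_higher_pderiv:
  fixes q :: "real poly"
  assumes "i \<le> n"
  shows "q ^ (n - i) dvd (pderiv ^^ i) (q ^ n)"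
  using assms
proof (induction i)
  case (Suc i)
  from Suc obtain r where r: "(pderiv ^^ i) (q ^ n) = q ^ (n - i) * r"
    by (auto elim: dvdE)
  have "n - i = Suc (n - Suc i)" using Suc.prems by simp
  then have "(pderiv ^^ Suc i) (q ^ n) = q ^ (n - Suc i) * (q * pderiv r + r * (smult (of_nat (Suc (n - Suc i))) (pderiv q)))"
    by (simp add: r pderiv_mult pderiv_power_Suc algebra_simps del: power_Suc of_nat_Suc)
       (simp add: algebra_simps)
  then show ?case by simp
qed simp

text \<open>The boundary terms vanish because the lower derivatives of \<open>(x\<^sup>2 - 1)\<^sup>n\<close> do so at \<open>\<plusminus>1\<close>.\<close>
lemma poly_int_by_parts:
  assumes "j \<le> n"
  shows "poly_int (r * (pderiv ^^ j) ([:-1, 0, 1:] ^ n)) =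
         (-1) ^ j * poly_int ((pderiv ^^ j) r * [:-1, 0, 1:] ^ n)"
  using assms
proof (induction j arbitrary: r)
  case (Suc j)
  let ?D = "(pderiv ^^ j) ([:-1, 0, 1:] ^ n) :: real poly"
  have "[:-1, 0, 1:] ^ (n - j) dvd ?D" "n - j > 0"
    using Suc.prems by (auto intro: power_dvd_higher_pderiv)
  then have "poly ?D 1 = 0" "poly ?D (-1) = 0"
    by (auto elim!: dvdE simp: power_0_left)
  then have "poly_int (pderiv (r * ?D)) = 0"
    unfolding poly_int_pderiv by simp
  then have "poly_int (r * (pderiv ^^ Suc j) ([:-1, 0, 1:] ^ n)) = - poly_int (pderiv r * ?D)"
    by (simp add: pderiv_mult poly_int_add algebra_simps)
  also have "\<dots> = (-1) ^ Suc j * poly_int ((pderiv ^^ Suc j) r * [:-1, 0, 1:] ^ n)"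
    using Suc by (simp del: funpow.simps add: funpow_Suc_right)
  finally show ?case .
qed simp

lemma pochhammer_Suc_real: "pochhammer (1 + real m) n = fact (n + m) / fact m"
  by (simp add: pochhammer_fact add.commute)
    (metis add.commute nonzero_mult_div_cancel_left of_nat_fact pochhammer_fact pochhammer_product' fact_nonzero)

text \<open>With Rodrigues' formula, n integrations by parts move all derivatives onto x^p. They
  annihilate it for p < n and otherwise leave a multiple of x^(p-n) against (1 - x^2)^n, a Beta
  integral that vanishes for odd p - n.\<close>

lemma legendre_moment:
  "poly_int (monom 1 p * legendre_poly n) =
     (if n \<le> p \<and> even (p - n) then 2 ^ (n + 1) * fact p * fact (n + (p - n) div 2) /
        (fact ((p - n) div 2) * fact (n + p + 1)) else 0)"
proof -
  have "poly_int (monom 1 p * legendre_poly n) =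
     (-1) ^ n * poly_int ((pderiv ^^ n) (monom 1 p) * [:-1, 0, 1:] ^ n) / (2 ^ n * fact n)"
    using poly_int_by_parts[of n n "monom 1 p"]
    by (simp add: legendre_poly_def poly_int_smult)
  \<comment> \<open>The sign from the integrations by parts is absorbed by turning x^2 - 1 into 1 -
    x^2.\<close>
  also have "\<dots> = poly_int ((pderiv ^^ n) (monom 1 p) * [:1, 0, -1:] ^ n) / (2 ^ n * fact n)"
  proof -
    have "[:-1, 0, 1 :: real:] ^ n = smult ((-1) ^ n) ([:1, 0, -1:] ^ n)"
      using smult_power[of "-1" "[:1, 0, -1 :: real:]" n] by simp
    then show ?thesis
      by (simp add: poly_int_smult flip: power_mult_distrib)
  qed
  also have "\<dots> = (if n \<le> p \<and> even (p - n) then 2 ^ (n + 1) * fact p * fact (n + (p - n) div 2) /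
        (fact ((p - n) div 2) * fact (n + p + 1)) else 0)"
  proof (cases "n \<le> p")
    case True
    have D: "(pderiv ^^ n) (monom 1 p) = smult (fact p / fact (p - n)) (monom 1 (p - n) :: real poly)"
    proof (rule poly_eqI)
      fix i
      have "pochhammer (1 + real (p - n)) n = fact p / fact (p - n)"
        using True pochhammer_Suc_real[of "p - n" n] by simp
      then show "coeff ((pderiv ^^ n) (monom 1 p)) i = coeff (smult (fact p / fact (p - n)) (monom 1 (p - n) :: real poly)) i"
        using True by (auto simp: coeff_higher_pderiv)
    qed
    show ?thesis
    proof (cases "even (p - n)")
      case e: True
      then obtain k where k: "p - n = 2 * k" by (rule evenE)
      then have p: "p = n + 2 * k" using True by simp
      have f1: "fact (2 * n + 2 * k + 2) = 2 * (real n + k + 1) * fact (n + p + 1)"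
        by (simp add: p fact_reduce algebra_simps)
      have f2: "fact (n + k + 1) = (real n + k + 1) * fact (n + k)" by (simp add: algebra_simps)
      have f3: "4 ^ (n + 1) = (4::real) * 2 ^ n * 2 ^ n" by (simp flip: power_mult_distrib)
      define a b c d e' x y :: real where "a = fact n" and "b = fact (2 * k)" and "c = fact (n + k)"
        and "d = fact k" and "e' = fact (n + p + 1)" and "x = real n + k + 1" and "y = fact p"
      have "a > 0" "b > 0" "d > 0" "e' > 0" "x > 0"
        by (auto simp: a_def b_def d_def e'_def x_def)
      then have "y / b * (a * b * (4 * 2 ^ n * 2 ^ n) * (x * c) / (d * (2 * x * e'))) / (2 ^ n * a) =
          2 ^ (n + 1) * y * c / (d * e')"
        by (simp add: divide_simps)
      then show ?thesis using True e
        unfolding D k mult_smult_left poly_int_smult poly_int_even_odd(1) f1 f2 f3 a_def b_def c_def d_def e'_def x_def y_def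
        by (simp del: fact_Suc)
    next
      case False
      then obtain k where k: "p - n = 2 * k + 1" by (rule oddE)
      then show ?thesis unfolding D k using poly_int_even_odd(2)[of k n]
        by (simp add: poly_int_smult)
    qed
  next
    case False
    then have "(pderiv ^^ n) (monom 1 p :: real poly) = 0"
      by (intro poly_eqI) (auto simp: coeff_higher_pderiv)
    then show ?thesis using False by simp
  qed
  finally show ?thesis .
qed

text \<open>The coefficient of x^m in the n-th derivative stems from x^(n+m) in the binomial
  expansion of (x^2 - 1)^n, which contains only even powers.\<close>

lemma coeff_legendre:
  "coeff (legendre_poly n) m =
     (if m \<le> n \<and> even (n - m) then (-1) ^ ((n - m) div 2) * real (n choose ((n - m) div 2)) *
        fact (n + m) / (fact m * 2 ^ n * fact n) else 0)"
proof -
  have "[:-1, 0, 1 :: real:] = monom 1 2 + (- 1)"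
    by (simp add: monom_altdef power2_eq_square one_pCons)
  then have "[:-1, 0, 1 :: real:] ^ n = (\<Sum>j\<le>n. of_nat (n choose j) * monom 1 2 ^ j * (- 1) ^ (n - j))"
    using binomial_ring[of "monom 1 2" "- 1 :: real poly" n] by simp
  also have "\<dots> = (\<Sum>j\<le>n. monom (real (n choose j) * (- 1) ^ (n - j)) (2 * j))"
    by (intro sum.cong refl poly_eqI) (auto simp: monom_power of_nat_poly minus_one_power_iff mult.commute)
  finally have Q: "coeff ([:-1, 0, 1 :: real:] ^ n) i = (if even i \<and> i \<le> 2 * n then real (n choose (i div 2)) * (- 1) ^ (n - i div 2) else 0)" for i
    by (auto simp: coeff_sum sum.delta elim!: evenE intro!: sum.neutral)
  note pochhammer_Suc_real[of m n]
  moreover have "m \<le> n \<Longrightarrow> even (n + m) \<Longrightarrow> n - (m + n) div 2 = (n - m) div 2"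
    by presburger
  moreover have "m \<le> n \<Longrightarrow> even (n + m) \<Longrightarrow> n choose ((m + n) div 2) = n choose ((n - m) div 2)"
    by (subst binomial_symmetric) (presburger, metis calculation(2))
  ultimately show ?thesis
    by (auto simp: legendre_poly_def coeff_higher_pderiv Q add.commute mult_ac)
qed

lemma degree_legendre: "degree (legendre_poly n) = n"
proof (rule antisym)
  show "degree (legendre_poly n) \<le> n"
    by (rule degree_le) (simp add: coeff_legendre)
  show "n \<le> degree (legendre_poly n)"
    by (rule le_degree) (simp add: coeff_legendre)
qed

section \<open>The rescaled Legendre polynomials as an orthonormal basis of the polynomials\<close>

text \<open>The mean value over \<open>[-\<pi>, \<pi>]\<close>.\<close>
definition poly_mean :: "real poly \<Rightarrow> real" where
  "poly_mean q = poly_int (pcompose q [:0, pi:]) / 2"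

lemma poly_mean_has_integral: "(poly q has_integral 2 * pi * poly_mean q) {-pi..pi}"
proof -
  have "((\<lambda>x. poly (pcompose q [:0, pi:]) (1 / pi * x + 0)) has_integral (pi * (2 * poly_mean q)))
          (cbox (- 1 / (1 / pi)) (1 / (1 / pi)))"
    using has_integral_affinity'[OF poly_int_has_integral[of "pcompose q [:0, pi:]", folded box_real(2)], of "1 / pi" 0]
    by (simp add: poly_mean_def field_simps)
  then show ?thesis by (simp add: poly_pcompose mult_ac)
qed

lemma poly_mean_add: "poly_mean (p + q) = poly_mean p + poly_mean q"
  and poly_mean_smult: "poly_mean (smult c p) = c * poly_mean p"
  and poly_mean_0 [simp]: "poly_mean 0 = 0"
  by (simp_all add: poly_mean_def pcompose_add pcompose_smult
        poly_int_add poly_int_smult add_divide_distrib)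

lemma poly_mean_sum: "poly_mean (sum f A) = (\<Sum>x\<in>A. poly_mean (f x))"
  by (induction A rule: infinite_finite_induct) (auto simp: poly_mean_add)

lemma poly_PL: "poly (PL n) w = sqrt (2 * real n + 1) * poly (legendre_poly n) (w / pi)"
  by (simp add: PL_def poly_pcompose)

lemma coeff_PL: "coeff (PL n) m = sqrt (2 * real n + 1) * coeff (legendre_poly n) m / pi ^ m"
  by (simp add: PL_def coeff_pcompose_linear power_divide)

lemma degree_PL: "degree (PL n) = n"
proof -
  have "sqrt (2 * real n + 1) \<noteq> 0" by (simp add: add_nonneg_eq_0_iff)
  then show ?thesis by (simp add: PL_def degree_pcompose degree_legendre)
qed

lemma PL_moment:
  "poly_mean (monom 1 p * PL n) =
     (if n \<le> p \<and> even (p - n) then sqrt (2 * real n + 1) * pi ^ p * 2 ^ n * fact p *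
        fact (n + (p - n) div 2) / (fact ((p - n) div 2) * fact (n + p + 1)) else 0)"
proof -
  have "pcompose (PL n) [:0, pi:] = smult (sqrt (2 * real n + 1)) (legendre_poly n)"
    by (rule poly_eq_poly_eq_iff[THEN iffD1]) (auto simp: poly_pcompose poly_PL)
  moreover have "pcompose (monom 1 p) [:0, pi:] = smult (pi ^ p) (monom 1 p)"
    by (rule poly_eq_poly_eq_iff[THEN iffD1]) (auto simp: poly_pcompose poly_monom power_mult_distrib)
  ultimately show ?thesis
    by (auto simp: poly_mean_def pcompose_mult poly_int_smult legendre_moment)
qed

text \<open>Expanding the factor of lower degree into monomials leaves only moments of order below
  n, which vanish. On the diagonal just the leading coefficient times the n-th moment
  survives.\<close>

lemma PL_orthonormal: "poly_mean (PL m * PL n) = (if m = n then 1 else 0)"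
proof -
  have less: "poly_mean (PL m * PL n) = 0" if "m < n" for m n
  proof -
    have "PL m * PL n = (\<Sum>i\<le>m. smult (coeff (PL m) i) (monom 1 i * PL n))"
      by (subst (1) poly_as_sum_of_monoms[symmetric])
        (simp add: degree_PL sum_distrib_right smult_monom flip: mult_smult_left)
    also have "poly_mean \<dots> = 0"
      using that by (simp add: poly_mean_sum poly_mean_smult PL_moment)
    finally show ?thesis .
  qed
  have eq: "poly_mean (PL n * PL n) = 1"
  proof -
    have "PL n * PL n = (\<Sum>i\<le>n. smult (coeff (PL n) i) (monom 1 i * PL n))"
      by (subst (1) poly_as_sum_of_monoms[symmetric])
        (simp add: degree_PL sum_distrib_right smult_monom flip: mult_smult_left)
    also have "poly_mean \<dots> = (\<Sum>i\<le>n. coeff (PL n) i * poly_mean (monom 1 i * PL n))"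
      by (simp add: poly_mean_sum poly_mean_smult)
    also have "\<dots> = (\<Sum>i\<in>{n}. coeff (PL n) i * poly_mean (monom 1 i * PL n))"
      by (rule sum.mono_neutral_right) (auto simp: PL_moment)
    also have "\<dots> = (sqrt (2 * real n + 1))\<^sup>2 * fact (n + n) / fact (n + n + 1)"
      by (simp add: coeff_PL coeff_legendre PL_moment power2_eq_square)
    also have "\<dots> = 1"
    proof -
      have "fact (n + n + 1) = (2 * real n + 1) * fact (n + n)" by simp
      moreover have "(2 * real n + 1) * fact (n + n) > 0" by (intro mult_pos_pos) auto
      ultimately show ?thesis by (simp del: fact_Suc)
    qed
    finally show ?thesis .
  qed
  show ?thesis
    using less[of m n] less[of n m] eq by (cases m n rule: linorder_cases) (auto simp: mult.commute)
qed

text \<open>Since \<open>PL n\<close> has exact degree n, removing leading terms one by one yields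
  some expansion; orthonormality then identifies its coefficients.\<close>

lemma PL_expansion:
  assumes "degree q \<le> p"
  shows "q = (\<Sum>n\<le>p. smult (poly_mean (q * PL n)) (PL n))"
proof -
  have "\<exists>c. q = (\<Sum>n\<le>p. smult (c n) (PL n))"
    using assms
  proof (induction p arbitrary: q)
    case 0
    then obtain a where q: "q = [:a:]" by (metis degree_eq_zeroE le_zero_eq)
    have "degree (PL 0) = 0" by (simp add: degree_PL)
    then obtain b where b: "PL 0 = [:b:]" by (metis degree_eq_zeroE)
    have "coeff (PL 0) 0 = 1" by (simp add: coeff_PL coeff_legendre)
    then have "PL 0 = 1" using b by (simp add: one_pCons)
    then show ?case using q by (intro exI[of _ "\<lambda>_. a"]) simp
  next
    case (Suc p)
    have nz: "coeff (PL (Suc p)) (Suc p) \<noteq> 0"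
      using degree_PL[of "Suc p"] leading_coeff_0_iff[of "PL (Suc p)"] by fastforce
    define r where "r = q - smult (coeff q (Suc p) / coeff (PL (Suc p)) (Suc p)) (PL (Suc p))"
    have "degree r \<le> p"
    proof (rule degree_le, intro allI impI)
      fix i assume "p < i"
      then consider "i = Suc p" | "i > Suc p" by linarith
      then show "coeff r i = 0"
        using Suc.prems nz by cases (auto simp: r_def coeff_eq_0 degree_PL)
    qed
    then obtain c where c: "r = (\<Sum>n\<le>p. smult (c n) (PL n))" using Suc.IH by blast
    define c' where "c' = c(Suc p := coeff q (Suc p) / coeff (PL (Suc p)) (Suc p))"
    have "(\<Sum>n\<le>Suc p. smult (c' n) (PL n)) = r + (q - r)"
      unfolding c by (simp add: c'_def) (simp add: r_def flip: c)
    then show ?case by (intro exI[of _ c']) simp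
  qed
  then obtain c where c: "q = (\<Sum>n\<le>p. smult (c n) (PL n))" by blast
  have "poly_mean (q * PL m) = c m" if "m \<le> p" for m
  proof -
    have "poly_mean (q * PL m) = (\<Sum>n\<le>p. c n * (if n = m then 1 else 0))"
      unfolding c by (simp add: sum_distrib_right poly_mean_sum poly_mean_smult PL_orthonormal)
    then show ?thesis using that by (simp add: mult_delta_right)
  qed
  then show ?thesis using c by simp
qed

text \<open>The triangular matrices of moments and of coefficients are inverse to each other; this
  is what collapses the double series to the Taylor series of f.\<close>

lemma PL_moment_coeff_sum:
  assumes "m \<le> p"
  shows "(\<Sum>n\<le>p. poly_mean (monom 1 p * PL n) * coeff (PL n) m) = (if m = p then 1 else 0)"
proof -
  have "coeff (monom 1 p) m = coeff (\<Sum>n\<le>p. smult (poly_mean (monom 1 p * PL n)) (PL n)) m"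
    using PL_expansion[of "monom 1 p" p] by (simp add: degree_monom_eq)
  then show ?thesis by (auto simp: coeff_sum)
qed

section \<open>Fourier integrals of compactly supported functions\<close>

text \<open>The kernel is that of the inverse transform, without the factor 1/(2 pi). The argument
  is complex because compact support of \<open>G\<close> makes the integral entire.\<close>

definition fourier_int :: "(real \<Rightarrow> complex) \<Rightarrow> complex \<Rightarrow> complex" where
  "fourier_int G z = (LINT w|lborel. G w * exp (\<i> * of_real w * z))"

text \<open>The bound on \<open>g\<close> is asked only where \<open>f\<close> is nonzero: for
  complex z, exp(i w z) is bounded on the support but not on the line.\<close>

lemma integrable_mult_bounded:
  fixes f g :: "'a \<Rightarrow> complex"
  assumes "integrable M f" "g \<in> borel_measurable M" "\<And>x. f x \<noteq> 0 \<Longrightarrow> cmod (g x) \<le> B"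
  shows "integrable M (\<lambda>x. f x * g x)"
proof (rule Bochner_Integration.integrable_bound)
  show "integrable M (\<lambda>x. B * cmod (f x))" using assms by simp
  show "(\<lambda>x. f x * g x) \<in> borel_measurable M" using assms by measurable
  show "AE x in M. norm (f x * g x) \<le> norm (B * cmod (f x))"
  proof (rule AE_I2)
    fix x
    show "norm (f x * g x) \<le> norm (B * cmod (f x))"
    proof (cases "f x = 0")
      case False
      then have *: "cmod (g x) \<le> B" using assms(3) by blast
      then have "0 \<le> B" using norm_ge_zero order_trans by blast
      then show ?thesis using mult_left_mono[OF *, of "cmod (f x)"] by (simp add: norm_mult abs_mult mult.commute)
    qed simp
  qed
qed

lemma integrable_fourier:
  assumes "integrable lborel G" "\<forall>w. w \<notin> {-A..A} \<longrightarrow> G w = 0"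
  shows "integrable lborel (\<lambda>w. G w * exp (\<i> * of_real w * z))"
proof (rule integrable_mult_bounded[OF assms(1), where B = "exp (A * cmod z)"])
  fix w assume "G w \<noteq> 0"
  then have "w \<in> {-A..A}" using assms(2) by blast
  then have "\<bar>w\<bar> \<le> A" by auto
  then have "\<bar>w\<bar> * cmod z \<le> A * cmod z" by (intro mult_right_mono) auto
  then show "cmod (exp (\<i> * of_real w * z)) \<le> exp (A * cmod z)"
    by (intro order_trans[OF norm_exp]) (simp add: norm_mult)
qed simp

text \<open>Expand exp(i w h) and integrate termwise. On the support the p-th term is at most (|A|
  |h|)^p / p! times an integrable function, which justifies the exchange.\<close>

lemma fourier_int_sums:
  assumes int: "integrable lborel G" and supp: "\<forall>w. w \<notin> {-A..A} \<longrightarrow> G w = 0"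
  shows "(\<lambda>p. \<i> ^ p * (LINT w|lborel. of_real w ^ p * (G w * exp (\<i> * of_real w * z))) / fact p * h ^ p)
           sums fourier_int G (z + h)"
proof -
  define E where "E w = G w * exp (\<i> * of_real w * z)" for w
  have E: "integrable lborel E" unfolding E_def by (rule integrable_fourier[OF assms])
  have E0: "E w = 0" if "w \<notin> {-A..A}" for w using supp that by (simp add: E_def)
  define f where "f p w = (\<i> * of_real w * h) ^ p / fact p * E w" for p w
  have bd: "norm (f p w) \<le> (\<bar>A\<bar> * cmod h) ^ p / fact p * cmod (E w)" for p w
  proof (cases "E w = 0")
    case False
    then have "\<bar>w\<bar> \<le> \<bar>A\<bar>" using E0[of w] by fastforce
    then have "(\<bar>w\<bar> * cmod h) ^ p \<le> (\<bar>A\<bar> * cmod h) ^ p"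
      by (intro power_mono mult_right_mono) auto
    then show ?thesis
      by (simp add: f_def norm_mult norm_divide norm_power mult_right_mono divide_right_mono)
  qed (simp add: f_def)
  have fint: "integrable lborel (f p)" for p
  proof (rule Bochner_Integration.integrable_bound)
    show "integrable lborel (\<lambda>w. (\<bar>A\<bar> * cmod h) ^ p / fact p * cmod (E w))" using E by simp
    show "f p \<in> borel_measurable lborel" unfolding f_def using E by measurable
    show "AE w in lborel. norm (f p w) \<le> norm ((\<bar>A\<bar> * cmod h) ^ p / fact p * cmod (E w))"
      using bd by (intro AE_I2 order_trans[OF bd]) (simp add: abs_mult)
  qed
  have "(\<lambda>p. integral\<^sup>L lborel (f p)) sums (LINT w|lborel. (\<Sum>p. f p w))"
  proof (rule sums_integral[OF fint])
    show "AE w in lborel. summable (\<lambda>p. norm (f p w))"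
    proof (rule AE_I2)
      fix w
      have "summable (\<lambda>p. (\<bar>A\<bar> * cmod h) ^ p / fact p * cmod (E w))"
        using summable_exp[of "\<bar>A\<bar> * cmod h"] by (intro summable_mult2) (simp add: divide_inverse mult.commute)
      then show "summable (\<lambda>p. norm (f p w))"
        by (rule summable_comparison_test[rotated]) (use bd in auto)
    qed
    have "summable (\<lambda>p. (\<bar>A\<bar> * cmod h) ^ p / fact p * (LINT w|lborel. cmod (E w)))"
      using summable_exp[of "\<bar>A\<bar> * cmod h"] by (intro summable_mult2) (simp add: divide_inverse mult.commute)
    then show "summable (\<lambda>p. LINT w|lborel. norm (f p w))"
    proof (rule summable_comparison_test[rotated], intro exI allI impI)
      fix p
      have "(LINT w|lborel. norm (f p w)) \<le> (LINT w|lborel. (\<bar>A\<bar> * cmod h) ^ p / fact p * cmod (E w))"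
        using fint E bd by (intro integral_mono) auto
      then show "norm (LINT w|lborel. norm (f p w)) \<le> (\<bar>A\<bar> * cmod h) ^ p / fact p * (LINT w|lborel. cmod (E w))"
        by (simp add: integral_nonneg_AE)
    qed
  qed
  moreover have "(\<Sum>p. f p w) = G w * exp (\<i> * of_real w * (z + h))" for w
  proof -
    have "(\<lambda>p. (\<i> * of_real w * h) ^ p / fact p) sums exp (\<i> * of_real w * h)"
      using exp_converges[of "\<i> * of_real w * h"] by (simp add: scaleR_conv_of_real field_simps)
    then have "(\<lambda>p. f p w) sums (exp (\<i> * of_real w * h) * E w)"
      unfolding f_def by (rule sums_mult2)
    then show ?thesis by (simp add: sums_iff E_def exp_add algebra_simps)
  qed
  moreover have "integral\<^sup>L lborel (f p) = \<i> ^ p * (LINT w|lborel. of_real w ^ p * E w) / fact p * h ^ p" for p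
  proof -
    have "f p = (\<lambda>w. (\<i> ^ p / fact p * h ^ p) * (of_real w ^ p * E w))"
      by (auto simp: f_def power_mult_distrib)
    then show ?thesis by simp
  qed
  ultimately show ?thesis unfolding E_def fourier_int_def by simp
qed

text \<open>In formal power series form the Taylor expansion yields all higher derivatives, by
  comparison of coefficients, as well as holomorphy.\<close>

lemma fourier_int_expansion:
  assumes "integrable lborel G" "\<forall>w. w \<notin> {-A..A} \<longrightarrow> G w = 0"
  shows "(\<lambda>h. fourier_int G (z + h)) has_fps_expansion
     Abs_fps (\<lambda>p. \<i> ^ p * (LINT w|lborel. of_real w ^ p * (G w * exp (\<i> * of_real w * z))) / fact p)"
    (is "_ has_fps_expansion Abs_fps ?a")
proof -
  have "conv_radius ?a = \<infinity>"
    using fourier_int_sums[OF assms, where z = z] by (intro conv_radius_inftyI'') (auto simp: sums_iff)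
  moreover have "eval_fps (Abs_fps ?a) h = fourier_int G (z + h)" for h
    using fourier_int_sums[OF assms, where z = z and h = h] by (simp add: eval_fps_def sums_iff)
  ultimately show ?thesis
    by (simp add: has_fps_expansion_def fps_conv_radius_def)
qed

lemma higher_deriv_fourier_int:
  assumes "integrable lborel G" "\<forall>w. w \<notin> {-A..A} \<longrightarrow> G w = 0"
  shows "(deriv ^^ k) (fourier_int G) z =
           \<i> ^ k * (LINT w|lborel. of_real w ^ k * (G w * exp (\<i> * of_real w * z)))"
  using fps_nth_fps_expansion[OF fourier_int_expansion[OF assms, where z = z], of k]
  by (simp add: higher_deriv_shift_0[of k "fourier_int G" z] o_def)

lemma holomorphic_fourier_int:
  assumes "integrable lborel G" "\<forall>w. w \<notin> {-A..A} \<longrightarrow> G w = 0"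
  shows "fourier_int G holomorphic_on UNIV"
proof -
  have "fourier_int G field_differentiable at z" for z
  proof -
    obtain s where s: "open s" "0 \<in> s" "(\<lambda>h. fourier_int G (z + h)) holomorphic_on s"
      by (rule has_fps_expansion_imp_holomorphic[OF fourier_int_expansion[OF assms, where z = z]])
    then obtain D where "((\<lambda>h. fourier_int G (z + h)) has_field_derivative D) (at 0)"
      using holomorphic_on_imp_differentiable_at[OF s(3) s(1) s(2)] unfolding field_differentiable_def by auto
    then show ?thesis
      unfolding field_differentiable_def using DERIV_shift[of "fourier_int G" D 0 z]
      by (auto simp: add.commute)
  qed
  then show ?thesis by (simp add: holomorphic_on_def field_differentiable_at_within)
qed

lemma integrable_fourier_power:
  assumes "integrable lborel G" "\<forall>w. w \<notin> {-A..A} \<longrightarrow> G w = 0"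
  shows "integrable lborel (\<lambda>w. of_real w ^ k * (G w * exp (\<i> * of_real w * z)))"
proof -
  have "integrable lborel (\<lambda>w. (G w * exp (\<i> * of_real w * z)) * of_real w ^ k)"
  proof (rule integrable_mult_bounded[OF integrable_fourier[OF assms], where B = "\<bar>A\<bar> ^ k"])
    fix w assume "G w * exp (\<i> * of_real w * z) \<noteq> 0"
    then have "w \<in> {-A..A}" using assms(2) by fastforce
    then have "\<bar>w\<bar> \<le> \<bar>A\<bar>" by auto
    then show "cmod (of_real w ^ k) \<le> \<bar>A\<bar> ^ k" by (simp add: norm_power power_mono)
  qed auto
  then show ?thesis by (simp add: mult.commute)
qed

text \<open>\<open>PL n\<close> has the parity of n: where k and n differ in parity the coefficient
  is 0.\<close>

lemma minus_one_power_coeff_PL: "(-1) ^ k * coeff (PL n) k = (-1) ^ n * coeff (PL n) k"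
  by (auto simp: coeff_PL coeff_legendre minus_one_power_iff)

text \<open>On exp(i w t) the operator i d/dt acts as multiplication by -w, so the symbol is (-i)^n
  P_n(-w), which parity turns into i^n P_n(w).\<close>

lemma chromatic_deriv_fourier_int:
  assumes "integrable lborel G" "\<forall>w. w \<notin> {-A..A} \<longrightarrow> G w = 0"
  shows "chromatic_deriv n (fourier_int G) u =
     \<i> ^ n * (LINT w|lborel. of_real (poly (PL n) w) * (G w * exp (\<i> * of_real w * u)))"
proof -
  let ?I = "\<lambda>k. LINT w|lborel. of_real w ^ k * (G w * exp (\<i> * of_real w * u))"
  have "chromatic_deriv n (fourier_int G) u =
      (- \<i>) ^ n * (\<Sum>k\<le>degree (PL n). of_real ((-1) ^ k * coeff (PL n) k) * ?I k)"
  proof -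
    have "\<i> ^ k * \<i> ^ k = (-1) ^ k" for k :: nat by (simp flip: power_mult_distrib)
    then have "of_real c * \<i> ^ k * (\<i> ^ k * I) = of_real ((-1) ^ k * c) * I" for c k I
      by (simp add: mult.assoc[symmetric] mult.commute[of "of_real c"])
    then show ?thesis
      by (simp only: chromatic_deriv_def higher_deriv_fourier_int[OF assms])
  qed
  also have "\<dots> = (- \<i>) ^ n * (-1) ^ n * (\<Sum>k\<le>degree (PL n). of_real (coeff (PL n) k) * ?I k)"
    unfolding minus_one_power_coeff_PL[of _ n]
    unfolding of_real_mult mult.assoc sum_distrib_left[symmetric] by simp
  also have "(- \<i>) ^ n * (-1) ^ n = \<i> ^ n" by (simp flip: power_mult_distrib)
  also have "(\<Sum>k\<le>degree (PL n). of_real (coeff (PL n) k) * ?I k) =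
      (LINT w|lborel. (\<Sum>k\<le>degree (PL n). of_real (coeff (PL n) k) * (of_real w ^ k * (G w * exp (\<i> * of_real w * u)))))"
    by (subst Bochner_Integration.integral_sum) (auto intro!: integrable_mult_right integrable_fourier_power[OF assms])
  also have "\<dots> = (LINT w|lborel. of_real (poly (PL n) w) * (G w * exp (\<i> * of_real w * u)))"
    by (intro Bochner_Integration.integral_cong refl)
      (simp only: poly_altdef of_real_sum of_real_mult of_real_power sum_distrib_right mult.assoc)
  finally show ?thesis .
qed

section \<open>Gaussian integrals and interchange of integrals\<close>

text \<open>After rescaling by \<open>e\<close> this is the characteristic function of the standard
  normal distribution.\<close>

lemma gauss_fourier:
  assumes "e > 0"
  shows "(LINT t|lborel. of_real (exp (- (e * t)\<^sup>2 / 2)) * exp (\<i> * of_real a * of_real t)) =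
           complex_of_real (sqrt (2 * pi) / e * exp (- (a / e)\<^sup>2 / 2))"
proof -
  have "(LINT t|lborel. of_real (exp (- (e * t)\<^sup>2 / 2)) * exp (\<i> * of_real a * of_real t)) =
      (1 / e) *\<^sub>R (LINT x|lborel. of_real (exp (- x\<^sup>2 / 2)) * exp (\<i> * of_real (a / e) * of_real x))"
    using assms by (subst lborel_integral_real_affine[where c = "1 / e" and t = 0])
      (auto simp: field_simps)
  also have "(LINT x|lborel. of_real (exp (- x\<^sup>2 / 2)) * exp (\<i> * of_real (a / e) * of_real x)) =
      sqrt (2 * pi) *\<^sub>R (LINT x|lborel. std_normal_density x *\<^sub>R exp (\<i> * of_real (a / e * x)))"
    by (subst integral_scaleR_right[symmetric])
      (auto simp: std_normal_density_def scaleR_conv_of_real mult_ac)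
  also have "(LINT x|lborel. std_normal_density x *\<^sub>R exp (\<i> * of_real (a / e * x))) = char std_normal_distribution (a / e)"
    unfolding char_def by (subst integral_density) auto
  finally show ?thesis
    by (simp add: char_std_normal_distribution scaleR_conv_of_real)
qed

lemma integrable_gauss:
  assumes "(e::real) > 0"
  shows "integrable lborel (\<lambda>t. exp (- (e * t)\<^sup>2 / 2))"
proof -
  have "integrable lborel (\<lambda>t. sqrt (2 * pi) * std_normal_density t)" by simp
  then have "integrable lborel (\<lambda>t::real. exp (- t\<^sup>2 / 2))"
    by (simp add: std_normal_density_def)
  from lborel_integrable_real_affine[OF this, of e 0] assms show ?thesis by simp
qed

lemma integral_gauss: "(LINT t|lborel. exp (- t\<^sup>2 / 2 :: real)) = sqrt (2 * pi)"
proof -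
  have "(LINT t|lborel. sqrt (2 * pi) * std_normal_density t) = sqrt (2 * pi)" by simp
  then show ?thesis by (simp add: std_normal_density_def)
qed

text \<open>Fubini in the only form used below: the multiplier \<open>m\<close> is always a
  unimodular exponential or its conjugate.\<close>

lemma integral_swap_bounded:
  fixes a b :: "real \<Rightarrow> complex" and m :: "real \<Rightarrow> real \<Rightarrow> complex"
  assumes a: "integrable lborel a" and b: "integrable lborel b"
    and m: "case_prod m \<in> borel_measurable (lborel \<Otimes>\<^sub>M lborel)" and m1: "\<And>x y. cmod (m x y) \<le> 1"
  shows "(LINT x|lborel. a x * (LINT y|lborel. b y * m x y)) = (LINT y|lborel. b y * (LINT x|lborel. a x * m x y))"
    and "integrable lborel (\<lambda>x. a x * (LINT y|lborel. b y * m x y))"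
proof -
  have [measurable]: "a \<in> borel_measurable borel" "b \<in> borel_measurable borel" using a b by auto
  note [measurable] = m
  have int: "integrable (lborel \<Otimes>\<^sub>M lborel) (\<lambda>(x, y). a x * (b y * m x y))"
  proof (rule lborel_pair.Fubini_integrable)
    have mx: "m x \<in> borel_measurable borel" for x
      using measurable_compose[OF measurable_Pair1' m, of x] by (simp add: space_pair_measure)
    have bm: "integrable lborel (\<lambda>y. b y * m x y)" for x
      using mx m1 by (intro integrable_mult_bounded[OF b, where B = 1]) auto
    show "AE x in lborel. integrable lborel (\<lambda>y. case (x, y) of (x, y) \<Rightarrow> a x * (b y * m x y))"
      using bm by auto
    show "(\<lambda>(x, y). a x * (b y * m x y)) \<in> borel_measurable (lborel \<Otimes>\<^sub>M lborel)" by measurable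
    show "integrable lborel (\<lambda>x. LINT y|lborel. norm (case (x, y) of (x, y) \<Rightarrow> a x * (b y * m x y)))"
    proof (rule Bochner_Integration.integrable_bound)
      show "integrable lborel (\<lambda>x. cmod (a x) * (LINT y|lborel. cmod (b y)))" using a by simp
      show "(\<lambda>x. LINT y|lborel. norm (case (x, y) of (x, y) \<Rightarrow> a x * (b y * m x y))) \<in> borel_measurable lborel"
        by measurable
      show "AE x in lborel. norm (LINT y|lborel. norm (case (x, y) of (x, y) \<Rightarrow> a x * (b y * m x y))) \<le>
              norm (cmod (a x) * (LINT y|lborel. cmod (b y)))"
      proof (rule AE_I2)
        fix x
        have "(LINT y|lborel. cmod (b y * m x y)) \<le> (LINT y|lborel. cmod (b y))"
          using m1 by (intro integral_mono integrable_norm bm b) (auto simp: norm_mult mult_left_le)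
        then show "norm (LINT y|lborel. norm (case (x, y) of (x, y) \<Rightarrow> a x * (b y * m x y))) \<le>
              norm (cmod (a x) * (LINT y|lborel. cmod (b y)))"
          by (simp add: norm_mult abs_mult mult_left_mono integral_nonneg_AE)
      qed
    qed
  qed
  show "(LINT x|lborel. a x * (LINT y|lborel. b y * m x y)) = (LINT y|lborel. b y * (LINT x|lborel. a x * m x y))"
  proof -
    have "b y * (LINT x|lborel. a x * m x y) = (LINT x|lborel. a x * (b y * m x y))" for y
      by (subst integral_mult_right_zero[symmetric]) (simp only: mult.left_commute)
    then show ?thesis using lborel_pair.Fubini_integral[OF int] by simp
  qed
  show "integrable lborel (\<lambda>x. a x * (LINT y|lborel. b y * m x y))"
    using lborel_pair.integrable_fst[OF int] by simp
qed

section \<open>Plancherel theorem for compactly supported functions\<close>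

lemma borel_measurable_cnj [measurable]: "cnj \<in> borel_measurable borel"
  by (intro borel_measurable_continuous_onI continuous_intros)

text \<open>The bound \<open>M\<close> supplies the dominating function. Continuity is asked at the
  single point \<open>w\<close>, so jumps of \<open>G\<close> elsewhere are harmless.\<close>

lemma gauss_approx_identity:
  fixes G :: "real \<Rightarrow> complex"
  assumes G: "G \<in> borel_measurable borel" and M: "\<And>w. cmod (G w) \<le> M" and cont: "isCont G w"
  shows "(\<lambda>n. LINT x|lborel. of_real (exp (- x\<^sup>2 / 2)) * G (w + 1 / real (Suc n) * x))
           \<longlonglongrightarrow> of_real (sqrt (2 * pi)) * G w"
proof -
  have "(\<lambda>n. LINT x|lborel. of_real (exp (- x\<^sup>2 / 2)) * G (w + 1 / real (Suc n) * x))
           \<longlonglongrightarrow> (LINT x|lborel. of_real (exp (- x\<^sup>2 / 2)) * G w)"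
  proof (rule integral_dominated_convergence)
    show "integrable lborel (\<lambda>x::real. exp (- x\<^sup>2 / 2) * M)"
      using integrable_gauss[of 1] by simp
    show "AE x in lborel. (\<lambda>n. of_real (exp (- x\<^sup>2 / 2)) * G (w + 1 / real (Suc n) * x))
            \<longlonglongrightarrow> of_real (exp (- x\<^sup>2 / 2)) * G w"
    proof (intro AE_I2 tendsto_intros isCont_tendsto_compose[OF cont])
      fix x :: real
      have "(\<lambda>n. w + 1 / real (Suc n) * x) \<longlonglongrightarrow> w + 0 * x"
        by (intro tendsto_intros LIMSEQ_Suc lim_1_over_n)
      then show "(\<lambda>n. w + 1 / real (Suc n) * x) \<longlonglongrightarrow> w" by simp
    qed
    show "AE x in lborel. norm (of_real (exp (- x\<^sup>2 / 2)) * G (w + 1 / real (Suc n) * x)) \<le> exp (- x\<^sup>2 / 2) * M" for n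
      using M by (simp add: norm_mult)
  qed (use G in measurable)
  moreover have "(LINT x|lborel. of_real (exp (- x\<^sup>2 / 2)) * G w) = of_real (sqrt (2 * pi)) * G w"
    by (simp only: integral_mult_left_zero integral_complex_of_real integral_gauss)
  ultimately show ?thesis by (simp only:)
qed

lemma integrable_bounded_support:
  fixes G :: "real \<Rightarrow> complex"
  assumes "G \<in> borel_measurable borel" "\<forall>w. w \<notin> {-A..A} \<longrightarrow> G w = 0" "\<And>w. cmod (G w) \<le> M"
  shows "integrable lborel G"
proof (rule Bochner_Integration.integrable_bound)
  show "integrable lborel (\<lambda>w. indicator {-A..A} w * M)"
    by (intro integrable_mult_left integrable_real_indicator) (auto simp: emeasure_lborel_Icc_eq)
  have "0 \<le> M" using assms(3) norm_ge_zero order_trans by blast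
  then show "AE w in lborel. norm (G w) \<le> norm (indicator {-A..A} w * M)"
    using assms(2,3) by (auto simp: indicator_def)
qed (use assms in simp)

lemma norm_fourier_int_le:
  "cmod (fourier_int G (of_real t)) \<le> (LINT w|lborel. cmod (G w))"
  unfolding fourier_int_def
  by (rule order_trans[OF integral_norm_bound]) (simp add: norm_mult norm_exp_eq_Re)

lemma continuous_fourier_int_real:
  assumes "integrable lborel G" "\<forall>w. w \<notin> {-A..A} \<longrightarrow> G w = 0"
  shows "continuous_on UNIV (\<lambda>t::real. fourier_int G (of_real t))"
  by (rule continuous_on_compose2[OF holomorphic_on_imp_continuous_on[OF holomorphic_fourier_int[OF assms]]])
     (auto intro!: continuous_intros)

text \<open>The Gaussian weight in time makes the triple integral over t, w, v absolutely
  convergent. Two applications of Fubini then integrate t out first, leaving a Gaussian in (w - v)/e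
  that averages G near w.\<close>

lemma gauss_fourier_energy:
  fixes G :: "real \<Rightarrow> complex"
  assumes G: "integrable lborel G" "\<forall>w. w \<notin> {-A..A} \<longrightarrow> G w = 0" and e: "e > 0"
  shows "complex_of_real (LINT t|lborel. (cmod (fourier_int G (of_real t)))\<^sup>2 * exp (- (e * t)\<^sup>2 / 2)) =
     of_real (sqrt (2 * pi)) * (LINT w|lborel. G w * (LINT x|lborel. of_real (exp (- x\<^sup>2 / 2)) * cnj (G (w + e * x))))"
    and "integrable lborel (\<lambda>t. (cmod (fourier_int G (of_real t)))\<^sup>2 * exp (- (e * t)\<^sup>2 / 2))"
proof -
  define g where "g t = fourier_int G (of_real t)" for t :: real
  define k where "k t = complex_of_real (exp (- (e * t)\<^sup>2 / 2))" for t
  define m where "m t w = exp (\<i> * of_real w * of_real t)" for t w :: real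
  have [measurable]: "g \<in> borel_measurable borel"
    unfolding g_def by (intro borel_measurable_continuous_onI continuous_fourier_int_real[OF G])
  have gb: "cmod (g t) \<le> (LINT w|lborel. cmod (G w))" for t
    unfolding g_def by (rule norm_fourier_int_le)
  have kint: "integrable lborel k"
    unfolding k_def by (intro integrable_of_real integrable_gauss e)
  have b: "integrable lborel (\<lambda>t. k t * cnj (g t))"
    using gb by (intro integrable_mult_bounded[OF kint]) auto
  have m1: "cmod (m t w) \<le> 1" "cmod (m t w) = 1" for t w
    by (simp_all add: m_def norm_exp_eq_Re)
  have mm [measurable]: "case_prod m \<in> borel_measurable (lborel \<Otimes>\<^sub>M lborel)"
    unfolding m_def by measurable
  have int2: "integrable lborel (\<lambda>t. k t * cnj (g t) * g t)"
    using gb by (intro integrable_mult_bounded[OF b]) auto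
  have sq: "k t * cnj (g t) * g t = of_real ((cmod (g t))\<^sup>2 * exp (- (e * t)\<^sup>2 / 2))" for t
    by (simp add: k_def complex_norm_square mult_ac del: of_real_power)
  show "integrable lborel (\<lambda>t. (cmod (fourier_int G (of_real t)))\<^sup>2 * exp (- (e * t)\<^sup>2 / 2))"
    using int2 unfolding sq g_def[symmetric] by (simp only: complex_of_real_integrable_eq)
  have inner: "(LINT t|lborel. k t * cnj (g t) * m t w) =
      of_real (sqrt (2 * pi)) * (LINT x|lborel. of_real (exp (- x\<^sup>2 / 2)) * cnj (G (w + e * x)))" for w
  proof -
    have cg: "cnj (g t) = (LINT v|lborel. cnj (G v) * cnj (m t v))" for t
      unfolding g_def fourier_int_def m_def Bochner_Integration.integral_cnj[symmetric] complex_cnj_mult by (rule refl)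
    \<comment> \<open>The phases combine to exp(i (w - v) t), so this is the transform of a Gaussian
      at w - v.\<close>
    have kernel: "(LINT t|lborel. k t * m t w * cnj (m t v)) =
        of_real (sqrt (2 * pi) / e * exp (- ((w - v) / e)\<^sup>2 / 2))" for v
      unfolding gauss_fourier[OF e, symmetric]
      by (simp add: k_def m_def exp_cnj mult.assoc flip: exp_add) (simp add: algebra_simps)
    have "integrable lborel (\<lambda>t. k t * m t w)"
      using m1 unfolding m_def by (intro integrable_mult_bounded[OF kint]) auto
    then have "(LINT t|lborel. k t * m t w * (LINT v|lborel. cnj (G v) * cnj (m t v))) =
        (LINT v|lborel. cnj (G v) * (LINT t|lborel. k t * m t w * cnj (m t v)))"
      using G m1 by (intro integral_swap_bounded(1)) auto
    also have "\<dots> = (LINT v|lborel. cnj (G v) * of_real (sqrt (2 * pi) / e * exp (- ((w - v) / e)\<^sup>2 / 2)))"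
      by (simp only: kernel)
    also have "\<dots> =
        of_real (sqrt (2 * pi)) * (LINT x|lborel. of_real (exp (- x\<^sup>2 / 2)) * cnj (G (w + e * x)))"
    proof -
      \<comment> \<open>Substitution v = w + e x; its Jacobian e cancels the 1/e of the
        kernel.\<close>
      have "cnj (G (w + e * x)) * of_real (sqrt (2 * pi) / e * exp (- ((w - (w + e * x)) / e)\<^sup>2 / 2)) =
          of_real (sqrt (2 * pi) / e) * (of_real (exp (- x\<^sup>2 / 2)) * cnj (G (w + e * x)))" for x
        using e by simp
      then show ?thesis
        using e by (subst lborel_integral_real_affine[where c = e and t = w])
          (simp_all only: integral_mult_right_zero, simp_all add: scaleR_conv_of_real)
    qed
    finally show ?thesis by (simp add: cg mult_ac)
  qed
  have "complex_of_real (LINT t|lborel. (cmod (g t))\<^sup>2 * exp (- (e * t)\<^sup>2 / 2)) =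
      (LINT t|lborel. k t * cnj (g t) * g t)"
    unfolding sq by (simp only: integral_complex_of_real)
  also have "\<dots> = (LINT t|lborel. k t * cnj (g t) * (LINT w|lborel. G w * m t w))"
    by (simp add: g_def fourier_int_def m_def)
  also have "\<dots> = (LINT w|lborel. G w * (LINT t|lborel. k t * cnj (g t) * m t w))"
    by (rule integral_swap_bounded(1)[OF b G(1) mm m1(1)])
  also have "\<dots> = of_real (sqrt (2 * pi)) * (LINT w|lborel. G w * (LINT x|lborel. of_real (exp (- x\<^sup>2 / 2)) * cnj (G (w + e * x))))"
    unfolding inner by (simp only: mult.left_commute[of _ "complex_of_real (sqrt (2 * pi))"] integral_mult_right_zero)
  finally show "complex_of_real (LINT t|lborel. (cmod (fourier_int G (of_real t)))\<^sup>2 * exp (- (e * t)\<^sup>2 / 2)) =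
     of_real (sqrt (2 * pi)) * (LINT w|lborel. G w * (LINT x|lborel. of_real (exp (- x\<^sup>2 / 2)) * cnj (G (w + e * x))))"
    by (simp only: g_def)
qed

text \<open>The Gaussian factor is removed by dominated convergence on the frequency side and by monotone
  convergence on the time side.\<close>
lemma plancherel_bounded_support:
  fixes G :: "real \<Rightarrow> complex"
  assumes G: "G \<in> borel_measurable borel" "\<forall>w. w \<notin> {-A..A} \<longrightarrow> G w = 0" "\<And>w. cmod (G w) \<le> M"
    and cont: "AE w in lborel. isCont G w"
  shows "(\<integral>\<^sup>+t. ennreal ((cmod (fourier_int G (of_real t)))\<^sup>2) \<partial>lborel) =
           ennreal (2 * pi * (LINT w|lborel. (cmod (G w))\<^sup>2))"
proof -
  have int: "integrable lborel G" by (rule integrable_bounded_support[OF G])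
  have cont_g: "continuous_on UNIV (\<lambda>t::real. fourier_int G (of_real t))"
    by (rule continuous_fourier_int_real[OF int G(2)])
  have [measurable]: "(\<lambda>t::real. fourier_int G (of_real t)) \<in> borel_measurable borel"
    by (rule borel_measurable_continuous_onI[OF cont_g])
  define J where "J n = (LINT t|lborel. (cmod (fourier_int G (of_real t)))\<^sup>2 * exp (- (1 / real (Suc n) * t)\<^sup>2 / 2))" for n
  define I where "I n w = (LINT x|lborel. of_real (exp (- x\<^sup>2 / 2)) * cnj (G (w + 1 / real (Suc n) * x)))" for n w
  have Ilim: "AE w in lborel. (\<lambda>n. I n w) \<longlonglongrightarrow> of_real (sqrt (2 * pi)) * cnj (G w)"
    using cont
  proof eventually_elim
    case (elim w)
    then have "isCont (\<lambda>w. cnj (G w)) w" by (intro continuous_intros)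
    then show ?case
      unfolding I_def using G by (intro gauss_approx_identity) auto
  qed
  have Ibd: "cmod (I n w) \<le> sqrt (2 * pi) * M" for n w
  proof -
    have "cmod (I n w) \<le> (LINT x|lborel. exp (- x\<^sup>2 / 2) * M)"
      unfolding I_def
    proof (rule order_trans[OF integral_norm_bound], rule integral_mono[OF integrable_norm])
      show i: "integrable lborel (\<lambda>x::real. exp (- x\<^sup>2 / 2) * M)"
        using integrable_gauss[of 1] by simp
      show "integrable lborel (\<lambda>x. of_real (exp (- x\<^sup>2 / 2)) * cnj (G (w + 1 / real (Suc n) * x)))"
        using G integrable_of_real[OF integrable_gauss[of 1]] by (intro integrable_mult_bounded[where B = M]) auto
      show "\<And>x. norm (of_real (exp (- x\<^sup>2 / 2)) * cnj (G (w + 1 / real (Suc n) * x))) \<le> exp (- x\<^sup>2 / 2) * M"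
        using G by (simp add: norm_mult)
    qed
    then show ?thesis using integral_gauss by simp
  qed
  have "(\<lambda>n. LINT w|lborel. G w * I n w) \<longlonglongrightarrow> (LINT w|lborel. G w * (of_real (sqrt (2 * pi)) * cnj (G w)))"
  proof (rule integral_dominated_convergence)
    show "integrable lborel (\<lambda>w. cmod (G w) * (sqrt (2 * pi) * M))" using int by simp
    show "AE w in lborel. (\<lambda>n. G w * I n w) \<longlonglongrightarrow> G w * (of_real (sqrt (2 * pi)) * cnj (G w))"
      using Ilim by eventually_elim (intro tendsto_intros)
    show "AE w in lborel. norm (G w * I n w) \<le> cmod (G w) * (sqrt (2 * pi) * M)" for n
      using Ibd by (simp add: norm_mult mult_left_mono)
    show "(\<lambda>w. G w * (of_real (sqrt (2 * pi)) * cnj (G w))) \<in> borel_measurable lborel" using G by measurable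
    show "(\<lambda>w. G w * I n w) \<in> borel_measurable lborel" for n
      unfolding I_def using G(1) by measurable
  qed
  then have "(\<lambda>n. complex_of_real (J n)) \<longlonglongrightarrow>
      of_real (sqrt (2 * pi)) * (LINT w|lborel. G w * (of_real (sqrt (2 * pi)) * cnj (G w)))"
    unfolding J_def I_def by (subst gauss_fourier_energy(1)[OF int G(2)]) (auto intro!: tendsto_intros)
  also have "(LINT w|lborel. G w * (of_real (sqrt (2 * pi)) * cnj (G w))) =
      (LINT w|lborel. of_real (sqrt (2 * pi)) * complex_of_real ((cmod (G w))\<^sup>2))"
    by (simp add: complex_norm_square mult_ac del: of_real_power)
  also have "\<dots> = of_real (sqrt (2 * pi) * (LINT w|lborel. (cmod (G w))\<^sup>2))"
    by (simp only: integral_mult_right_zero integral_complex_of_real of_real_mult)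
  also have "of_real (sqrt (2 * pi)) * complex_of_real (sqrt (2 * pi) * (LINT w|lborel. (cmod (G w))\<^sup>2)) =
      of_real (2 * pi * (LINT w|lborel. (cmod (G w))\<^sup>2))"
    by (simp flip: of_real_mult mult.assoc)
  finally have "J \<longlonglongrightarrow> 2 * pi * (LINT w|lborel. (cmod (G w))\<^sup>2)"
    by (simp only: tendsto_of_real_iff)
  then have "(\<lambda>n. ennreal (J n)) \<longlonglongrightarrow> ennreal (2 * pi * (LINT w|lborel. (cmod (G w))\<^sup>2))"
    by (rule tendsto_ennrealI)
  moreover have "ennreal (J n) = (\<integral>\<^sup>+t. ennreal ((cmod (fourier_int G (of_real t)))\<^sup>2 * exp (- (1 / real (Suc n) * t)\<^sup>2 / 2)) \<partial>lborel)" for n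
    unfolding J_def by (intro nn_integral_eq_integral[symmetric] gauss_fourier_energy(2)[OF int G(2)]) auto
  moreover have "(\<lambda>n. \<integral>\<^sup>+t. ennreal ((cmod (fourier_int G (of_real t)))\<^sup>2 * exp (- (1 / real (Suc n) * t)\<^sup>2 / 2)) \<partial>lborel)
      \<longlonglongrightarrow> (\<integral>\<^sup>+t. ennreal ((cmod (fourier_int G (of_real t)))\<^sup>2) \<partial>lborel)"
  proof (rule nn_integral_LIMSEQ)
    show "incseq (\<lambda>n t. ennreal ((cmod (fourier_int G (of_real t)))\<^sup>2 * exp (- (1 / real (Suc n) * t)\<^sup>2 / 2)))"
    proof (rule incseq_SucI, rule le_funI, rule ennreal_leI, rule mult_left_mono)
      fix n and t :: real
      have "(1 / real (Suc (Suc n)) * t)\<^sup>2 \<le> (1 / real (Suc n) * t)\<^sup>2"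
        unfolding power_mult_distrib by (intro power_mono mult_right_mono) (auto simp: field_simps)
      then show "exp (- (1 / real (Suc n) * t)\<^sup>2 / 2) \<le> exp (- (1 / real (Suc (Suc n)) * t)\<^sup>2 / 2)"
        by simp
    qed auto
    fix t :: real
    have "(\<lambda>n. (cmod (fourier_int G (of_real t)))\<^sup>2 * exp (- (1 / real (Suc n) * t)\<^sup>2 / 2)) \<longlonglongrightarrow>
        (cmod (fourier_int G (of_real t)))\<^sup>2 * exp (- (0 * t)\<^sup>2 / 2)"
      by (intro tendsto_intros LIMSEQ_Suc lim_1_over_n) auto
    then show "(\<lambda>n. ennreal ((cmod (fourier_int G (of_real t)))\<^sup>2 * exp (- (1 / real (Suc n) * t)\<^sup>2 / 2))) \<longlonglongrightarrow>
        ennreal ((cmod (fourier_int G (of_real t)))\<^sup>2)"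
      by (intro tendsto_ennrealI) simp
  qed measurable
  ultimately show ?thesis
    by (metis (no_types, lifting) LIMSEQ_unique ext)
qed

section \<open>Truncated continuous functions\<close>

text \<open>Used on both sides of the transform: to restrict densities to the band, and to truncate
  signals to [-T, T] in time.\<close>

definition cutoff :: "real \<Rightarrow> (real \<Rightarrow> complex) \<Rightarrow> real \<Rightarrow> complex" where
  "cutoff A k w = indicator {-A..A} w *\<^sub>R k w"

text \<open>Exactly the hypotheses of the Plancherel lemma. Discontinuities can occur only at the
  two endpoints, a null set.\<close>

lemma cutoff_facts:
  assumes k: "continuous_on UNIV k"
  shows "cutoff A k \<in> borel_measurable borel" "\<forall>w. w \<notin> {-A..A} \<longrightarrow> cutoff A k w = 0"
    "\<exists>M. \<forall>w. cmod (cutoff A k w) \<le> M" "AE w in lborel. isCont (cutoff A k) w"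
    "integrable lborel (cutoff A k)"
proof -
  have [measurable]: "k \<in> borel_measurable borel" by (rule borel_measurable_continuous_onI[OF k])
  show m: "cutoff A k \<in> borel_measurable borel" unfolding cutoff_def by measurable
  show s: "\<forall>w. w \<notin> {-A..A} \<longrightarrow> cutoff A k w = 0" by (simp add: cutoff_def)
  have "compact (k ` {-A..A})"
    by (intro compact_continuous_image continuous_on_subset[OF k]) auto
  then obtain M where M: "\<And>w. w \<in> {-A..A} \<Longrightarrow> cmod (k w) \<le> M"
    using compact_imp_bounded bounded_iff by (metis imageI)
  have b: "cmod (cutoff A k w) \<le> \<bar>M\<bar>" for w
    using M[of w] by (auto simp: cutoff_def indicator_def)
  then show "\<exists>M. \<forall>w. cmod (cutoff A k w) \<le> M" by blast
  show "integrable lborel (cutoff A k)"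
    by (rule integrable_bounded_support[OF m s b])
  have "AE w in lborel. w \<notin> {-A, A}"
    by (intro AE_not_in) (simp add: finite_imp_null_set_lborel)
  then show "AE w in lborel. isCont (cutoff A k) w"
  proof eventually_elim
    case (elim w)
    have kc: "isCont k w" using k by (simp add: continuous_on_eq_continuous_at)
    consider "w \<in> {-A<..<A}" | "w \<in> {..<-A} \<union> {A<..}" using elim by fastforce
    then show ?case
    proof cases
      case 1
      then have "eventually (\<lambda>x. x \<in> {-A<..<A}) (nhds w)" by (intro eventually_nhds_in_open) auto
      then have "eventually (\<lambda>x. cutoff A k x = k x) (nhds w)"
        by eventually_elim (auto simp: cutoff_def)
      then show ?thesis using kc by (simp add: isCont_cong)
    next
      case 2
      then have "eventually (\<lambda>x. x \<in> {..<-A} \<union> {A<..}) (nhds w)" by (intro eventually_nhds_in_open) auto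
      then have "eventually (\<lambda>x. cutoff A k x = 0) (nhds w)"
        by eventually_elim (auto simp: cutoff_def)
      then show ?thesis by (simp add: isCont_cong)
    qed
  qed
qed

lemma plancherel_cutoff:
  assumes "continuous_on UNIV k"
  shows "(\<integral>\<^sup>+t. ennreal ((cmod (fourier_int (cutoff A k) (of_real t)))\<^sup>2) \<partial>lborel) =
           ennreal (2 * pi * (LINT w|lborel. (cmod (cutoff A k w))\<^sup>2))"
  using plancherel_bounded_support cutoff_facts[OF assms] by blast

section \<open>Band-limited functions: membership and Fourier inversion\<close>

lemma integral_eq_of_nn_integral_eq:
  fixes f :: "'a \<Rightarrow> real"
  assumes "f \<in> borel_measurable M" "\<And>x. 0 \<le> f x" "0 \<le> c" "(\<integral>\<^sup>+x. ennreal (f x) \<partial>M) = ennreal c"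
  shows "integrable M f" "integral\<^sup>L M f = c"
  using nn_integral_eq_integrable[of f M c] assms by auto

text \<open>The truncated integrals that define the transform are themselves Fourier integrals of
  cutoffs, at the reflected frequency, so Plancherel applies to them.\<close>

lemma fourier_truncation:
  "(LINT t:{-T..T}|lborel. g t * exp (- \<i> * of_real w * of_real t)) = fourier_int (cutoff T g) (of_real (- w))"
  unfolding set_lebesgue_integral_def fourier_int_def cutoff_def
  by (intro Bochner_Integration.integral_cong refl) (simp add: mult_ac)

text \<open>Plancherel for the truncated time signal and for \<open>G\<close> itself, together with the cross term, give
  the squared distance of the truncated transform from \<open>2\<pi> G\<close> as \<open>4\<pi>\<^sup>2 E - 2\<pi> I(T)\<close>, where
  \<open>E\<close> and \<open>I(T)\<close> are the energies of \<open>G\<close> and of the signal on \<open>[-T, T]\<close>.\<close>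
lemma fourier_int_in_BL:
  assumes k: "continuous_on UNIV k"
  shows "(\<lambda>t. fourier_int (cutoff a k) (of_real t)) \<in> BL a"
proof -
  define G where "G = cutoff a k"
  define g where "g t = fourier_int G (of_real t)" for t :: real
  define F where "F w = of_real (2 * pi) * G w" for w
  note G = cutoff_facts[OF k, of a, folded G_def]
  note [measurable] = G(1)
  have cg: "continuous_on UNIV g"
    unfolding g_def by (rule continuous_fourier_int_real[OF G(5) G(2)])
  then have [measurable]: "g \<in> borel_measurable borel" by (rule borel_measurable_continuous_onI)
  have Gsq: "integrable lborel (\<lambda>w. (cmod (G w))\<^sup>2)"
  proof -
    obtain M where "\<forall>w. cmod (G w) \<le> M" using G(3) by blast
    then have "integrable lborel (\<lambda>w. G w * cnj (G w))"
      using G(1) by (intro integrable_mult_bounded[OF G(5), where B = M]) auto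
    then show ?thesis
      by (simp only: complex_norm_square[symmetric] of_real_power[symmetric] complex_of_real_integrable_eq)
  qed
  define E where "E = (LINT w|lborel. (cmod (G w))\<^sup>2)"
  have "E \<ge> 0" by (simp add: E_def)
  have gsq: "integrable lborel (\<lambda>t. (cmod (g t))\<^sup>2)" "(LINT t|lborel. (cmod (g t))\<^sup>2) = 2 * pi * E"
    using integral_eq_of_nn_integral_eq[of "\<lambda>t. (cmod (g t))\<^sup>2" lborel "2 * pi * E"]
      plancherel_cutoff[OF k, of a] \<open>E \<ge> 0\<close>
    by (auto simp: g_def[symmetric] G_def[symmetric] E_def)
  have sqF: "square_integrable F"
    using Gsq G(1) by (simp add: square_integrable_def F_def[abs_def] norm_mult power_mult_distrib)
  have sqg: "square_integrable g"
    using gsq by (simp add: square_integrable_def)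
  define I where "I T = (LINT t|lborel. (cmod (cutoff T g t))\<^sup>2)" for T
  have I0: "I T \<ge> 0" for T by (simp add: I_def)
  have Ilim: "(I \<longlongrightarrow> 2 * pi * E) at_top"
    unfolding I_def gsq(2)[symmetric]
  proof (rule integral_dominated_convergence_at_top[OF _ _ gsq(1)])
    show "\<forall>\<^sub>F T in at_top. AE t in lborel. norm ((cmod (cutoff T g t))\<^sup>2) \<le> (cmod (g t))\<^sup>2"
      by (auto simp: cutoff_def indicator_def)
    show "AE t in lborel. ((\<lambda>T. (cmod (cutoff T g t))\<^sup>2) \<longlongrightarrow> (cmod (g t))\<^sup>2) at_top"
    proof (rule AE_I2)
      fix t :: real
      have "\<forall>\<^sub>F T in at_top. (cmod (cutoff T g t))\<^sup>2 = (cmod (g t))\<^sup>2"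
        using eventually_ge_at_top[of "\<bar>t\<bar>"] by eventually_elim (auto simp: cutoff_def indicator_def)
      then show "((\<lambda>T. (cmod (cutoff T g t))\<^sup>2) \<longlongrightarrow> (cmod (g t))\<^sup>2) at_top"
        by (rule tendsto_eventually)
    qed
    show "(\<lambda>t. (cmod (g t))\<^sup>2) \<in> borel_measurable lborel" by measurable
    show "(\<lambda>t. (cmod (cutoff T g t))\<^sup>2) \<in> borel_measurable lborel" for T
      unfolding cutoff_def by measurable
  qed
  have N: "(\<integral>\<^sup>+ w. ennreal ((cmod ((LINT t:{-T..T}|lborel. g t * exp (- \<i> * of_real w * of_real t)) - F w))\<^sup>2) \<partial>lborel)
      = ennreal (4 * pi\<^sup>2 * E - 2 * pi * I T)" for T
  proof -
    define H where "H = cutoff T g"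
    note H = cutoff_facts[OF cg, of T, folded H_def]
    define P where "P w = fourier_int H (of_real (- w))" for w :: real
    have "continuous_on UNIV (\<lambda>t::real. fourier_int H (of_real t))"
      by (rule continuous_fourier_int_real[OF H(5) H(2)])
    then have m1 [measurable]: "(\<lambda>t::real. fourier_int H (of_real t)) \<in> borel_measurable borel"
      by (rule borel_measurable_continuous_onI)
    have [measurable]: "P \<in> borel_measurable borel"
      unfolding P_def by (rule measurable_compose[OF _ m1]) measurable
    have "(\<integral>\<^sup>+ w. ennreal ((cmod (P w))\<^sup>2) \<partial>lborel) = (\<integral>\<^sup>+ w. ennreal ((cmod (fourier_int H (of_real w)))\<^sup>2) \<partial>lborel)"
      by (subst (2) nn_integral_real_affine[where c = "-1" and t = 0]) (auto simp: P_def)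
    then have Psq: "integrable lborel (\<lambda>w. (cmod (P w))\<^sup>2)" "(LINT w|lborel. (cmod (P w))\<^sup>2) = 2 * pi * I T"
      using integral_eq_of_nn_integral_eq[of "\<lambda>w. (cmod (P w))\<^sup>2" lborel "2 * pi * I T"]
        plancherel_cutoff[OF cg, of T] I0[of T]
      by (auto simp: H_def[symmetric] I_def)
    have Fint: "integrable lborel (\<lambda>w. cnj (F w))" using G(5) by (simp add: F_def)
    define m where "m w t = exp (\<i> * of_real t * of_real (- w))" for w t :: real
    have mm: "case_prod m \<in> borel_measurable (lborel \<Otimes>\<^sub>M lborel)"
      unfolding m_def by measurable
    have m1: "cmod (m w t) \<le> 1" for w t by (simp add: m_def norm_exp_eq_Re)
    have PF: "integrable lborel (\<lambda>w. cnj (F w) * P w)" "(LINT w|lborel. cnj (F w) * P w) = of_real (2 * pi * I T)"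
    proof -
      show "integrable lborel (\<lambda>w. cnj (F w) * P w)"
        using integral_swap_bounded(2)[OF Fint H(5) mm m1] by (simp add: P_def m_def fourier_int_def)
      \<comment> \<open>For the cross term, transforming the conjugate of \<open>F\<close> gives
        back the conjugate signal; against the truncated signal this yields its energy on
        [-T, T].\<close>
      have kernel: "(LINT w|lborel. cnj (F w) * m w t) = of_real (2 * pi) * cnj (g t)" for t
      proof -
        have "cnj (F w) * m w t = of_real (2 * pi) * cnj (G w * exp (\<i> * of_real w * of_real t))" for w
          by (simp add: F_def m_def exp_cnj mult_ac)
        then show ?thesis
          unfolding g_def fourier_int_def
          by (simp only: integral_mult_right_zero Bochner_Integration.integral_cnj)
      qed
      have "(LINT w|lborel. cnj (F w) * P w) = (LINT t|lborel. H t * (LINT w|lborel. cnj (F w) * m w t))"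
        using integral_swap_bounded(1)[OF Fint H(5) mm m1] by (simp add: P_def m_def fourier_int_def)
      also have "\<dots> = (LINT t|lborel. H t * (of_real (2 * pi) * cnj (g t)))"
        by (simp only: kernel)
      also have "\<dots> =
          (LINT t|lborel. of_real (2 * pi) * complex_of_real ((cmod (H t))\<^sup>2))"
        by (intro Bochner_Integration.integral_cong refl)
           (auto simp: H_def cutoff_def complex_norm_square indicator_def simp del: of_real_power)
      also have "\<dots> = of_real (2 * pi * I T)"
        by (simp only: integral_mult_right_zero integral_complex_of_real of_real_mult I_def H_def)
      finally show "(LINT w|lborel. cnj (F w) * P w) = of_real (2 * pi * I T)" .
    qed
    have sq: "(cmod (P w - F w))\<^sup>2 = (cmod (P w))\<^sup>2 + 4 * pi\<^sup>2 * (cmod (G w))\<^sup>2 - 2 * Re (cnj (F w) * P w)" for w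
    proof -
      have "(cmod (F w))\<^sup>2 = 4 * pi\<^sup>2 * (cmod (G w))\<^sup>2"
        by (simp add: F_def norm_mult power_mult_distrib)
      then show ?thesis by (simp add: cmod_power2 power2_diff algebra_simps)
    qed
    have int: "integrable lborel (\<lambda>w. (cmod (P w - F w))\<^sup>2)"
      unfolding sq using Psq(1) Gsq PF(1) by (intro Bochner_Integration.integrable_diff Bochner_Integration.integrable_add integrable_mult_right integrable_Re)
    have "(LINT w|lborel. (cmod (P w - F w))\<^sup>2) =
        (LINT w|lborel. (cmod (P w))\<^sup>2) + 4 * pi\<^sup>2 * (LINT w|lborel. (cmod (G w))\<^sup>2) - 2 * (LINT w|lborel. Re (cnj (F w) * P w))"
    proof -
      define R where "R w = Re (cnj (F w) * P w)" for w
      have "integrable lborel R" unfolding R_def using PF(1) by (rule integrable_Re)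
      then show ?thesis
        unfolding sq R_def[symmetric] using Psq(1) Gsq by simp
    qed
    also have "(LINT w|lborel. Re (cnj (F w) * P w)) = Re (LINT w|lborel. cnj (F w) * P w)"
      using PF(1) by (rule integral_Re)
    also have "(LINT w|lborel. (cmod (P w))\<^sup>2) + 4 * pi\<^sup>2 * (LINT w|lborel. (cmod (G w))\<^sup>2) - 2 * Re (LINT w|lborel. cnj (F w) * P w) = 4 * pi\<^sup>2 * E - 2 * pi * I T"
      by (simp only: PF(2) Psq(2) E_def Re_complex_of_real)
    finally show ?thesis
      unfolding fourier_truncation H_def[symmetric] P_def[symmetric]
      by (subst nn_integral_eq_integral[OF int]) auto
  qed
  have "((\<lambda>T. 4 * pi\<^sup>2 * E - 2 * pi * I T) \<longlongrightarrow> 4 * pi\<^sup>2 * E - 2 * pi * (2 * pi * E)) at_top"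
    by (intro tendsto_intros Ilim)
  then have "((\<lambda>T. 4 * pi\<^sup>2 * E - 2 * pi * I T) \<longlongrightarrow> 0) at_top"
    by (simp add: power2_eq_square)
  then have "((\<lambda>T. ennreal (4 * pi\<^sup>2 * E - 2 * pi * I T)) \<longlongrightarrow> 0) at_top"
    using tendsto_ennrealI by fastforce
  then have "has_fourier_transform g F"
    using sqF sqg unfolding has_fourier_transform_def L2_tendsto_def N by simp
  moreover have "AE w in lborel. w \<notin> {-a..a} \<longrightarrow> F w = 0"
    using G(2) by (auto simp: F_def)
  ultimately show ?thesis
    using cg sqg unfolding BL_def g_def G_def by blast
qed

section \<open>Fourier inversion by pairing with Gaussians\<close>

lemma integrable_product_square:
  fixes f g :: "real \<Rightarrow> complex"
  assumes "square_integrable f" "square_integrable g"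
  shows "integrable lborel (\<lambda>x. f x * g x)"
proof (rule Bochner_Integration.integrable_bound)
  show "integrable lborel (\<lambda>x. (cmod (f x))\<^sup>2 + (cmod (g x))\<^sup>2)"
    using assms by (simp add: square_integrable_def)
  show "(\<lambda>x. f x * g x) \<in> borel_measurable lborel"
    using assms by (auto simp: square_integrable_def)
  show "AE x in lborel. norm (f x * g x) \<le> norm ((cmod (f x))\<^sup>2 + (cmod (g x))\<^sup>2)"
  proof (rule AE_I2)
    fix x
    have "2 * (cmod (f x) * cmod (g x)) \<le> (cmod (f x))\<^sup>2 + (cmod (g x))\<^sup>2"
      using sum_squares_bound[of "cmod (f x)" "cmod (g x)"] by simp
    moreover have "0 \<le> cmod (f x) * cmod (g x)" by simp
    ultimately have "cmod (f x) * cmod (g x) \<le> (cmod (f x))\<^sup>2 + (cmod (g x))\<^sup>2" by linarith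
    then show "norm (f x * g x) \<le> norm ((cmod (f x))\<^sup>2 + (cmod (g x))\<^sup>2)"
      by (simp add: norm_mult)
  qed
qed

lemma square_integrable_gauss:
  assumes "e > 0"
  shows "square_integrable (\<lambda>w. of_real (exp (- (e * w)\<^sup>2 / 2)) * exp (\<i> * of_real w * of_real s))"
proof -
  have "(cmod (of_real (exp (- (e * w)\<^sup>2 / 2)) * exp (\<i> * of_real w * of_real s)))\<^sup>2 = exp (- (sqrt 2 * e * w)\<^sup>2 / 2)" for w
    by (simp add: norm_mult norm_exp_eq_Re power_mult_distrib flip: exp_of_nat_mult)
  then show ?thesis
    using integrable_gauss[of "sqrt 2 * e"] assms by (simp add: square_integrable_def)
qed

text \<open>For each truncation T, Fubini moves the transform from f onto the Gaussian test
  function. As T grows, the frequency side converges because L2 convergence implies weak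
  convergence, and the time side by domination.\<close>

lemma gauss_pairing:
  assumes f: "continuous_on UNIV f" and F: "has_fourier_transform f F" and e: "e > 0"
  shows "(LINT w|lborel. of_real (exp (- (e * w)\<^sup>2 / 2)) * exp (\<i> * of_real w * of_real s) * F w) =
         (LINT t|lborel. f t * of_real (sqrt (2 * pi) / e * exp (- ((s - t) / e)\<^sup>2 / 2)))"
proof -
  define \<psi> where "\<psi> w = of_real (exp (- (e * w)\<^sup>2 / 2)) * exp (\<i> * of_real w * of_real s)" for w
  define \<gamma> where "\<gamma> t = complex_of_real (sqrt (2 * pi) / e * exp (- ((s - t) / e)\<^sup>2 / 2))" for t
  have sqf: "square_integrable f" and sqF: "square_integrable F"
    and lim: "L2_tendsto (\<lambda>T w. LINT t:{-T..T}|lborel. f t * exp (- \<i> * of_real w * of_real t)) F at_top"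
    using F by (auto simp: has_fourier_transform_def)
  have sq\<psi>: "square_integrable \<psi>"
    unfolding \<psi>_def by (rule square_integrable_gauss[OF e])
  \<comment> \<open>\<open>f\<close> is only in L2, so the time-side pairing needs
    \<open>\<gamma>\<close> in L2 as well.\<close>
  have sq\<gamma>: "square_integrable \<gamma>"
  proof -
    have "(cmod (\<gamma> t))\<^sup>2 = (sqrt (2 * pi) / e)\<^sup>2 * exp (- (- (sqrt 2 * s / e) + (sqrt 2 / e) * t)\<^sup>2 / 2)" for t
    proof -
      have "- (- (sqrt 2 * s / e) + (sqrt 2 / e) * t)\<^sup>2 / 2 = 2 * (- ((s - t) / e)\<^sup>2 / 2)"
      proof -
        have "- (sqrt 2 * s / e) + (sqrt 2 / e) * t = - (sqrt 2 * ((s - t) / e))"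
          by (simp add: algebra_simps diff_divide_distrib)
        then show ?thesis by (simp add: power_mult_distrib power_divide)
      qed
      then show ?thesis
        by (simp add: \<gamma>_def norm_mult power_mult_distrib norm_divide power_divide flip: exp_of_nat_mult)
    qed
    moreover have "integrable lborel (\<lambda>t. exp (- (- (sqrt 2 * s / e) + (sqrt 2 / e) * t)\<^sup>2 / 2))"
      using e lborel_integrable_real_affine[of "\<lambda>t::real. exp (- t\<^sup>2 / 2)" "sqrt 2 / e" "- (sqrt 2 * s / e)"]
        integrable_gauss[of 1] by simp
    ultimately show ?thesis by (simp add: square_integrable_def \<gamma>_def[abs_def])
  qed
  have int\<psi>: "integrable lborel \<psi>"
    unfolding \<psi>_def
    using integrable_of_real[OF integrable_gauss[OF e]]
    by (intro integrable_mult_bounded[where B = 1]) (auto simp: norm_exp_eq_Re)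
  define P where "P T w = fourier_int (cutoff T f) (of_real (- w))" for T w :: real
  have P: "(LINT t:{-T..T}|lborel. f t * exp (- \<i> * of_real w * of_real t)) = P T w" for T w
    by (simp only: fourier_truncation P_def)
  have meas_f [measurable]: "f \<in> borel_measurable borel" using f by (rule borel_measurable_continuous_onI)
  define m where "m w t = exp (\<i> * of_real t * of_real (- w))" for w t :: real
  have mm: "case_prod m \<in> borel_measurable (lborel \<Otimes>\<^sub>M lborel)"
    unfolding m_def by measurable
  have m1: "cmod (m w t) \<le> 1" for w t by (simp add: m_def norm_exp_eq_Re)
  have kernel: "(LINT w|lborel. \<psi> w * m w t) = \<gamma> t" for t
    unfolding \<gamma>_def gauss_fourier[OF e, symmetric] \<psi>_def m_def mult.assoc exp_add[symmetric]
    by (intro Bochner_Integration.integral_cong refl) (simp add: algebra_simps)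
  have swap: "integrable lborel (\<lambda>w. \<psi> w * P T w)"
      "(LINT w|lborel. \<psi> w * P T w) = (LINT t|lborel. cutoff T f t * \<gamma> t)" for T
    using integral_swap_bounded[OF int\<psi> cutoff_facts(5)[OF f, of T] mm m1] kernel
    by (simp_all add: P_def m_def fourier_int_def)
  have int\<psi>F: "integrable lborel (\<lambda>w. \<psi> w * F w)" and intf\<gamma>: "integrable lborel (\<lambda>t. f t * \<gamma> t)"
    by (intro integrable_product_square sq\<psi> sqF sqf sq\<gamma>)+
  define C where "C = (LINT w|lborel. (cmod (\<psi> w))\<^sup>2)"
  have C: "(\<integral>\<^sup>+w. (ennreal (cmod (\<psi> w)))\<^sup>2 \<partial>lborel) = ennreal C"
    using sq\<psi> unfolding C_def square_integrable_def
    by (subst nn_integral_eq_integral[symmetric]) (auto simp: ennreal_power)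
  have Pm [measurable]: "P T \<in> borel_measurable borel" for T
  proof -
    have [measurable]: "(\<lambda>t::real. fourier_int (cutoff T f) (of_real t)) \<in> borel_measurable borel"
      by (intro borel_measurable_continuous_onI continuous_fourier_int_real[OF cutoff_facts(5)[OF f] cutoff_facts(2)[OF f]])
    show ?thesis unfolding P_def
      by (rule measurable_compose[of uminus borel borel "\<lambda>t::real. fourier_int (cutoff T f) (of_real t)" borel]) auto
  qed
  \<comment> \<open>Cauchy-Schwarz in extended nonnegative form, to fit the L2 distance, which is
    allowed to be infinite.\<close>
  have bound: "ennreal ((cmod ((LINT w|lborel. \<psi> w * P T w) - (LINT w|lborel. \<psi> w * F w)))\<^sup>2) \<le>
      ennreal C * (\<integral>\<^sup>+w. ennreal ((cmod (P T w - F w))\<^sup>2) \<partial>lborel)" for T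
  proof -
    have [measurable]: "F \<in> borel_measurable borel" "\<psi> \<in> borel_measurable borel"
      using sqF sq\<psi> by (auto simp: square_integrable_def)
    have i: "integrable lborel (\<lambda>w. \<psi> w * (P T w - F w))"
      using swap(1) int\<psi>F by (simp add: right_diff_distrib)
    have "(LINT w|lborel. \<psi> w * P T w) - (LINT w|lborel. \<psi> w * F w) = (LINT w|lborel. \<psi> w * (P T w - F w))"
      using swap(1) int\<psi>F by (simp add: right_diff_distrib)
    then have "ennreal (cmod ((LINT w|lborel. \<psi> w * P T w) - (LINT w|lborel. \<psi> w * F w))) \<le>
        (\<integral>\<^sup>+w. ennreal (cmod (\<psi> w)) * ennreal (cmod (P T w - F w)) \<partial>lborel)"
      using integral_norm_bound_ennreal[OF i] by (simp add: norm_mult ennreal_mult)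
    then have "(ennreal (cmod ((LINT w|lborel. \<psi> w * P T w) - (LINT w|lborel. \<psi> w * F w))))\<^sup>2 \<le>
        (\<integral>\<^sup>+w. ennreal (cmod (\<psi> w)) * ennreal (cmod (P T w - F w)) \<partial>lborel)\<^sup>2"
      by (intro power_mono) auto
    also have "\<dots> \<le> (\<integral>\<^sup>+w. (ennreal (cmod (\<psi> w)))\<^sup>2 \<partial>lborel) * (\<integral>\<^sup>+w. (ennreal (cmod (P T w - F w)))\<^sup>2 \<partial>lborel)"
      by (rule Cauchy_Schwarz_nn_integral) measurable
    finally show ?thesis unfolding C by (simp add: ennreal_power)
  qed
  have "((\<lambda>T. ennreal C * (\<integral>\<^sup>+w. ennreal ((cmod (P T w - F w))\<^sup>2) \<partial>lborel)) \<longlongrightarrow> ennreal C * 0) at_top"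
    using lim unfolding L2_tendsto_def P by (intro ennreal_tendsto_cmult) auto
  then have upper: "((\<lambda>T. ennreal C * (\<integral>\<^sup>+w. ennreal ((cmod (P T w - F w))\<^sup>2) \<partial>lborel)) \<longlongrightarrow> 0) at_top"
    by (simp only: mult_zero_right)
  have "((\<lambda>T. ennreal ((cmod ((LINT w|lborel. \<psi> w * P T w) - (LINT w|lborel. \<psi> w * F w)))\<^sup>2)) \<longlongrightarrow> 0) at_top"
    by (rule tendsto_sandwich[OF _ _ tendsto_const upper])
      (rule always_eventually, rule allI, rule zero_le, rule always_eventually, rule allI, rule bound)
  then have "((\<lambda>T. ennreal ((cmod ((LINT w|lborel. \<psi> w * P T w) - (LINT w|lborel. \<psi> w * F w)))\<^sup>2)) \<longlongrightarrow> ennreal 0) at_top"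
    by (simp only: ennreal_0)
  then have "((\<lambda>T. (cmod ((LINT w|lborel. \<psi> w * P T w) - (LINT w|lborel. \<psi> w * F w)))\<^sup>2) \<longlongrightarrow> 0) at_top"
    by (subst (asm) tendsto_ennreal_iff) auto
  then have "((\<lambda>T. sqrt ((cmod ((LINT w|lborel. \<psi> w * P T w) - (LINT w|lborel. \<psi> w * F w)))\<^sup>2)) \<longlongrightarrow> sqrt 0) at_top"
    by (rule tendsto_real_sqrt)
  then have "((\<lambda>T. (LINT w|lborel. \<psi> w * P T w) - (LINT w|lborel. \<psi> w * F w)) \<longlongrightarrow> 0) at_top"
    by (simp add: tendsto_norm_zero_iff)
  then have "((\<lambda>T. LINT w|lborel. \<psi> w * P T w) \<longlongrightarrow> (LINT w|lborel. \<psi> w * F w)) at_top"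
    by (simp only: LIM_zero_iff)
  moreover have "((\<lambda>T. LINT w|lborel. \<psi> w * P T w) \<longlongrightarrow> (LINT t|lborel. f t * \<gamma> t)) at_top"
    unfolding swap(2)
  proof (rule integral_dominated_convergence_at_top[OF _ _ integrable_norm[OF intf\<gamma>]])
    show "\<forall>\<^sub>F T in at_top. AE t in lborel. norm (cutoff T f t * \<gamma> t) \<le> norm (f t * \<gamma> t)"
      by (auto simp: cutoff_def indicator_def)
    show "AE t in lborel. ((\<lambda>T. cutoff T f t * \<gamma> t) \<longlongrightarrow> f t * \<gamma> t) at_top"
    proof (rule AE_I2)
      fix t :: real
      have "\<forall>\<^sub>F T in at_top. cutoff T f t * \<gamma> t = f t * \<gamma> t"
        using eventually_ge_at_top[of "\<bar>t\<bar>"] by eventually_elim (auto simp: cutoff_def indicator_def)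
      then show "((\<lambda>T. cutoff T f t * \<gamma> t) \<longlongrightarrow> f t * \<gamma> t) at_top"
        by (rule tendsto_eventually)
    qed
    show "(\<lambda>t. f t * \<gamma> t) \<in> borel_measurable lborel" using intf\<gamma> by simp
    show "(\<lambda>t. cutoff T f t * \<gamma> t) \<in> borel_measurable lborel" for T
      unfolding cutoff_def \<gamma>_def by measurable
  qed
  ultimately have "(LINT w|lborel. \<psi> w * F w) = (LINT t|lborel. f t * \<gamma> t)"
    using tendsto_unique[OF trivial_limit_at_top_linorder] by blast
  then show ?thesis by (simp only: \<psi>_def \<gamma>_def)
qed

text \<open>Let e tend to 0 in the Gaussian pairing: the frequency side tends to the Fourier
  integral of F, dominated by |F|, and the time side, a Gaussian average of f, tends to 2 pi f(s).
  Continuity of f makes this hold at every s. Changing the transform on a null set makes its support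
  exact.\<close>

lemma BL_inversion:
  assumes "f \<in> BL a"
  obtains F where "integrable lborel F" "\<forall>w. w \<notin> {-a..a} \<longrightarrow> F w = 0"
    "integrable lborel (\<lambda>w. (cmod (F w))\<^sup>2)" "\<And>s. f s = fourier_int F (of_real s) / of_real (2 * pi)"
proof -
  obtain F0 where f: "continuous_on UNIV f" and F0: "has_fourier_transform f F0"
    and supp: "AE w in lborel. w \<notin> {-a..a} \<longrightarrow> F0 w = 0"
    using assms by (auto simp: BL_def)
  define F where "F = cutoff a F0"
  have eq: "AE w in lborel. F0 w = F w"
    using supp by eventually_elim (auto simp: F_def cutoff_def indicator_def)
  have sqF0: "square_integrable F0" and sqf: "square_integrable f"
    using F0 by (auto simp: has_fourier_transform_def)
  then have [measurable]: "F0 \<in> borel_measurable borel" by (simp add: square_integrable_def)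
  have [measurable]: "F \<in> borel_measurable borel" unfolding F_def cutoff_def by measurable
  have supF: "\<forall>w. w \<notin> {-a..a} \<longrightarrow> F w = 0" by (simp add: F_def cutoff_def)
  have sqF: "integrable lborel (\<lambda>w. (cmod (F w))\<^sup>2)"
  proof (rule Bochner_Integration.integrable_bound)
    show "integrable lborel (\<lambda>w. (cmod (F0 w))\<^sup>2)" using sqF0 by (simp add: square_integrable_def)
  qed (auto simp: F_def cutoff_def indicator_def)
  have intF: "integrable lborel F"
  proof -
    \<comment> \<open>On a bounded band square integrability gives integrability, by pairing with
      the indicator.\<close>
    have "square_integrable (\<lambda>w. of_real (indicator {-a..a} w))"
      by (auto simp: square_integrable_def power2_eq_square indicator_inter_arith[symmetric] emeasure_lborel_Icc_eq)
    from integrable_product_square[OF sqF0 this]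
    show ?thesis by (simp add: F_def cutoff_def[abs_def] scaleR_conv_of_real mult.commute)
  qed
  have "f s = fourier_int F (of_real s) / of_real (2 * pi)" for s
  proof -
    define e where "e n = 1 / real (Suc n)" for n
    have e: "e n > 0" for n by (simp add: e_def)
    have e0: "e \<longlonglongrightarrow> 0" unfolding e_def by (intro LIMSEQ_Suc lim_1_over_n)
    have "(\<lambda>n. LINT w|lborel. of_real (exp (- (e n * w)\<^sup>2 / 2)) * exp (\<i> * of_real w * of_real s) * F w)
        \<longlonglongrightarrow> (LINT w|lborel. of_real (exp (- (0 * w)\<^sup>2 / 2)) * exp (\<i> * of_real w * of_real s) * F w)"
    proof (rule integral_dominated_convergence[OF _ _ integrable_norm[OF intF]])
      show "AE w in lborel. (\<lambda>n. of_real (exp (- (e n * w)\<^sup>2 / 2)) * exp (\<i> * of_real w * of_real s) * F w)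
          \<longlonglongrightarrow> of_real (exp (- (0 * w)\<^sup>2 / 2)) * exp (\<i> * of_real w * of_real s) * F w"
        by (intro AE_I2 tendsto_intros e0) auto
      show "AE w in lborel. norm (of_real (exp (- (e n * w)\<^sup>2 / 2)) * exp (\<i> * of_real w * of_real s) * F w) \<le> cmod (F w)" for n
        by (auto simp: norm_mult norm_exp_eq_Re intro!: mult_left_le_one_le)
    qed measurable
    moreover have "(LINT w|lborel. of_real (exp (- (0 * w)\<^sup>2 / 2)) * exp (\<i> * of_real w * of_real s) * F w) = fourier_int F (of_real s)"
      by (simp add: fourier_int_def mult.commute)
    moreover have "(LINT w|lborel. of_real (exp (- (e n * w)\<^sup>2 / 2)) * exp (\<i> * of_real w * of_real s) * F w) =
        (LINT t|lborel. f t * of_real (sqrt (2 * pi) / e n * exp (- ((s - t) / e n)\<^sup>2 / 2)))" for n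
      unfolding gauss_pairing[OF f F0 e, symmetric] using eq
      by (intro integral_cong_AE) auto
    ultimately have lim1: "(\<lambda>n. LINT t|lborel. f t * of_real (sqrt (2 * pi) / e n * exp (- ((s - t) / e n)\<^sup>2 / 2))) \<longlonglongrightarrow> fourier_int F (of_real s)"
      by simp
    \<comment> \<open>\<^term>\<open>f\<close> is not known to be bounded, so the approximate identity applies only near \<^term>\<open>s\<close>.\<close>
    define f1 where "f1 t = indicator {s - 1..s + 1} t *\<^sub>R f t" for t
    define f2 where "f2 t = f t - f1 t" for t
    have [measurable]: "f \<in> borel_measurable borel" using f by (rule borel_measurable_continuous_onI)
    have [measurable]: "f1 \<in> borel_measurable borel" unfolding f1_def by measurable
    have [measurable]: "f2 \<in> borel_measurable borel" unfolding f2_def by measurable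
    have near: "(\<lambda>n. LINT t|lborel. f1 t * of_real (sqrt (2 * pi) / e n * exp (- ((s - t) / e n)\<^sup>2 / 2))) \<longlonglongrightarrow> of_real (2 * pi) * f s"
    proof -
      have "compact (f ` {s - 1..s + 1})"
        by (intro compact_continuous_image continuous_on_subset[OF f]) auto
      then obtain M where M: "\<And>t. t \<in> {s - 1..s + 1} \<Longrightarrow> cmod (f t) \<le> M"
        using compact_imp_bounded bounded_iff by (metis imageI)
      have b: "cmod (f1 t) \<le> \<bar>M\<bar>" for t
        using M[of t] by (auto simp: f1_def indicator_def)
      have "eventually (\<lambda>t. t \<in> {s - 1<..<s + 1}) (nhds s)" by (intro eventually_nhds_in_open) auto
      then have "eventually (\<lambda>t. f1 t = f t) (nhds s)"
        by eventually_elim (auto simp: f1_def)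
      then have "isCont f1 s" using f by (simp add: isCont_cong continuous_on_eq_continuous_at)
      from tendsto_mult[OF tendsto_const gauss_approx_identity[OF _ b this], of "of_real (sqrt (2 * pi))"]
      have "(\<lambda>n. of_real (sqrt (2 * pi)) * (LINT x|lborel. of_real (exp (- x\<^sup>2 / 2)) * f1 (s + e n * x)))
          \<longlonglongrightarrow> of_real (sqrt (2 * pi)) * (of_real (sqrt (2 * pi)) * f s)"
        by (simp add: e_def f1_def)
      also have "of_real (sqrt (2 * pi)) * (of_real (sqrt (2 * pi)) * f s) = of_real (2 * pi) * f s"
        by (simp flip: of_real_mult mult.assoc)
      finally show ?thesis
      proof (rule Lim_transform_eventually, intro always_eventually allI)
        fix n
        have "f1 (s + e n * x) * of_real (sqrt (2 * pi) / e n * exp (- ((s - (s + e n * x)) / e n)\<^sup>2 / 2)) =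
          of_real (sqrt (2 * pi) / e n) * (of_real (exp (- x\<^sup>2 / 2)) * f1 (s + e n * x))" for x
          using e[of n] by simp
        then show "of_real (sqrt (2 * pi)) * (LINT x|lborel. of_real (exp (- x\<^sup>2 / 2)) * f1 (s + e n * x)) =
           (LINT t|lborel. f1 t * of_real (sqrt (2 * pi) / e n * exp (- ((s - t) / e n)\<^sup>2 / 2)))"
          using e[of n] by (subst lborel_integral_real_affine[where c = "e n" and t = s])
            (simp_all only: integral_mult_right_zero, simp_all add: scaleR_conv_of_real)
      qed
    qed
    \<comment> \<open>A majorant uniform in n. Where |s - t| > 1, half of the Gaussian exponent
      absorbs the growing factor x = 1/e(n), and the other half leaves exp(-(s-t)^2/4).\<close>
    have bnd: "cmod (f2 t * of_real (sqrt (2 * pi) / e n * exp (- ((s - t) / e n)\<^sup>2 / 2)))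
        \<le> sqrt (2 * pi) * cmod (f t * of_real (exp (- (s - t)\<^sup>2 / 4)))" for n t
    proof (cases "t \<in> {s - 1..s + 1}")
      case False
      define x where "x = real (Suc n)"
      have "1 < \<bar>s - t\<bar>" using False by auto
      then have y1: "1 \<le> (s - t)\<^sup>2" by (metis abs_le_square_iff abs_one less_imp_le one_power2)
      have x1: "1 \<le> x" "1 \<le> x\<^sup>2" by (auto simp: x_def)
      \<comment> \<open>Expand (x/2 - 1)^2 >= 0.\<close>
      have "x \<le> 1 + x\<^sup>2 / 4" using zero_le_power2[of "x / 2 - 1"] by (simp add: power2_eq_square field_simps)
      also have "\<dots> \<le> exp (x\<^sup>2 / 4)" by (rule exp_ge_add_one_self)
      also have "\<dots> \<le> exp (x\<^sup>2 * (s - t)\<^sup>2 / 4)" using mult_left_mono[OF y1, of "x\<^sup>2"] by simp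
      finally have "x * exp (- ((s - t) * x)\<^sup>2 / 2) \<le> exp (x\<^sup>2 * (s - t)\<^sup>2 / 4) * exp (- ((s - t) * x)\<^sup>2 / 2)"
        by (intro mult_right_mono) auto
      also have "\<dots> = exp (- (x\<^sup>2 * (s - t)\<^sup>2) / 4)"
        by (simp add: power_mult_distrib mult.commute flip: exp_add)
      also have "\<dots> \<le> exp (- (s - t)\<^sup>2 / 4)"
        using mult_right_mono[OF x1(2), of "(s - t)\<^sup>2"] by simp
      finally have *: "x * exp (- ((s - t) * x)\<^sup>2 / 2) \<le> exp (- (s - t)\<^sup>2 / 4)" .
      have "cmod (f2 t * of_real (sqrt (2 * pi) / e n * exp (- ((s - t) / e n)\<^sup>2 / 2))) =
          sqrt (2 * pi) * (cmod (f t) * (x * exp (- ((s - t) * x)\<^sup>2 / 2)))"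
        using False by (simp add: f2_def f1_def e_def x_def norm_mult del: of_nat_Suc)
      also have "\<dots> \<le> sqrt (2 * pi) * (cmod (f t) * exp (- (s - t)\<^sup>2 / 4))"
        by (intro mult_left_mono *) auto
      finally show ?thesis by (simp add: norm_mult)
    qed (simp add: f2_def f1_def)
    have dom: "integrable lborel (\<lambda>t. f t * of_real (exp (- (s - t)\<^sup>2 / 4)))"
    proof -
      have "integrable lborel (\<lambda>t. exp (- (- s + 1 * t)\<^sup>2 / 2))"
        using lborel_integrable_real_affine[of "\<lambda>t::real. exp (- t\<^sup>2 / 2)" 1 "- s"] integrable_gauss[of 1] by simp
      moreover have "(cmod (of_real (exp (- (s - t)\<^sup>2 / 4))))\<^sup>2 = exp (- (- s + 1 * t)\<^sup>2 / 2)" for t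
        by (simp add: power2_commute[of s t] flip: exp_of_nat_mult)
      ultimately have "square_integrable (\<lambda>t. of_real (exp (- (s - t)\<^sup>2 / 4)))"
        by (simp add: square_integrable_def)
      then show ?thesis by (intro integrable_product_square sqf)
    qed
    have far: "(\<lambda>n. LINT t|lborel. f2 t * of_real (sqrt (2 * pi) / e n * exp (- ((s - t) / e n)\<^sup>2 / 2))) \<longlonglongrightarrow> (LINT t::real|lborel. 0)"
    proof (rule integral_dominated_convergence)
      show "integrable lborel (\<lambda>t. sqrt (2 * pi) * cmod (f t * of_real (exp (- (s - t)\<^sup>2 / 4))))"
        by (intro integrable_mult_right integrable_norm dom)
      show "AE t in lborel. (\<lambda>n. f2 t * of_real (sqrt (2 * pi) / e n * exp (- ((s - t) / e n)\<^sup>2 / 2))) \<longlonglongrightarrow> 0"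
      proof (rule AE_I2)
        fix t :: real
        show "(\<lambda>n. f2 t * of_real (sqrt (2 * pi) / e n * exp (- ((s - t) / e n)\<^sup>2 / 2))) \<longlonglongrightarrow> 0"
        proof (cases "t = s")
          case False
          then have "(s - t)\<^sup>2 > 0" by simp
          then have "(\<lambda>n. sqrt (2 * pi) * real (Suc n) * exp (- ((s - t)\<^sup>2 * (real (Suc n))\<^sup>2) / 2)) \<longlonglongrightarrow> 0"
            by real_asymp
          then have "(\<lambda>n. sqrt (2 * pi) / e n * exp (- ((s - t) / e n)\<^sup>2 / 2)) \<longlonglongrightarrow> 0"
            by (simp add: e_def power_mult_distrib del: of_nat_Suc)
          then have "(\<lambda>n. complex_of_real (sqrt (2 * pi) / e n * exp (- ((s - t) / e n)\<^sup>2 / 2))) \<longlonglongrightarrow> of_real 0"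
            by (rule tendsto_of_real)
          from tendsto_mult_right_zero[OF this[unfolded of_real_0], of "f2 t"] show ?thesis .
        qed (simp add: f2_def f1_def)
      qed
    qed (use bnd in auto)
    have int1: "integrable lborel (\<lambda>t. f t * of_real (sqrt (2 * pi) / e n * exp (- ((s - t) / e n)\<^sup>2 / 2)))"
      "integrable lborel (\<lambda>t. f2 t * of_real (sqrt (2 * pi) / e n * exp (- ((s - t) / e n)\<^sup>2 / 2)))" for n
    proof -
      show i2: "integrable lborel (\<lambda>t. f2 t * of_real (sqrt (2 * pi) / e n * exp (- ((s - t) / e n)\<^sup>2 / 2)))"
        by (rule Bochner_Integration.integrable_bound[OF integrable_mult_right[OF integrable_norm[OF dom], of "sqrt (2 * pi)"]])
          (use bnd[of _ n] in \<open>auto simp: abs_mult\<close>)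
      have i1: "integrable lborel f1"
        unfolding f1_def using borel_integrable_atLeastAtMost'[OF continuous_on_subset[OF f], of "s - 1" "s + 1"]
        by (simp add: set_integrable_def)
      have "integrable lborel (\<lambda>t. f1 t * of_real (sqrt (2 * pi) / e n * exp (- ((s - t) / e n)\<^sup>2 / 2)))"
        using e[of n] by (intro integrable_mult_bounded[OF i1, where B = "sqrt (2 * pi) / e n"])
          (auto simp: norm_mult norm_divide divide_right_mono mult_left_le)
      from Bochner_Integration.integrable_add[OF this i2]
      show "integrable lborel (\<lambda>t. f t * of_real (sqrt (2 * pi) / e n * exp (- ((s - t) / e n)\<^sup>2 / 2)))"
        by (simp only: f2_def distrib_right[symmetric]) simp
    qed
    have "(LINT t|lborel. f t * of_real (sqrt (2 * pi) / e n * exp (- ((s - t) / e n)\<^sup>2 / 2))) -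
        (LINT t|lborel. f2 t * of_real (sqrt (2 * pi) / e n * exp (- ((s - t) / e n)\<^sup>2 / 2))) =
        (LINT t|lborel. f1 t * of_real (sqrt (2 * pi) / e n * exp (- ((s - t) / e n)\<^sup>2 / 2)))" for n
      unfolding Bochner_Integration.integral_diff[OF int1, symmetric]
      by (intro Bochner_Integration.integral_cong refl) (simp only: f2_def left_diff_distrib[symmetric], simp)
    then have "(\<lambda>n. LINT t|lborel. f1 t * of_real (sqrt (2 * pi) / e n * exp (- ((s - t) / e n)\<^sup>2 / 2))) \<longlonglongrightarrow> fourier_int F (of_real s) - 0"
      using tendsto_diff[OF lim1 far] by simp
    from LIMSEQ_unique[OF near this]
    have "fourier_int F (of_real s) = of_real (2 * pi) * f s" by simp
    then show ?thesis by simp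
  qed
  with that intF supF sqF show thesis by blast
qed

section \<open>Chromatic derivatives of the sinc function and spherical Bessel functions\<close>

lemma cutoff_poly_integral:
  "(LINT w|lborel. cutoff pi (\<lambda>w. of_real (poly q w)) w) = complex_of_real (2 * pi * poly_mean q)"
proof -
  have int: "set_integrable lborel {-pi..pi} (poly q)"
    by (intro borel_integrable_atLeastAtMost' continuous_intros)
  have "(LINT w|lborel. cutoff pi (\<lambda>w. of_real (poly q w)) w) =
      complex_of_real (LINT w:{-pi..pi}|lborel. poly q w)"
    unfolding set_lebesgue_integral_def integral_complex_of_real[symmetric]
    by (intro Bochner_Integration.integral_cong refl) (simp add: cutoff_def scaleR_conv_of_real)
  also have "(LINT w:{-pi..pi}|lborel. poly q w) = 2 * pi * poly_mean q"
    using set_borel_integral_eq_integral(2)[OF int] poly_mean_has_integral[of q]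
    by (simp add: integral_unique)
  finally show ?thesis .
qed

text \<open>For n = 0 this is 1/(2 pi), the density of sinc. The power of -i makes the Taylor
  coefficients of the resulting Fourier integral real.\<close>

definition sinc_density :: "nat \<Rightarrow> real \<Rightarrow> complex" where
  "sinc_density n w = (- \<i>) ^ n / of_real (2 * pi) * of_real (poly (PL n) w)"

text \<open>This is \<open>\<phi>\<^sub>n\<close> above; it differs from the chromatic derivative of sinc by the sign \<open>(-1)\<^sup>n\<close>.\<close>
definition sinc_deriv :: "nat \<Rightarrow> complex \<Rightarrow> complex" where
  "sinc_deriv n = fourier_int (cutoff pi (sinc_density n))"

lemma continuous_sinc_density: "continuous_on UNIV (sinc_density n)"
  unfolding sinc_density_def by (intro continuous_intros) auto

lemmas sinc_density_cutoff = cutoff_facts[OF continuous_sinc_density, of pi]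

lemma sinc_deriv_sums:
  "(\<lambda>p. (- \<i>) ^ n * \<i> ^ p * of_real (poly_mean (monom 1 p * PL n) / fact p) * z ^ p) sums sinc_deriv n z"
proof -
  have "(LINT w|lborel. of_real w ^ p * cutoff pi (sinc_density n) w) =
      (- \<i>) ^ n * complex_of_real (poly_mean (monom 1 p * PL n))" for p
  proof -
    have "of_real w ^ p * cutoff pi (sinc_density n) w =
        (- \<i>) ^ n / of_real (2 * pi) * cutoff pi (\<lambda>w. of_real (poly (monom 1 p * PL n) w)) w" for w
      by (simp add: cutoff_def sinc_density_def poly_monom scaleR_conv_of_real)
    then show ?thesis by (simp only: integral_mult_right_zero cutoff_poly_integral) simp
  qed
  then show ?thesis
    using fourier_int_sums[OF sinc_density_cutoff(5,2), where z = 0 and h = z, of n]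
    by (simp add: sinc_deriv_def mult_ac)
qed

text \<open>Only p = n + 2k has a nonzero moment, and there the phase (-i)^n i^p is (-1)^k. Apart
  from sqrt(2n+1), this is the power series of the spherical Bessel function at pi z.\<close>

lemma sinc_deriv_sums':
  "(\<lambda>k. of_real (sqrt (2 * real n + 1)) * ((- 1) ^ k * 2 ^ n * fact (n + k) / (fact k * fact (2 * n + 2 * k + 1))) *
      (of_real pi * z) ^ (n + 2 * k)) sums sinc_deriv n z"
proof -
  let ?f = "\<lambda>p. (- \<i>) ^ n * \<i> ^ p * of_real (poly_mean (monom 1 p * PL n) / fact p) * z ^ p"
  have "strict_mono (\<lambda>k. n + 2 * k)" by (simp add: strict_mono_def)
  moreover have "?f p = 0" if "p \<notin> range (\<lambda>k. n + 2 * k)" for p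
  proof -
    have "\<not> (n \<le> p \<and> even (p - n))"
    proof
      assume "n \<le> p \<and> even (p - n)"
      then have "p = n + 2 * ((p - n) div 2)" using dvd_mult_div_cancel[of 2 "p - n"] by linarith
      with that show False by blast
    qed
    then show ?thesis by (simp only: PL_moment) simp
  qed
  ultimately have "(\<lambda>k. ?f (n + 2 * k)) sums sinc_deriv n z"
    using sinc_deriv_sums[of n z] by (subst sums_mono_reindex)
  moreover have "?f (n + 2 * k) = of_real (sqrt (2 * real n + 1)) * ((- 1) ^ k * 2 ^ n * fact (n + k) / (fact k * fact (2 * n + 2 * k + 1))) *
      (of_real pi * z) ^ (n + 2 * k)" for k
  proof -
    have i: "(- \<i>) ^ n * \<i> ^ (n + 2 * k) = (- 1) ^ k"
    proof -
      have "(- \<i>) ^ n * \<i> ^ n = 1" unfolding power_mult_distrib[symmetric] by simp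
      then have "((- \<i>) ^ n * \<i> ^ n) * (\<i> ^ 2) ^ k = (- 1) ^ k" by simp
      then show ?thesis by (simp only: power_add power_mult mult.assoc)
    qed
    have "poly_mean (monom 1 (n + 2 * k) * PL n) / fact (n + 2 * k) =
        sqrt (2 * real n + 1) * pi ^ (n + 2 * k) * 2 ^ n * fact (n + k) / (fact k * fact (2 * n + 2 * k + 1))"
    proof -
      have e: "(n \<le> n + 2 * k \<and> even (n + 2 * k - n)) = True" "(n + 2 * k - n) div 2 = k" "n + (n + 2 * k) + 1 = 2 * n + 2 * k + 1"
        by simp_all
      have "s * F * t / G / F = s * t / G" if "F > 0" for s t F G :: real using that by simp
      from this[of "fact (n + 2 * k)" "sqrt (2 * real n + 1) * pi ^ (n + 2 * k) * 2 ^ n" "fact (n + k)"]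
      show ?thesis unfolding PL_moment e if_True by simp
    qed
    then show ?thesis
      unfolding i by (simp add: power_mult_distrib del: fact_Suc)
  qed
  ultimately show ?thesis by simp
qed

section \<open>Spherical Bessel functions and sinc\<close>

lemma rGamma_half: "rGamma (of_nat m + 1 / 2 :: complex) = of_real (4 ^ m * fact m / (fact (2 * m) * sqrt pi))"
proof (induction m)
  case 0
  show ?case using Gamma_one_half_complex by (simp add: rGamma_inverse_Gamma field_simps)
next
  case (Suc m)
  have nz: "of_nat m + 1 / 2 \<noteq> (0 :: complex)"
  proof -
    have "complex_of_real (real m + 1 / 2) \<noteq> 0" by (subst of_real_eq_0_iff) linarith
    then show ?thesis by simp
  qed
  have "(of_nat m + 1 / 2) * rGamma (of_nat (Suc m) + 1 / 2) = rGamma (of_nat m + 1 / 2 :: complex)"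
    using rGamma_plus1[of "of_nat m + 1 / 2 :: complex"] by (simp add: algebra_simps)
  also have "\<dots> = of_real ((real m + 1 / 2) * (4 ^ Suc m * fact (Suc m) / (fact (2 * Suc m) * sqrt pi)))"
    unfolding Suc.IH of_real_eq_iff
  proof -
    have "fact (2 * Suc m) = (2 * real m + 2) * ((2 * real m + 1) * fact (2 * m))"
      by (simp add: algebra_simps)
    moreover have "4 ^ m * fact m / (F * s) = (M + 1 / 2) * (4 * 4 ^ m * ((M + 1) * fact m) / ((2 * M + 2) * ((2 * M + 1) * F) * s))"
      if "F > 0" "s > 0" "M \<ge> 0" for F s M :: real
      using that by (simp add: divide_simps) (simp add: algebra_simps)
    from this[of "fact (2 * m)" "sqrt pi" "real m"]
    have "4 ^ m * fact m / (fact (2 * m) * sqrt pi) = (real m + 1 / 2) * (4 * 4 ^ m * ((real m + 1) * fact m) / ((2 * real m + 2) * ((2 * real m + 1) * fact (2 * m)) * sqrt pi))"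
      by simp
    ultimately show "4 ^ m * fact m / (fact (2 * m) * sqrt pi) = (real m + 1 / 2) * (4 ^ Suc m * fact (Suc m) / (fact (2 * Suc m) * sqrt pi))"
      by (simp add: algebra_simps)
  qed
  also have "\<dots> = (of_nat m + 1 / 2) * of_real (4 ^ Suc m * fact (Suc m) / (fact (2 * Suc m) * sqrt pi))"
    by (simp only: of_real_mult of_real_add of_real_of_nat_eq of_real_divide of_real_1 of_real_numeral)
  finally show ?case using nz by (simp only: mult_cancel_left simp_thms)
qed

text \<open>The two power series are compared term by term; the Gamma factors are explicit because
  the order n + 1/2 is a half-integer.\<close>

lemma spherical_bessel_eq_sinc_deriv:
  "of_real (sqrt (2 * real n + 1)) * spherical_bessel_j n (of_real pi * z) = sinc_deriv n z"
proof (cases "z = 0")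
  case True
  have "sinc_deriv n 0 = (if n = 0 then 1 else 0)"
    using sinc_deriv_sums[of n 0] unfolding powser_sums_zero_iff PL_moment by auto
  then show ?thesis using True by (simp add: spherical_bessel_j_def)
next
  case False
  define x where "x = of_real pi * z"
  have x: "x \<noteq> 0" using False by (simp add: x_def)
  let ?b = "\<lambda>k. (- 1) ^ k / fact k * rGamma (of_nat n + 1 / 2 + of_nat k + 1) * (x / 2) ^ (2 * k)"
  let ?c = "\<lambda>k. (- 1) ^ k * 2 ^ n * fact (n + k) / (fact k * fact (2 * n + 2 * k + 1)) * x ^ (n + 2 * k)"
  \<comment> \<open>Both powers use the same principal logarithm, since Ln(x/2) = Ln x - ln 2 for
    every nonzero x. The half powers of x therefore cancel, also on the negative axis.\<close>
  have pre: "of_real (sqrt (pi / 2)) * x powr (- 1 / 2) * (x / 2) powr (of_nat n + 1 / 2) =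
      of_real (sqrt pi / 2) * x ^ n / 2 ^ n"
  proof -
    have "x powr (- 1 / 2) * (x / 2) powr (of_nat n + 1 / 2) =
        exp (of_nat n * Ln x - (of_nat n + 1 / 2) * of_real (ln 2))"
      using x Ln_divide_of_real[of 2 x] by (simp add: powr_def flip: exp_add) (simp add: algebra_simps)
    also have "\<dots> = x ^ n / (2 ^ n * of_real (sqrt 2))"
    proof -
      have "exp ((of_nat n + 1 / 2) * complex_of_real (ln 2)) = of_real (exp ((real n + 1 / 2) * ln 2))"
        by (simp only: exp_of_real[symmetric] of_real_mult of_real_add of_real_of_nat_eq of_real_divide of_real_1 of_real_numeral)
      also have "exp ((real n + 1 / 2) * ln 2) = 2 ^ n * sqrt 2"
        using powr_add[of 2 "real n" "1/2"] by (simp add: powr_def powr_half_sqrt[symmetric] flip: powr_realpow)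
      finally show ?thesis using x by (simp add: exp_diff exp_of_nat_mult)
    qed
    finally have *: "x powr (- 1 / 2) * (x / 2) powr (of_nat n + 1 / 2) = x ^ n / (2 ^ n * of_real (sqrt 2))" .
    have "sqrt (pi / 2) / sqrt 2 = sqrt pi / 2"
      by (simp add: real_sqrt_divide flip: real_sqrt_mult)
    then have "complex_of_real (sqrt (pi / 2)) / of_real (sqrt 2) = of_real (sqrt pi / 2)"
      by (metis of_real_divide)
    then show ?thesis
      unfolding mult.assoc * by (metis (no_types, lifting) times_divide_eq_right times_divide_eq_left divide_divide_eq_left mult.commute)
  qed
  have summand: "of_real (sqrt pi / 2) * x ^ n / 2 ^ n * ?b k = ?c k" for k
  proof -
    have "of_nat n + 1 / 2 + of_nat k + 1 = of_nat (n + k + 1) + (1 / 2 :: complex)" by simp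
    then have g: "rGamma (of_nat n + 1 / 2 + of_nat k + 1 :: complex) =
        of_real (4 ^ (n + k + 1) * fact (n + k + 1) / (fact (2 * (n + k + 1)) * sqrt pi))"
      by (simp only: rGamma_half)
    have "fact (2 * (n + k + 1)) = 2 * (real (n + k + 1) * fact (2 * n + 2 * k + 1))"
      by (simp add: algebra_simps)
    moreover have "fact (n + k + 1) = real (n + k + 1) * fact (n + k)" by simp
    moreover have "s / 2 * (4 * A * (N * F) / (2 * (N * G) * s)) = A * F / G"
      if "s > 0" "N > 0" "G > 0" for s A N F G :: real using that by simp
    from this[of "sqrt pi" "real (n + k + 1)" "fact (2 * n + 2 * k + 1)" "4 ^ (n + k)" "fact (n + k)"]
    have "sqrt pi / 2 * (4 * 4 ^ (n + k) * (real (n + k + 1) * fact (n + k)) / (2 * (real (n + k + 1) * fact (2 * n + 2 * k + 1)) * sqrt pi)) =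
        4 ^ (n + k) * fact (n + k) / fact (2 * n + 2 * k + 1)"
      by simp
    ultimately have "sqrt pi / 2 * (4 ^ (n + k + 1) * fact (n + k + 1) / (fact (2 * (n + k + 1)) * sqrt pi)) =
        4 ^ (n + k) * fact (n + k) / fact (2 * n + 2 * k + 1)"
      by (simp only: power_add power_one_right mult.commute[of _ 4] mult.assoc)
    then have g': "complex_of_real (sqrt pi / 2) * rGamma (of_nat n + 1 / 2 + of_nat k + 1) =
        4 ^ (n + k) * fact (n + k) / fact (2 * n + 2 * k + 1)"
      unfolding g of_real_mult[symmetric] by simp
    have "of_real (sqrt pi / 2) * x ^ n / 2 ^ n * ?b k =
        (complex_of_real (sqrt pi / 2) * rGamma (of_nat n + 1 / 2 + of_nat k + 1)) * ((- 1) ^ k / fact k * (x ^ n / 2 ^ n * (x / 2) ^ (2 * k)))"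
    proof -
      have "s * X / T * (M / F * R * Z) = (s * R) * (M / F * (X / T * Z))" for s X T M F R Z :: complex
        by (simp add: mult_ac)
      then show ?thesis .
    qed
    also have "\<dots> = ?c k"
    proof -
      have "(4::complex) ^ (n + k) = 2 ^ n * 2 ^ n * 2 ^ (2 * k)"
        by (simp add: power_add power_mult flip: power_mult_distrib)
      then show ?thesis
        unfolding g' by (simp add: power_add power_divide mult_ac del: fact_Suc)
    qed
    finally show ?thesis .
  qed
  have c: "(\<lambda>k. of_real (sqrt (2 * real n + 1)) * ?c k) sums sinc_deriv n z"
    using sinc_deriv_sums'[of n z] by (simp only: x_def mult.assoc)
  have s: "of_real (sqrt (2 * real n + 1)) \<noteq> (0 :: complex)" by (simp add: add_nonneg_eq_0_iff)
  then have "?c sums (sinc_deriv n z / of_real (sqrt (2 * real n + 1)))"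
    using sums_divide[OF c, of "of_real (sqrt (2 * real n + 1))"] by simp
  then have "(\<lambda>k. of_real (sqrt pi / 2) * x ^ n / 2 ^ n * ?b k) sums (sinc_deriv n z / of_real (sqrt (2 * real n + 1)))"
    unfolding summand .
  then have "of_real (sqrt pi / 2) * x ^ n / 2 ^ n * (\<Sum>k. ?b k) = sinc_deriv n z / of_real (sqrt (2 * real n + 1))"
  proof -
    assume a: "(\<lambda>k. of_real (sqrt pi / 2) * x ^ n / 2 ^ n * ?b k) sums (sinc_deriv n z / of_real (sqrt (2 * real n + 1)))"
    \<comment> \<open>\<open>bessel_J\<close> is an infinite-sum term, so its series must be known
      to be summable before the prefactor is pulled out; a nonzero prefactor lets this be read off
      the product series.\<close>
    have nz: "of_real (sqrt pi / 2) * x ^ n / 2 ^ n \<noteq> 0" using x by simp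
    then have sb: "summable ?b" using summable_mult_D[OF sums_summable[OF a]] by blast
    show ?thesis using suminf_mult[OF sb] sums_unique[OF a] by (simp only:)
  qed
  then have "spherical_bessel_j n x = sinc_deriv n z / of_real (sqrt (2 * real n + 1))"
    by (simp only: spherical_bessel_j_def bessel_J_def mult.assoc[symmetric] pre x if_False)
  then show ?thesis using s by (simp add: x_def)
qed

text \<open>For n = 0 the series is that of sin x / x at x = pi z; multiplying by x allows
  comparison with the odd terms of the sine series.\<close>

lemma csinc_eq_sinc_deriv: "csinc = sinc_deriv 0"
proof
  fix z
  show "csinc z = sinc_deriv 0 z"
  proof (cases "z = 0")
    case True
    then show ?thesis
      using spherical_bessel_eq_sinc_deriv[of 0 0] by (simp add: csinc_def spherical_bessel_j_def)
  next
    case False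
    define x where "x = of_real pi * z"
    have x: "x \<noteq> 0" using False by (simp add: x_def)
    have "(\<lambda>k. (- 1) ^ k / fact (2 * k + 1) * x ^ (2 * k)) sums sinc_deriv 0 z"
      using sinc_deriv_sums'[of 0 z] by (simp add: x_def del: fact_Suc)
    then have 1: "(\<lambda>k. (- 1) ^ k / fact (2 * k + 1) * x ^ (2 * k) * x) sums (sinc_deriv 0 z * x)"
      by (rule sums_mult2)
    have "strict_mono (\<lambda>k::nat. 2 * k + 1)" by (simp add: strict_mono_def)
    then have "(\<lambda>k. sin_coeff (2 * k + 1) *\<^sub>R x ^ (2 * k + 1)) sums sin x"
      using sin_converges[of x]
      by (subst sums_mono_reindex[where f = "\<lambda>n. sin_coeff n *\<^sub>R x ^ n"]) (auto simp: sin_coeff_def elim!: oddE)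
    then have "(\<lambda>k. (- 1) ^ k / fact (2 * k + 1) * x ^ (2 * k) * x) sums sin x"
      by (simp add: sin_coeff_def scaleR_conv_of_real mult_ac del: fact_Suc)
    with 1 have "sinc_deriv 0 z * x = sin x" using sums_unique2 by blast
    then show ?thesis using False x by (simp add: csinc_def x_def field_simps)
  qed
qed

lemma PL_0: "PL 0 = 1"
proof -
  have "PL 0 = monom (coeff (PL 0) 0) 0"
    using poly_as_sum_of_monoms[of "PL 0"] by (simp add: degree_PL)
  then show ?thesis by (simp add: coeff_PL coeff_legendre)
qed

lemma chromatic_deriv_csinc: "chromatic_deriv n csinc z = (- 1) ^ n * sinc_deriv n z"
proof -
  have "chromatic_deriv n csinc z =
      \<i> ^ n * (LINT w|lborel. of_real (poly (PL n) w) * (cutoff pi (sinc_density 0) w * exp (\<i> * of_real w * z)))"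
    unfolding csinc_eq_sinc_deriv sinc_deriv_def
    by (rule chromatic_deriv_fourier_int[OF sinc_density_cutoff(5,2)])
  also have "\<i> ^ n = (- 1) ^ n * (- \<i>) ^ n" by (simp flip: power_mult_distrib)
  also have "(- 1) ^ n * (- \<i>) ^ n * (LINT w|lborel. of_real (poly (PL n) w) * (cutoff pi (sinc_density 0) w * exp (\<i> * of_real w * z))) =
      (- 1) ^ n * sinc_deriv n z"
    unfolding sinc_deriv_def fourier_int_def mult.assoc integral_mult_right_zero[symmetric]
    by (intro Bochner_Integration.integral_cong refl)
       (simp add: cutoff_def sinc_density_def PL_0 scaleR_conv_of_real)
  finally show ?thesis .
qed

text \<open>The chain rule puts (-1)^k on the k-th derivative; the parity of \<open>PL n\<close>
  turns it into the common sign (-1)^n.\<close>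

lemma chromatic_deriv_reflect:
  assumes "f holomorphic_on UNIV"
  shows "chromatic_deriv n (\<lambda>w. f (z - w)) u = (- 1) ^ n * chromatic_deriv n f (z - u)"
proof -
  have d: "(deriv ^^ k) (\<lambda>w. f (z - w)) u = (- 1) ^ k * (deriv ^^ k) f (z - u)" for k
    using higher_deriv_compose_linear'[OF assms, of UNIV u "-1" z k] by simp
  have "complex_of_real (coeff (PL n) k) * \<i> ^ k * (deriv ^^ k) (\<lambda>w. f (z - w)) u =
      (- 1) ^ n * (complex_of_real (coeff (PL n) k) * \<i> ^ k * (deriv ^^ k) f (z - u))" for k
  proof -
    have "complex_of_real (coeff (PL n) k) * \<i> ^ k * (deriv ^^ k) (\<lambda>w. f (z - w)) u =
        of_real ((- 1) ^ k * coeff (PL n) k) * (\<i> ^ k * (deriv ^^ k) f (z - u))"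
      unfolding d by simp
    then show ?thesis unfolding minus_one_power_coeff_PL[of _ n] by simp
  qed
  then show ?thesis
    unfolding chromatic_deriv_def by (simp only: sum_distrib_left[symmetric] mult.left_commute)
qed

lemma chromatic_deriv_csinc_reflect: "chromatic_deriv n (\<lambda>w. csinc (z - w)) u = sinc_deriv n (z - u)"
proof -
  have "csinc holomorphic_on UNIV"
    unfolding csinc_eq_sinc_deriv sinc_deriv_def by (rule holomorphic_fourier_int[OF sinc_density_cutoff(5,2)])
  from chromatic_deriv_reflect[OF this, of n z u] show ?thesis
    by (simp add: chromatic_deriv_csinc flip: mult.assoc power_mult_distrib)
qed

section \<open>Chromatic expansion of entire functions\<close>

lemma fact_double_ratio_mono:
  assumes "j \<le> n"
  shows "fact n * fact (2 * j) \<le> fact (2 * n) * (fact j :: real)"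
  using assms
proof (induction n rule: dec_induct)
  case (step n)
  have "fact (Suc n) * fact (2 * j) = (real n + 1) * (fact n * fact (2 * j))"
    by (simp add: algebra_simps)
  also have "\<dots> \<le> (real n + 1) * (fact (2 * n) * fact j)"
    by (intro mult_left_mono step.IH) auto
  also have "\<dots> \<le> ((2 * real n + 2) * (2 * real n + 1)) * (fact (2 * n) * fact j)"
  proof (intro mult_right_mono)
    have "(real n + 1) * 1 \<le> (real n + 1) * (2 * (2 * real n + 1))"
      by (intro mult_left_mono) auto
    then show "real n + 1 \<le> (2 * real n + 2) * (2 * real n + 1)" by (simp add: algebra_simps)
  qed auto
  also have "\<dots> = fact (2 * Suc n) * fact j"
    by (simp add: algebra_simps)
  finally show ?case .
qed simp

lemma fact_double_ratio_antimono:
  "fact (n + k) / fact (2 * n + 2 * k + 1) \<le> (fact n / fact (2 * n + 1) :: real)"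
proof (induction k)
  case (Suc k)
  have "fact (n + Suc k) / fact (2 * n + 2 * Suc k + 1) =
      (real n + k + 1) / ((2 * real n + 2 * k + 3) * (2 * real n + 2 * k + 2)) * (fact (n + k) / fact (2 * n + 2 * k + 1) :: real)"
  proof -
    have "fact (2 * n + 2 * Suc k + 1) = (2 * real n + 2 * k + 3) * (2 * real n + 2 * k + 2) * fact (2 * n + 2 * k + 1)"
      by (simp add: algebra_simps)
    moreover have "fact (n + Suc k) = (real n + k + 1) * fact (n + k)" by (simp add: algebra_simps)
    ultimately show ?thesis by (simp only: times_divide_times_eq)
  qed
  also have "\<dots> \<le> 1 * (fact n / fact (2 * n + 1))"
  proof (intro mult_mono Suc.IH)
    have "1 * (real n + k + 1) \<le> (2 * real n + 2 * k + 3) * (2 * real n + 2 * k + 2)"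
      by (intro mult_mono) auto
    then show "(real n + k + 1) / ((2 * real n + 2 * k + 3) * (2 * real n + 2 * k + 2)) \<le> 1"
      by (intro divide_le_eq_1_pos[THEN iffD2] mult_pos_pos) auto
  qed auto
  finally show ?case by simp
qed simp

lemma power_div_fact_le_exp:
  fixes x :: real
  assumes "0 \<le> x"
  shows "x ^ k / fact k \<le> exp x"
proof -
  have "(\<lambda>n. x ^ n / fact n) sums exp x"
    using exp_converges[of x] by (simp add: divide_inverse mult.commute)
  then have "(\<Sum>n\<in>{k}. x ^ n / fact n) \<le> exp x"
    using assms sum_le_suminf[of "\<lambda>n. x ^ n / fact n" "{k}"] by (simp add: sums_iff)
  then show ?thesis by simp
qed

text \<open>Hence the absolute values of the Taylor terms of phi_n at h are, without any loss,
  moment terms at |h|.\<close>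

lemma PL_moment_nonneg: "poly_mean (monom 1 p * PL n) \<ge> 0"
  by (auto simp: PL_moment intro!: divide_nonneg_nonneg mult_nonneg_nonneg)

text \<open>The bound is the leading term, p = n, times an exponential: the factorial ratio of each
  later term p = n + 2k is at most that of the leading one, and the remaining ((pi t)^2)^k / k! sum
  to exp((pi t)^2).\<close>

lemma PL_moment_series_bound:
  assumes t: "t \<ge> 0"
  obtains S where "(\<lambda>p. poly_mean (monom 1 p * PL n) / fact p * t ^ p) sums S"
    "S \<le> sqrt (2 * real n + 1) * (pi * t) ^ n * 2 ^ n * fact n / fact (2 * n + 1) * exp ((pi * t)\<^sup>2)"
proof -
  let ?f = "\<lambda>p. poly_mean (monom 1 p * PL n) / fact p * t ^ p"
  define D where "D = sqrt (2 * real n + 1) * (pi * t) ^ n * 2 ^ n * fact n / fact (2 * n + 1)"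
  have f: "?f (n + 2 * k) = sqrt (2 * real n + 1) * (pi * t) ^ n * 2 ^ n * (((pi * t)\<^sup>2) ^ k / fact k) * (fact (n + k) / fact (2 * n + 2 * k + 1))" for k
  proof -
    have e: "(n \<le> n + 2 * k \<and> even (n + 2 * k - n)) = True" "(n + 2 * k - n) div 2 = k" "n + (n + 2 * k) + 1 = 2 * n + 2 * k + 1"
      by simp_all
    have p: "pi ^ (n + 2 * k) * t ^ (n + 2 * k) = (pi * t) ^ n * ((pi * t)\<^sup>2) ^ k"
      unfolding power_mult_distrib[of pi t, symmetric] by (simp only: power_add power_mult)
    have "s * P * T * F * G / (A * B) / F * Q = s * (P * Q) * T * G / (A * B)" if "F > 0" for s P T F G A B Q :: real
      using that by simp
    from this[of "fact (n + 2 * k)" "sqrt (2 * real n + 1)" "pi ^ (n + 2 * k)" "2 ^ n" "fact (n + k)" "fact k" "fact (2 * n + 2 * k + 1)" "t ^ (n + 2 * k)"]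
    show ?thesis unfolding PL_moment e if_True p by (simp add: mult_ac)
  qed
  have f0: "?f (n + 2 * k) \<ge> 0" for k
    using PL_moment_nonneg t by (intro mult_nonneg_nonneg divide_nonneg_nonneg) auto
  have le: "?f (n + 2 * k) \<le> D * (((pi * t)\<^sup>2) ^ k / fact k)" for k
  proof -
    have "?f (n + 2 * k) \<le> sqrt (2 * real n + 1) * (pi * t) ^ n * 2 ^ n * (((pi * t)\<^sup>2) ^ k / fact k) * (fact n / fact (2 * n + 1))"
      unfolding f by (intro mult_left_mono fact_double_ratio_antimono mult_nonneg_nonneg divide_nonneg_nonneg) (use t in auto)
    then show ?thesis by (simp add: D_def mult_ac del: fact_Suc)
  qed
  have E: "(\<lambda>k. D * (((pi * t)\<^sup>2) ^ k / fact k)) sums (D * exp ((pi * t)\<^sup>2))"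
    using exp_converges[of "(pi * t)\<^sup>2"] by (intro sums_mult) (simp add: divide_inverse mult.commute)
  then have sm: "summable (\<lambda>k. ?f (n + 2 * k))"
  proof (intro summable_comparison_test[OF _ sums_summable[OF E]] exI allI impI)
    fix k
    show "norm (?f (n + 2 * k)) \<le> D * (((pi * t)\<^sup>2) ^ k / fact k)"
      using le[of k] f0[of k] by (simp only: real_norm_def abs_of_nonneg)
  qed
  then have S: "(\<lambda>k. ?f (n + 2 * k)) sums (\<Sum>k. ?f (n + 2 * k))" by (rule summable_sums)
  have "(\<Sum>k. ?f (n + 2 * k)) \<le> D * exp ((pi * t)\<^sup>2)"
    using suminf_le[OF le sm sums_summable[OF E]] E by (simp add: sums_iff)
  moreover have "?f sums (\<Sum>k. ?f (n + 2 * k))"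
  proof (rule sums_mono_reindex[where g = "\<lambda>k. n + 2 * k" and f = ?f, THEN iffD1, OF _ _ S])
    show "strict_mono (\<lambda>k. n + 2 * k)" by (simp add: strict_mono_def)
    fix p assume p: "p \<notin> range (\<lambda>k. n + 2 * k)"
    have "\<not> (n \<le> p \<and> even (p - n))"
    proof
      assume "n \<le> p \<and> even (p - n)"
      then have "p = n + 2 * ((p - n) div 2)" using dvd_mult_div_cancel[of 2 "p - n"] by linarith
      with p show False by blast
    qed
    then show "?f p = 0" by (simp only: PL_moment) simp
  qed
  ultimately show thesis using that unfolding D_def by blast
qed

text \<open>The left side multiplies a coefficient of P_n, the Cauchy factor m!/R^m and the leading
  term of the moment series. With k = (n-m)/2 the factorials reduce to binom(n,k) (n+m)!/(2n)! <=
  1/k!, and the powers to (t/R)^n ((pi R)^2)^k, one term of an exponential series.\<close>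

lemma coeff_PL_bound:
  assumes "t \<ge> 0" "R > 0" "m \<le> n"
  shows "\<bar>coeff (PL n) m\<bar> * (fact m / R ^ m) * (sqrt (2 * real n + 1) * (pi * t) ^ n * 2 ^ n * fact n / fact (2 * n + 1))
     \<le> (t / R) ^ n * exp ((pi * R)\<^sup>2)"
proof (cases "even (n - m)")
  case False
  then show ?thesis using assms by (simp add: coeff_PL coeff_legendre)
next
  case True
  define k where "k = (n - m) div 2"
  have nm: "n - m = 2 * k" using True by (simp add: k_def)
  then have n: "n = m + 2 * k" using assms(3) by simp
  have nk: "n + m = 2 * (n - k)" "k \<le> n" using n by auto
  define s where "s = sqrt (2 * real n + 1)"
  have s: "s * s = 2 * real n + 1" "s \<ge> 0" by (auto simp: s_def)
  have c: "\<bar>coeff (PL n) m\<bar> = s * (real (n choose k) * fact (n + m) / (fact m * 2 ^ n * fact n)) / pi ^ m"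
    using True assms(3) s by (simp add: coeff_PL coeff_legendre nm abs_mult s_def)
  have F: "fact (2 * n + 1) = (2 * real n + 1) * fact (2 * n)" by simp
  have "\<bar>coeff (PL n) m\<bar> * (fact m / R ^ m) * (s * (pi * t) ^ n * 2 ^ n * fact n / fact (2 * n + 1)) =
      real (n choose k) * fact (n + m) / fact (2 * n) * ((pi * t) ^ n / (pi ^ m * R ^ m))"
  proof -
    have "s * (C * G / (M * P * N)) / Q * (M / RR) * (s * X * P * N / (s * s * H)) = C * G / H * (X / (Q * RR))"
      if "s > 0" "M > 0" "P > 0" "N > 0" "H > 0" "Q > 0" "RR > 0" for C G M P N Q RR X H :: real
      using that by (simp add: divide_simps)
    from this[of "fact m" "2 ^ n" "fact n" "fact (2 * n)" "pi ^ m" "R ^ m" "real (n choose k)" "fact (n + m)" "(pi * t) ^ n"]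
    show ?thesis unfolding c F s(1)[symmetric] using assms(2) by (simp add: s_def add_pos_nonneg)
  qed
  also have "(pi * t) ^ n / (pi ^ m * R ^ m) = (t / R) ^ n * ((pi * R)\<^sup>2) ^ k"
  proof -
    have "(pi * R) ^ n = (pi * R) ^ m * ((pi * R)\<^sup>2) ^ k" by (simp add: n power_add power_mult)
    moreover have "(pi * t) ^ n = (t / R) ^ n * (pi * R) ^ n"
      using assms(2) by (simp add: mult.commute flip: power_mult_distrib)
    ultimately show ?thesis using assms(2) by (simp add: power_mult_distrib)
  qed
  also have "real (n choose k) * fact (n + m) / fact (2 * n) * ((t / R) ^ n * ((pi * R)\<^sup>2) ^ k) \<le>
      1 / fact k * ((t / R) ^ n * ((pi * R)\<^sup>2) ^ k)"
  proof (intro mult_right_mono)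
    \<comment> \<open>Since n + m = 2(n - k), the claim says that (2j)!/j! at j = n - k is at most
      its value at j = n.\<close>
    have "fact n * fact (2 * (n - k)) \<le> fact (2 * n) * (fact (n - k) :: real)"
      by (rule fact_double_ratio_mono) simp
    then show "real (n choose k) * fact (n + m) / fact (2 * n) \<le> 1 / fact k"
      unfolding nk(1) binomial_fact[OF nk(2)] by (simp add: divide_simps mult_ac)
  qed (use assms in auto)
  also have "\<dots> = (t / R) ^ n * (((pi * R)\<^sup>2) ^ k / fact k)" by simp
  also have "\<dots> \<le> (t / R) ^ n * exp ((pi * R)\<^sup>2)"
    using assms by (intro mult_left_mono power_div_fact_le_exp) auto
  finally show ?thesis by (simp only: s_def)
qed

text \<open>Fubini for double series: summable row norms give unconditional summability over all
  pairs, so the sums by rows and by columns agree.\<close>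

lemma sums_swap_dominated:
  fixes T :: "nat \<Rightarrow> nat \<Rightarrow> 'a :: banach"
  assumes a: "\<And>n. (\<lambda>p. T n p) sums a n" and N: "\<And>n. (\<lambda>p. norm (T n p)) sums N n" "summable N"
    and b: "\<And>p. ((\<lambda>n. T n p) has_sum b p) UNIV" "b sums S"
  shows "a sums S"
proof -
  have N0: "N n \<ge> 0" for n by (rule sums_le[OF _ sums_zero N(1)[of n]]) simp
  have "(\<lambda>(n, p). norm (T n p)) summable_on (UNIV \<times> UNIV)"
    using N N0
    by (intro summable_on_SigmaI[where g = N])
       (auto intro: sums_nonneg_imp_has_sum simp: summable_on_UNIV_nonneg_real_iff)
  then have "(\<lambda>x. norm (case_prod T x)) summable_on (UNIV \<times> UNIV)"
    by (simp add: case_prod_unfold)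
  then have "case_prod T summable_on (UNIV \<times> UNIV)"
    by (rule abs_summable_summable)
  then obtain s where s: "(case_prod T has_sum s) (UNIV \<times> UNIV)" by (auto simp: summable_on_def)
  have "(a has_sum s) UNIV"
  proof (rule has_sum_SigmaD[OF s])
    fix n
    show "((\<lambda>p. case_prod T (n, p)) has_sum a n) UNIV"
      using norm_summable_imp_has_sum[OF sums_summable[OF N(1)[of n]] a] by simp
  qed
  moreover have "(b has_sum s) UNIV"
  proof -
    have "((\<lambda>(p, n). T n p) has_sum s) (UNIV \<times> UNIV)"
      using s by (subst (asm) has_sum_swap) simp
    then show ?thesis by (rule has_sum_SigmaD) (use b(1) in auto)
  qed
  ultimately have "a sums s" "b sums s" by (auto intro: has_sum_imp_sums)
  with b(2) show ?thesis using sums_unique2[of b S s] by simp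
qed

text \<open>The coefficient of h^p, up to 1/p!, after the exchange. Parity replaces the sign (-1)^n
  by (-1)^k, so n survives only in moment times coefficient, where the inverse-matrix relation
  applies.\<close>

lemma chromatic_moment_sum:
  "(\<Sum>n\<le>p. chromatic_deriv n f u * ((- \<i>) ^ n * \<i> ^ p * of_real (poly_mean (monom 1 p * PL n)))) = (deriv ^^ p) f u"
proof -
  let ?M = "\<lambda>n. poly_mean (monom 1 p * PL n)" and ?D = "\<lambda>k. (deriv ^^ k) f u"
  have "chromatic_deriv n f u * ((- \<i>) ^ n * \<i> ^ p * of_real (?M n)) =
      (\<Sum>k\<le>p. \<i> ^ p * (- \<i>) ^ k * ?D k * of_real (?M n * coeff (PL n) k))" if "n \<le> p" for n
  proof -
    have "(\<Sum>k\<le>degree (PL n). complex_of_real (coeff (PL n) k) * \<i> ^ k * ?D k) =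
        (\<Sum>k\<le>p. complex_of_real (coeff (PL n) k) * \<i> ^ k * ?D k)"
      using that by (intro sum.mono_neutral_left) (auto simp: degree_PL coeff_eq_0)
    then have "chromatic_deriv n f u * ((- \<i>) ^ n * \<i> ^ p * of_real (?M n)) =
        ((- \<i>) ^ n * (- \<i>) ^ n) * (\<i> ^ p * of_real (?M n)) * (\<Sum>k\<le>p. complex_of_real (coeff (PL n) k) * \<i> ^ k * ?D k)"
      unfolding chromatic_deriv_def by (simp add: mult_ac)
    also have "(- \<i>) ^ n * (- \<i>) ^ n = (- 1) ^ n" by (simp flip: power_mult_distrib)
    also have "(- 1) ^ n * (\<i> ^ p * of_real (?M n)) * (\<Sum>k\<le>p. complex_of_real (coeff (PL n) k) * \<i> ^ k * ?D k) =
        (\<Sum>k\<le>p. \<i> ^ p * (- \<i>) ^ k * ?D k * of_real (?M n * coeff (PL n) k))"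
      unfolding sum_distrib_left
    proof (intro sum.cong refl)
      fix k
      have 1: "(- 1) ^ n * complex_of_real (coeff (PL n) k) = (- 1) ^ k * of_real (coeff (PL n) k)"
        using arg_cong[OF minus_one_power_coeff_PL[of k n], of complex_of_real] by auto
      have 2: "(- \<i>) ^ k = (- 1) ^ k * \<i> ^ k" by (simp flip: power_mult_distrib)
      have "(- 1) ^ n * (\<i> ^ p * of_real (?M n)) * (complex_of_real (coeff (PL n) k) * \<i> ^ k * ?D k) =
          ((- 1) ^ n * complex_of_real (coeff (PL n) k)) * (\<i> ^ p * of_real (?M n) * \<i> ^ k * ?D k)"
        by (simp only: mult_ac)
      also have "\<dots> = ((- 1) ^ k * complex_of_real (coeff (PL n) k)) * (\<i> ^ p * of_real (?M n) * \<i> ^ k * ?D k)"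
        by (simp only: 1)
      also have "\<dots> = \<i> ^ p * ((- 1) ^ k * \<i> ^ k) * ?D k * (of_real (?M n) * of_real (coeff (PL n) k))"
        by (simp only: mult_ac)
      finally show "(- 1) ^ n * (\<i> ^ p * of_real (?M n)) * (complex_of_real (coeff (PL n) k) * \<i> ^ k * ?D k) =
          \<i> ^ p * (- \<i>) ^ k * ?D k * of_real (?M n * coeff (PL n) k)"
        by (simp only: 2 of_real_mult)
    qed
    finally show ?thesis .
  qed
  then have "(\<Sum>n\<le>p. chromatic_deriv n f u * ((- \<i>) ^ n * \<i> ^ p * of_real (?M n))) =
      (\<Sum>n\<le>p. \<Sum>k\<le>p. \<i> ^ p * (- \<i>) ^ k * ?D k * of_real (?M n * coeff (PL n) k))"
    by (intro sum.cong refl) simp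
  also have "\<dots> = (\<Sum>k\<le>p. \<i> ^ p * (- \<i>) ^ k * ?D k * of_real (\<Sum>n\<le>p. ?M n * coeff (PL n) k))"
    by (subst sum.swap) (simp add: sum_distrib_left)
  also have "\<dots> = (\<Sum>k\<le>p. if k = p then \<i> ^ p * (- \<i>) ^ p * ?D p else 0)"
    by (intro sum.cong refl) (simp only: PL_moment_coeff_sum atMost_iff, simp)
  also have "\<dots> = ?D p"
    by (simp flip: power_mult_distrib)
  finally show ?thesis .
qed

theorem chromatic_expansion:
  assumes f: "f holomorphic_on UNIV"
  shows "(\<lambda>n. chromatic_deriv n f u * sinc_deriv n h) sums f (u + h)"
proof -
  define t where "t = cmod h"
  \<comment> \<open>Positive even for h = 0, and it makes t/R < 1.\<close>
  define R where "R = 2 * t + 1"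
  have t: "t \<ge> 0" by (simp add: t_def)
  then have R: "R > 0" unfolding R_def by linarith
  let ?D = "\<lambda>k. (deriv ^^ k) f u" and ?c = "\<lambda>n. chromatic_deriv n f u"
  have "compact (f ` sphere u R)"
    by (intro compact_continuous_image holomorphic_on_imp_continuous_on holomorphic_on_subset[OF f]) auto
  then obtain B where B: "\<And>x. x \<in> sphere u R \<Longrightarrow> cmod (f x) \<le> B"
    using compact_imp_bounded bounded_iff by (metis imageI)
  have B0: "B \<ge> 0" using order_trans[OF norm_ge_zero B[of "u + of_real R"]] R by (simp add: dist_norm)
  have D: "cmod (?D k) \<le> fact k * B / R ^ k" for k
    using B R by (intro Cauchy_inequality holomorphic_on_imp_continuous_on holomorphic_on_subset[OF f]) (auto simp: dist_norm)
  define A where "A n = sqrt (2 * real n + 1) * (pi * t) ^ n * 2 ^ n * fact n / fact (2 * n + 1)" for n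
  have A0: "A n \<ge> 0" for n unfolding A_def using t by (intro divide_nonneg_nonneg mult_nonneg_nonneg) auto
  \<comment> \<open>The factor n + 1 counts the coefficients of P_n, each contributing at most B
    (t/R)^n exp((pi R)^2).\<close>
  have cA: "cmod (?c n) * A n \<le> B * exp ((pi * R)\<^sup>2) * (real (Suc n) * (t / R) ^ n)" for n
  proof -
    have "cmod (?c n) \<le> (\<Sum>k\<le>n. \<bar>coeff (PL n) k\<bar> * (fact k * B / R ^ k))"
    proof -
      have "cmod (?c n) = cmod (\<Sum>k\<le>n. complex_of_real (coeff (PL n) k) * \<i> ^ k * ?D k)"
        by (simp add: chromatic_deriv_def degree_PL norm_mult norm_power)
      also have "\<dots> \<le> (\<Sum>k\<le>n. \<bar>coeff (PL n) k\<bar> * (fact k * B / R ^ k))"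
      proof (rule sum_norm_le)
        fix k
        have "cmod (complex_of_real (coeff (PL n) k) * \<i> ^ k * ?D k) = \<bar>coeff (PL n) k\<bar> * cmod (?D k)"
          by (simp add: norm_mult norm_power)
        also have "\<dots> \<le> \<bar>coeff (PL n) k\<bar> * (fact k * B / R ^ k)" by (intro mult_left_mono D) auto
        finally show "cmod (complex_of_real (coeff (PL n) k) * \<i> ^ k * ?D k) \<le> \<bar>coeff (PL n) k\<bar> * (fact k * B / R ^ k)" .
      qed
      finally show ?thesis .
    qed
    then have "cmod (?c n) * A n \<le> (\<Sum>k\<le>n. \<bar>coeff (PL n) k\<bar> * (fact k * B / R ^ k)) * A n"
      using A0 by (rule mult_right_mono)
    also have "\<dots> = (\<Sum>k\<le>n. B * (\<bar>coeff (PL n) k\<bar> * (fact k / R ^ k) * A n))"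
      unfolding sum_distrib_right by (intro sum.cong refl) simp
    also have "\<dots> \<le> (\<Sum>k\<le>n. B * ((t / R) ^ n * exp ((pi * R)\<^sup>2)))"
      unfolding A_def using t R B0 by (intro sum_mono mult_left_mono coeff_PL_bound) auto
    finally show ?thesis by (simp add: mult_ac)
  qed
  define T where "T n p = ?c n * ((- \<i>) ^ n * \<i> ^ p * of_real (poly_mean (monom 1 p * PL n) / fact p) * h ^ p)" for n p
  define S where "S n = (\<Sum>p. poly_mean (monom 1 p * PL n) / fact p * t ^ p)" for n
  have S: "(\<lambda>p. poly_mean (monom 1 p * PL n) / fact p * t ^ p) sums S n" "S n \<le> A n * exp ((pi * t)\<^sup>2)" for n
  proof -
    obtain s where s: "(\<lambda>p. poly_mean (monom 1 p * PL n) / fact p * t ^ p) sums s"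
        "s \<le> A n * exp ((pi * t)\<^sup>2)"
      unfolding A_def by (rule PL_moment_series_bound[OF t])
    have "S n = s" unfolding S_def by (rule sums_unique[OF s(1), symmetric])
    with s show "(\<lambda>p. poly_mean (monom 1 p * PL n) / fact p * t ^ p) sums S n"
      "S n \<le> A n * exp ((pi * t)\<^sup>2)" by simp_all
  qed
  have normT: "norm (T n p) = cmod (?c n) * (poly_mean (monom 1 p * PL n) / fact p * t ^ p)" for n p
    using PL_moment_nonneg[of p n] by (simp add: T_def norm_mult norm_power norm_divide t_def)
  show ?thesis
  proof (rule sums_swap_dominated[where T = T and N = "\<lambda>n. cmod (?c n) * S n" and b = "\<lambda>p. ?D p / fact p * h ^ p"])
    show "(\<lambda>p. T n p) sums (?c n * sinc_deriv n h)" for n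
      unfolding T_def by (intro sums_mult sinc_deriv_sums)
    show "(\<lambda>p. norm (T n p)) sums (cmod (?c n) * S n)" for n
      unfolding normT by (intro sums_mult S(1))
    have "t / R < 1" using t by (simp add: R_def)
    then have "summable (\<lambda>n. real (Suc n) * (t / R) ^ n)"
      using t R geometric_deriv_sums[of "t / R"] by (simp add: sums_iff)
    then have "summable (\<lambda>n. B * exp ((pi * R)\<^sup>2) * (real (Suc n) * (t / R) ^ n) * exp ((pi * t)\<^sup>2))"
      by (intro summable_mult2 summable_mult)
    then show "summable (\<lambda>n. cmod (?c n) * S n)"
    proof (rule summable_comparison_test[rotated], intro exI allI impI)
      fix n
      have "0 \<le> S n"
        using PL_moment_nonneg t by (intro sums_le[OF _ sums_zero S(1)] mult_nonneg_nonneg divide_nonneg_nonneg) auto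
      then have "norm (cmod (?c n) * S n) = cmod (?c n) * S n" by (simp add: norm_mult)
      also have "\<dots> \<le> cmod (?c n) * (A n * exp ((pi * t)\<^sup>2))" by (intro mult_left_mono S(2)) auto
      also have "\<dots> \<le> B * exp ((pi * R)\<^sup>2) * (real (Suc n) * (t / R) ^ n) * exp ((pi * t)\<^sup>2)"
        using mult_right_mono[OF cA[of n], of "exp ((pi * t)\<^sup>2)"] by (simp only: mult.assoc) simp
      finally show "norm (cmod (?c n) * S n) \<le> B * exp ((pi * R)\<^sup>2) * (real (Suc n) * (t / R) ^ n) * exp ((pi * t)\<^sup>2)" .
    qed
    \<comment> \<open>For fixed p the moments vanish when n > p, so each column is a finite
      sum.\<close>
    show "((\<lambda>n. T n p) has_sum (?D p / fact p * h ^ p)) UNIV" for p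
    proof (rule has_sum_finite_neutralI[of "{..p}"])
      show "T n p = 0" if "n \<in> UNIV - {..p}" for n
        using that by (simp add: T_def PL_moment)
      have "(\<Sum>n\<le>p. T n p) = (\<Sum>n\<le>p. ?c n * ((- \<i>) ^ n * \<i> ^ p * of_real (poly_mean (monom 1 p * PL n)))) / fact p * h ^ p"
        unfolding T_def sum_divide_distrib sum_distrib_right by (intro sum.cong refl) simp
      then show "?D p / fact p * h ^ p = (\<Sum>n\<le>p. T n p)"
        by (simp only: chromatic_moment_sum)
    qed auto
    show "(\<lambda>p. ?D p / fact p * h ^ p) sums f (u + h)"
      using holomorphic_power_series[of f u "t + 1" "u + h"] holomorphic_on_subset[OF f]
      by (simp add: t_def dist_norm)
  qed
qed

section \<open>Convergence for band-limited functions\<close>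

lemma poly_mean_square_sum_PL:
  assumes "finite I"
  shows "poly_mean ((\<Sum>n\<in>I. smult (a n) (PL n)) * (\<Sum>n\<in>I. smult (a n) (PL n))) = (\<Sum>n\<in>I. (a n)\<^sup>2)"
proof -
  have "poly_mean ((\<Sum>n\<in>I. smult (a n) (PL n)) * (\<Sum>n\<in>I. smult (a n) (PL n))) =
      (\<Sum>n\<in>I. \<Sum>m\<in>I. a n * (a m * (if n = m then 1 else 0)))"
    by (simp add: sum_product poly_mean_sum poly_mean_smult PL_orthonormal mult_smult_left mult_smult_right mult_ac)
  also have "\<dots> = (\<Sum>n\<in>I. (a n)\<^sup>2)"
    using assms by (simp add: mult_delta_right power2_eq_square)
  finally show ?thesis .
qed

text \<open>On the real line the squared modulus is the sum of squares of two real polynomials,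
  built from the real and imaginary parts of the \<open>b n\<close>, so orthonormality for
  \<open>poly_mean\<close> suffices.\<close>

lemma integral_square_sum_PL:
  fixes b :: "nat \<Rightarrow> complex"
  assumes "finite I"
  shows "(LINT w|lborel. (cmod (cutoff pi (\<lambda>w. \<Sum>n\<in>I. b n * of_real (poly (PL n) w)) w))\<^sup>2) = 2 * pi * (\<Sum>n\<in>I. (cmod (b n))\<^sup>2)"
    and "integrable lborel (\<lambda>w. (cmod (cutoff pi (\<lambda>w. \<Sum>n\<in>I. b n * of_real (poly (PL n) w)) w))\<^sup>2)"
proof -
  define qr where "qr = (\<Sum>n\<in>I. smult (Re (b n)) (PL n))"
  define qi where "qi = (\<Sum>n\<in>I. smult (Im (b n)) (PL n))"
  define q where "q = qr * qr + qi * qi"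
  have eq: "complex_of_real ((cmod (cutoff pi (\<lambda>w. \<Sum>n\<in>I. b n * of_real (poly (PL n) w)) w))\<^sup>2) =
      cutoff pi (\<lambda>w. of_real (poly q w)) w" for w
  proof -
    have "(cmod (\<Sum>n\<in>I. b n * of_real (poly (PL n) w)))\<^sup>2 = poly q w"
      unfolding cmod_power2 by (simp add: q_def qr_def qi_def poly_sum power2_eq_square)
    then show ?thesis by (simp add: cutoff_def indicator_def del: of_real_power)
  qed
  have "complex_of_real (LINT w|lborel. (cmod (cutoff pi (\<lambda>w. \<Sum>n\<in>I. b n * of_real (poly (PL n) w)) w))\<^sup>2) =
      of_real (2 * pi * poly_mean q)"
    unfolding integral_complex_of_real[symmetric] eq by (rule cutoff_poly_integral)
  also have "poly_mean q = (\<Sum>n\<in>I. (cmod (b n))\<^sup>2)"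
    unfolding q_def qr_def qi_def poly_mean_add poly_mean_square_sum_PL[OF assms]
    by (simp add: cmod_power2 sum.distrib)
  finally show "(LINT w|lborel. (cmod (cutoff pi (\<lambda>w. \<Sum>n\<in>I. b n * of_real (poly (PL n) w)) w))\<^sup>2) = 2 * pi * (\<Sum>n\<in>I. (cmod (b n))\<^sup>2)"
    by (simp only: of_real_eq_iff)
  have "integrable lborel (\<lambda>w. complex_of_real ((cmod (cutoff pi (\<lambda>w. \<Sum>n\<in>I. b n * of_real (poly (PL n) w)) w))\<^sup>2))"
    unfolding eq by (rule cutoff_facts(5)) (intro continuous_intros)
  then show "integrable lborel (\<lambda>w. (cmod (cutoff pi (\<lambda>w. \<Sum>n\<in>I. b n * of_real (poly (PL n) w)) w))\<^sup>2)"
    by (simp only: complex_of_real_integrable_eq)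
qed

lemma integrable_PL_mult:
  fixes K :: "real \<Rightarrow> complex"
  assumes K: "integrable lborel K" "\<forall>w. w \<notin> {-pi..pi} \<longrightarrow> K w = 0"
  shows "integrable lborel (\<lambda>w. of_real (poly (PL n) w) * K w)"
proof -
  have "integrable lborel (\<lambda>w. K w * cutoff pi (\<lambda>w. of_real (poly (PL n) w)) w)"
  proof -
    have k: "continuous_on UNIV (\<lambda>w. complex_of_real (poly (PL n) w))" by (intro continuous_intros)
    obtain M where "\<forall>w. cmod (cutoff pi (\<lambda>w. of_real (poly (PL n) w)) w) \<le> M"
      using cutoff_facts(3)[OF k] by blast
    then show ?thesis
      using cutoff_facts(1)[OF k] by (intro integrable_mult_bounded[OF K(1), where B = M]) auto
  qed
  moreover have "K w * cutoff pi (\<lambda>w. of_real (poly (PL n) w)) w = of_real (poly (PL n) w) * K w" for w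
    using K(2) by (cases "w \<in> {-pi..pi}") (auto simp: cutoff_def)
  ultimately show ?thesis by simp
qed

text \<open>Expands the nonnegative energy of \<open>K\<close> minus its projection \<open>L\<close>
  onto the span. The \<open>PL n\<close> are orthonormal for the mean, not the integral, hence the
  1/(2 pi) in \<open>b\<close>.\<close>

lemma bessel_inequality_PL:
  fixes K :: "real \<Rightarrow> complex"
  assumes K: "integrable lborel K" "\<forall>w. w \<notin> {-pi..pi} \<longrightarrow> K w = 0" "integrable lborel (\<lambda>w. (cmod (K w))\<^sup>2)"
    and I: "finite I"
  shows "(\<Sum>n\<in>I. (cmod (LINT w|lborel. of_real (poly (PL n) w) * K w))\<^sup>2) \<le> 2 * pi * (LINT w|lborel. (cmod (K w))\<^sup>2)"
proof -
  define a where "a n = (LINT w|lborel. of_real (poly (PL n) w) * K w)" for n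
  define b where "b n = a n / of_real (2 * pi)" for n
  define L where "L = cutoff pi (\<lambda>w. \<Sum>n\<in>I. b n * of_real (poly (PL n) w))"
  define s where "s = (\<Sum>n\<in>I. (cmod (a n))\<^sup>2)"
  have int: "integrable lborel (\<lambda>w. of_real (poly (PL n) w) * K w)" for n
    by (rule integrable_PL_mult[OF K(1,2)])
  have LK: "cnj (L w) * K w = (\<Sum>n\<in>I. cnj (b n) * (of_real (poly (PL n) w) * K w))" for w
    using K(2) by (cases "w \<in> {-pi..pi}") (auto simp: L_def cutoff_def sum_distrib_right mult.assoc)
  have LKint: "integrable lborel (\<lambda>w. cnj (L w) * K w)"
    unfolding LK using int by (intro Bochner_Integration.integrable_sum integrable_mult_right)
  have "(LINT w|lborel. cnj (L w) * K w) = (\<Sum>n\<in>I. cnj (b n) * a n)"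
    unfolding LK using int by (subst Bochner_Integration.integral_sum) (auto simp: a_def)
  also have "\<dots> = (\<Sum>n\<in>I. of_real ((cmod (a n))\<^sup>2 / (2 * pi)))"
    by (intro sum.cong refl) (simp add: b_def complex_norm_square mult.commute del: of_real_power)
  also have "\<dots> = of_real (s / (2 * pi))"
    by (simp only: s_def sum_divide_distrib of_real_sum)
  finally have cross: "(LINT w|lborel. Re (cnj (L w) * K w)) = s / (2 * pi)"
    using integral_Re[OF LKint] by simp
  have L2: "(LINT w|lborel. (cmod (L w))\<^sup>2) = s / (2 * pi)"
  proof -
    have "(LINT w|lborel. (cmod (L w))\<^sup>2) = 2 * pi * (\<Sum>n\<in>I. (cmod (b n))\<^sup>2)"
      unfolding L_def by (rule integral_square_sum_PL(1)[OF I])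
    also have "\<dots> = 2 * pi * (s / (2 * pi)\<^sup>2)"
      by (simp add: b_def s_def norm_divide power_divide sum_divide_distrib norm_mult)
    finally show ?thesis by (simp add: power2_eq_square)
  qed
  have L2int: "integrable lborel (\<lambda>w. (cmod (L w))\<^sup>2)"
    unfolding L_def by (rule integral_square_sum_PL(2)[OF I])
  have sq: "(cmod (K w - L w))\<^sup>2 = (cmod (K w))\<^sup>2 + (cmod (L w))\<^sup>2 - 2 * Re (cnj (L w) * K w)" for w
    by (simp add: cmod_power2 power2_diff algebra_simps)
  define R where "R w = Re (cnj (L w) * K w)" for w
  have R: "integrable lborel R" "(LINT w|lborel. R w) = s / (2 * pi)"
    unfolding R_def using integrable_Re[OF LKint] cross by auto
  have "0 \<le> (LINT w|lborel. (cmod (K w - L w))\<^sup>2)" by simp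
  also have "\<dots> = (LINT w|lborel. (cmod (K w))\<^sup>2) + (LINT w|lborel. (cmod (L w))\<^sup>2) - 2 * (LINT w|lborel. R w)"
    unfolding sq R_def[symmetric] using R(1) K(3) L2int by simp
  also have "\<dots> = (LINT w|lborel. (cmod (K w))\<^sup>2) - s / (2 * pi)"
    unfolding R(2) L2 by simp
  finally have "s / (2 * pi) \<le> (LINT w|lborel. (cmod (K w))\<^sup>2)" by simp
  then show ?thesis unfolding s_def a_def by (simp add: field_simps)
qed

text \<open>Cauchy-Schwarz as nonnegativity of a variance: on the interval subtract from |g| its
  mean \<open>m\<close>.\<close>

lemma integral_norm_square_le:
  fixes g :: "real \<Rightarrow> complex"
  assumes g: "integrable lborel g" "\<forall>w. w \<notin> {-A..A} \<longrightarrow> g w = 0" "integrable lborel (\<lambda>w. (cmod (g w))\<^sup>2)" and A: "A > 0"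
  shows "(LINT w|lborel. cmod (g w))\<^sup>2 \<le> 2 * A * (LINT w|lborel. (cmod (g w))\<^sup>2)"
proof -
  define I where "I = (LINT w|lborel. cmod (g w))"
  define m where "m = I / (2 * A)"
  have i: "integrable lborel (indicator {-A..A} :: real \<Rightarrow> real)" "(LINT w|lborel. indicator {-A..A} w) = 2 * A"
    using A by (auto simp: emeasure_lborel_Icc_eq)
  have sq: "(cmod (g w) - m * indicator {-A..A} w)\<^sup>2 = (cmod (g w))\<^sup>2 + m\<^sup>2 * indicator {-A..A} w - 2 * m * cmod (g w)" for w
    using g(2) by (cases "w \<in> {-A..A}") (auto simp: power2_diff)
  have "0 \<le> (LINT w|lborel. (cmod (g w) - m * indicator {-A..A} w)\<^sup>2)" by simp
  also have "\<dots> = (LINT w|lborel. (cmod (g w))\<^sup>2) + m\<^sup>2 * (2 * A) - 2 * m * I"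
    unfolding sq I_def i(2)[symmetric] using g(3) i(1) integrable_norm[OF g(1)]
    by simp
  also have "\<dots> = (LINT w|lborel. (cmod (g w))\<^sup>2) - I\<^sup>2 / (2 * A)"
    using A by (simp add: m_def power2_eq_square field_simps)
  finally have "I\<^sup>2 / (2 * A) \<le> (LINT w|lborel. (cmod (g w))\<^sup>2)" by simp
  then show ?thesis using A by (simp add: I_def field_simps)
qed

text \<open>Translation by \<open>u\<close> becomes the factor exp(-i w u) in the density, so a
  finite block of the series is one Fourier integral.\<close>

lemma sinc_deriv_combination:
  assumes "finite I"
  shows "(\<Sum>n\<in>I. b n * sinc_deriv n (z - u)) =
     fourier_int (cutoff pi (\<lambda>w. (\<Sum>n\<in>I. b n * sinc_density n w) * exp (- \<i> * of_real w * u))) z"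
proof -
  have int: "integrable lborel (\<lambda>w. b n * (cutoff pi (sinc_density n) w * exp (\<i> * of_real w * (z - u))))" for n
    by (intro integrable_mult_right integrable_fourier[OF sinc_density_cutoff(5,2)])
  have "(\<Sum>n\<in>I. b n * sinc_deriv n (z - u)) =
      (LINT w|lborel. (\<Sum>n\<in>I. b n * (cutoff pi (sinc_density n) w * exp (\<i> * of_real w * (z - u)))))"
    unfolding sinc_deriv_def fourier_int_def using int by (subst Bochner_Integration.integral_sum) simp_all
  also have "\<dots> = fourier_int (cutoff pi (\<lambda>w. (\<Sum>n\<in>I. b n * sinc_density n w) * exp (- \<i> * of_real w * u))) z"
    unfolding fourier_int_def
  proof (intro Bochner_Integration.integral_cong refl)
    fix w
    have "exp (\<i> * of_real w * (z - u)) = exp (- \<i> * of_real w * u) * exp (\<i> * of_real w * z)"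
      by (simp add: algebra_simps flip: exp_add)
    then show "(\<Sum>n\<in>I. b n * (cutoff pi (sinc_density n) w * exp (\<i> * of_real w * (z - u)))) =
        cutoff pi (\<lambda>w. (\<Sum>n\<in>I. b n * sinc_density n w) * exp (- \<i> * of_real w * u)) w * exp (\<i> * of_real w * z)"
      by (simp add: cutoff_def scaleR_conv_of_real sum_distrib_left sum_distrib_right mult_ac)
  qed
  finally show ?thesis .
qed

text \<open>\<open>C\<close> bounds |exp(-i w u)|^2 = exp(2 w Im u) on the band and equals 1 for
  real u. Both estimates reduce to the energy of the density: the L2 one by Plancherel, the
  pointwise one by Cauchy-Schwarz on an interval of length 2 pi.\<close>

lemma sinc_deriv_combination_bounds:
  fixes b :: "nat \<Rightarrow> complex" and u :: complex
  assumes I: "finite I"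
  defines "C \<equiv> exp (2 * pi * \<bar>Im u\<bar>)"
  shows "(\<lambda>t. \<Sum>n\<in>I. b n * sinc_deriv n (of_real t - u)) \<in> BL pi"
    and "(\<integral>\<^sup>+t. ennreal ((cmod (\<Sum>n\<in>I. b n * sinc_deriv n (of_real t - u)))\<^sup>2) \<partial>lborel) \<le> ennreal (C * (\<Sum>n\<in>I. (cmod (b n))\<^sup>2))"
    and "(cmod (\<Sum>n\<in>I. b n * sinc_deriv n (of_real t - u)))\<^sup>2 \<le> C * (\<Sum>n\<in>I. (cmod (b n))\<^sup>2)"
proof -
  define k where "k w = (\<Sum>n\<in>I. b n * sinc_density n w) * exp (- \<i> * of_real w * u)" for w
  have k: "continuous_on UNIV k"
    unfolding k_def by (intro continuous_intros continuous_sinc_density)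
  note kf = cutoff_facts[OF k, of pi]
  have comb: "(\<Sum>n\<in>I. b n * sinc_deriv n (of_real t - u)) = fourier_int (cutoff pi k) (of_real t)" for t
    unfolding k_def by (rule sinc_deriv_combination[OF I])
  show "(\<lambda>t. \<Sum>n\<in>I. b n * sinc_deriv n (of_real t - u)) \<in> BL pi"
    unfolding comb by (rule fourier_int_in_BL[OF k])
  define b' where "b' n = b n * ((- \<i>) ^ n / of_real (2 * pi))" for n
  define q where "q = cutoff pi (\<lambda>w. \<Sum>n\<in>I. b' n * of_real (poly (PL n) w))"
  have b': "(\<Sum>n\<in>I. (cmod (b' n))\<^sup>2) = (\<Sum>n\<in>I. (cmod (b n))\<^sup>2) / (2 * pi)\<^sup>2"
    by (simp add: b'_def norm_mult norm_divide norm_power power_divide power_mult_distrib sum_divide_distrib)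
  have q: "integrable lborel (\<lambda>w. (cmod (q w))\<^sup>2)"
    "(LINT w|lborel. (cmod (q w))\<^sup>2) = (\<Sum>n\<in>I. (cmod (b n))\<^sup>2) / (2 * pi)"
    unfolding q_def using integral_square_sum_PL[OF I, of b'] b' by (simp_all add: power2_eq_square)
  have le: "(cmod (cutoff pi k w))\<^sup>2 \<le> C * (cmod (q w))\<^sup>2" for w
  proof (cases "w \<in> {-pi..pi}")
    case True
    have "w * Im u \<le> pi * \<bar>Im u\<bar>"
    proof -
      have "w * Im u \<le> \<bar>w\<bar> * \<bar>Im u\<bar>" by (metis abs_ge_self abs_mult)
      also have "\<dots> \<le> pi * \<bar>Im u\<bar>" using True by (intro mult_right_mono) auto
      finally show ?thesis .
    qed
    then have *: "(cmod (exp (- \<i> * of_real w * u)))\<^sup>2 \<le> C"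
      by (simp add: norm_exp_eq_Re C_def flip: exp_of_nat_mult)
    have "cutoff pi k w = q w * exp (- \<i> * of_real w * u)"
      by (simp add: cutoff_def k_def q_def b'_def sinc_density_def mult_ac)
    then have "(cmod (cutoff pi k w))\<^sup>2 = (cmod (exp (- \<i> * of_real w * u)))\<^sup>2 * (cmod (q w))\<^sup>2"
      by (simp only: norm_mult power_mult_distrib mult.commute)
    also have "\<dots> \<le> C * (cmod (q w))\<^sup>2" by (intro mult_right_mono *) simp
    finally show ?thesis .
  qed (simp add: cutoff_def q_def)
  have kint: "integrable lborel (\<lambda>w. (cmod (cutoff pi k w))\<^sup>2)"
  proof (rule Bochner_Integration.integrable_bound[OF integrable_mult_right[OF q(1), of C]])
    show "(\<lambda>w. (cmod (cutoff pi k w))\<^sup>2) \<in> borel_measurable lborel" using kf(1) by measurable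
    show "AE w in lborel. norm ((cmod (cutoff pi k w))\<^sup>2) \<le> norm (C * (cmod (q w))\<^sup>2)"
    proof (rule AE_I2)
      fix w
      show "norm ((cmod (cutoff pi k w))\<^sup>2) \<le> norm (C * (cmod (q w))\<^sup>2)"
        using le[of w] by simp
    qed
  qed
  have "(LINT w|lborel. (cmod (cutoff pi k w))\<^sup>2) \<le> (LINT w|lborel. C * (cmod (q w))\<^sup>2)"
    by (intro integral_mono kint integrable_mult_right q(1) le)
  then have W: "2 * pi * (LINT w|lborel. (cmod (cutoff pi k w))\<^sup>2) \<le> C * (\<Sum>n\<in>I. (cmod (b n))\<^sup>2)"
    by (simp add: q(2) field_simps)
  then show "(\<integral>\<^sup>+t. ennreal ((cmod (\<Sum>n\<in>I. b n * sinc_deriv n (of_real t - u)))\<^sup>2) \<partial>lborel) \<le> ennreal (C * (\<Sum>n\<in>I. (cmod (b n))\<^sup>2))"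
    unfolding comb plancherel_cutoff[OF k] by (rule ennreal_leI)
  have "(cmod (\<Sum>n\<in>I. b n * sinc_deriv n (of_real t - u)))\<^sup>2 \<le> (LINT w|lborel. cmod (cutoff pi k w))\<^sup>2"
    unfolding comb by (intro power_mono norm_fourier_int_le) auto
  also have "\<dots> \<le> 2 * pi * (LINT w|lborel. (cmod (cutoff pi k w))\<^sup>2)"
    by (intro integral_norm_square_le kf kint) auto
  finally show "(cmod (\<Sum>n\<in>I. b n * sinc_deriv n (of_real t - u)))\<^sup>2 \<le> C * (\<Sum>n\<in>I. (cmod (b n))\<^sup>2)"
    using W by linarith
qed

text \<open>The coefficients at \<open>u\<close> have the moduli of Legendre coefficients of the
  density times exp(i w u), which stays in L2 because the band is bounded.\<close>

lemma BL_chromatic_deriv_square_summable: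
  assumes f: "f holomorphic_on UNIV" and BL: "(\<lambda>t::real. f (of_real t)) \<in> BL pi"
  shows "summable (\<lambda>n. (cmod (chromatic_deriv n f u))\<^sup>2)"
proof -
  obtain F where F: "integrable lborel F" "\<forall>w. w \<notin> {-pi..pi} \<longrightarrow> F w = 0"
    "integrable lborel (\<lambda>w. (cmod (F w))\<^sup>2)" and inv: "\<And>s. f (of_real s) = fourier_int F (of_real s) / of_real (2 * pi)"
    using BL_inversion[OF BL] by blast
  define F1 where "F1 w = F w / of_real (2 * pi)" for w
  have F1: "integrable lborel F1" "\<forall>w. w \<notin> {-pi..pi} \<longrightarrow> F1 w = 0" "integrable lborel (\<lambda>w. (cmod (F1 w))\<^sup>2)"
    using F unfolding F1_def by (auto simp: norm_divide power_divide norm_mult)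
  have real: "f (of_real s) = fourier_int F1 (of_real s)" for s
    unfolding inv fourier_int_def F1_def by (simp flip: integral_divide_zero)
  have "f z - fourier_int F1 z = 0" for z
  \<comment> \<open>Inversion is known only on the real line; both sides are entire, so the identity
    theorem extends it to complex \<open>u\<close>.\<close>
  proof (rule analytic_continuation[of "\<lambda>z. f z - fourier_int F1 z" UNIV "range of_real" 0])
    show "(\<lambda>z. f z - fourier_int F1 z) holomorphic_on UNIV"
      by (intro holomorphic_on_diff f holomorphic_fourier_int[OF F1(1,2)])
    show "0 islimpt range complex_of_real"
      unfolding islimpt_sequential
    proof (intro exI[of _ "\<lambda>n. of_real (1 / real (Suc n))"] conjI allI DiffI rangeI)
      have "(\<lambda>n. 1 / real (Suc n)) \<longlonglongrightarrow> 0" by (intro LIMSEQ_Suc lim_1_over_n)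
      from tendsto_of_real[OF this] show "(\<lambda>n. complex_of_real (1 / real (Suc n))) \<longlonglongrightarrow> 0"
        by (simp only: of_real_0)
    qed (simp only: singleton_iff of_real_eq_0_iff, simp)
    show "f z - fourier_int F1 z = 0" if "z \<in> range complex_of_real" for z
      using that real by auto
  qed auto
  then have eq: "f = fourier_int F1" by auto
  define K where "K w = F1 w * exp (\<i> * of_real w * u)" for w
  have K: "integrable lborel K" "\<forall>w. w \<notin> {-pi..pi} \<longrightarrow> K w = 0"
    using integrable_fourier[OF F1(1,2)] F1(2) unfolding K_def by auto
  have K2: "integrable lborel (\<lambda>w. (cmod (K w))\<^sup>2)"
  proof (rule Bochner_Integration.integrable_bound[OF integrable_mult_right[OF F1(3), of "(exp (pi * cmod u))\<^sup>2"]])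
    show "(\<lambda>w. (cmod (K w))\<^sup>2) \<in> borel_measurable lborel" using K(1) by measurable
    have "(cmod (K w))\<^sup>2 \<le> (exp (pi * cmod u))\<^sup>2 * (cmod (F1 w))\<^sup>2" for w
    proof (cases "w \<in> {-pi..pi}")
      case True
      then have "\<bar>w\<bar> * cmod u \<le> pi * cmod u" by (intro mult_right_mono) auto
      then have "cmod (exp (\<i> * of_real w * u)) \<le> exp (pi * cmod u)"
        by (intro order_trans[OF norm_exp]) (simp add: norm_mult)
      then have "cmod (K w) \<le> exp (pi * cmod u) * cmod (F1 w)"
        unfolding K_def norm_mult by (subst mult.commute) (intro mult_right_mono, auto)
      then show ?thesis by (simp only: power_mult_distrib[symmetric] power_mono norm_ge_zero)
    qed (use K F1 in auto)
    then show "AE w in lborel. norm ((cmod (K w))\<^sup>2) \<le> norm ((exp (pi * cmod u))\<^sup>2 * (cmod (F1 w))\<^sup>2)"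
      by (auto simp: abs_mult)
  qed
  have c: "cmod (chromatic_deriv n f u) = cmod (LINT w|lborel. of_real (poly (PL n) w) * K w)" for n
    unfolding eq chromatic_deriv_fourier_int[OF F1(1,2)] K_def by (simp add: norm_mult norm_power)
  show ?thesis
    unfolding c
    by (rule summableI_nonneg_bounded[where x = "2 * pi * (LINT w|lborel. (cmod (K w))\<^sup>2)"])
       (rule zero_le_power2, rule bessel_inequality_PL[OF K K2 finite_lessThan])
qed

theorem BL_chromatic_expansion:
  fixes f :: "complex \<Rightarrow> complex" and u :: complex
  assumes f: "f holomorphic_on UNIV" and BL: "(\<lambda>t::real. f (of_real t)) \<in> BL pi"
  defines "S \<equiv> \<lambda>N (t::real). \<Sum>n<N. chromatic_deriv n f u * sinc_deriv n (of_real t - u)"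
  shows "uniform_limit UNIV S (\<lambda>t. f (of_real t)) sequentially"
    and "converges_in_BL pi S (\<lambda>t. f (of_real t))"
proof -
  define a where "a n = (cmod (chromatic_deriv n f u))\<^sup>2" for n
  define C where "C = exp (2 * pi * \<bar>Im u\<bar>)"
  \<comment> \<open>\<open>C\<close> times the tail of the square sum: it bounds every block
    starting at N, independently of t and of the block's length.\<close>
  define \<tau> where "\<tau> N = C * (suminf a - (\<Sum>n<N. a n))" for N
  have a: "summable a" unfolding a_def by (rule BL_chromatic_deriv_square_summable[OF f BL])
  have a0: "a n \<ge> 0" for n by (simp add: a_def)
  have C0: "C > 0" by (simp add: C_def)
  have \<tau>0: "\<tau> N \<ge> 0" for N
    using sum_le_suminf[OF a, of "{..<N}"] a0 C0 by (simp add: \<tau>_def)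
  have \<tau>lim: "\<tau> \<longlonglongrightarrow> 0"
  proof -
    have "\<tau> \<longlonglongrightarrow> C * (suminf a - suminf a)"
      unfolding \<tau>_def by (intro tendsto_mult tendsto_diff tendsto_const summable_LIMSEQ a)
    then show ?thesis by simp
  qed
  have diff: "S M t - S N t = (\<Sum>n\<in>{N..<M}. chromatic_deriv n f u * sinc_deriv n (of_real t - u))" if "N \<le> M" for N M t
    using that unfolding S_def
    by (subst sum_diff[symmetric]) (auto intro!: sum.cong)
  have tail: "C * (\<Sum>n\<in>{N..<M}. a n) \<le> \<tau> N" if "N \<le> M" for N M
  proof -
    have "(\<Sum>n\<in>{N..<M}. a n) = (\<Sum>n<M. a n) - (\<Sum>n<N. a n)"
      using that by (subst sum_diff[symmetric]) (auto intro!: sum.cong)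
    also have "\<dots> \<le> suminf a - (\<Sum>n<N. a n)"
      using sum_le_suminf[OF a, of "{..<M}"] a0 by simp
    finally show ?thesis using C0 by (simp add: \<tau>_def)
  qed
  have lim: "(\<lambda>M. S M t) \<longlonglongrightarrow> f (of_real t)" for t
    using chromatic_expansion[OF f, of u "of_real t - u"] by (simp add: sums_def S_def)
  \<comment> \<open>The block bound does not depend on M, so it survives the pointwise limit in
    M.\<close>
  have sup: "(cmod (f (of_real t) - S N t))\<^sup>2 \<le> \<tau> N" for N t
  proof (rule tendsto_upperbound)
    show "(\<lambda>M. (cmod (S M t - S N t))\<^sup>2) \<longlonglongrightarrow> (cmod (f (of_real t) - S N t))\<^sup>2"
      by (intro tendsto_intros lim)
    show "\<forall>\<^sub>F M in sequentially. (cmod (S M t - S N t))\<^sup>2 \<le> \<tau> N"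
      using eventually_ge_at_top[of N]
    proof eventually_elim
      case (elim M)
      have "(cmod (S M t - S N t))\<^sup>2 \<le> C * (\<Sum>n\<in>{N..<M}. a n)"
        unfolding diff[OF elim] C_def a_def by (rule sinc_deriv_combination_bounds(3)) simp
      then show ?case using tail[OF elim] by linarith
    qed
  qed simp
  show "uniform_limit UNIV S (\<lambda>t. f (of_real t)) sequentially"
  proof (rule uniform_limitI)
    fix e :: real assume e: "e > 0"
    then have "\<forall>\<^sub>F N in sequentially. \<tau> N < e\<^sup>2"
      using order_tendstoD(2)[OF \<tau>lim] by simp
    then show "\<forall>\<^sub>F N in sequentially. \<forall>t\<in>UNIV. dist (S N t) (f (of_real t)) < e"
    proof eventually_elim
      case (elim N)
      have "(cmod (f (of_real t) - S N t))\<^sup>2 < e\<^sup>2" for t using sup[of t N] elim by linarith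
      then have "cmod (f (of_real t) - S N t) < e" for t
        using e power2_less_imp_less less_imp_le by blast
      then show ?case by (simp add: dist_norm norm_minus_commute)
    qed
  qed
  have SBL: "S N \<in> BL pi" for N
    unfolding S_def by (rule sinc_deriv_combination_bounds(1)) simp
  have [measurable]: "S N \<in> borel_measurable borel" for N
    using SBL[of N] by (simp add: BL_def square_integrable_def)
  \<comment> \<open>Fatou's lemma passes from the blocks to the pointwise limit.\<close>
  have L2: "(\<integral>\<^sup>+t. ennreal ((cmod (S N t - f (of_real t)))\<^sup>2) \<partial>lborel) \<le> ennreal (\<tau> N)" for N
  proof -
    have "(\<lambda>M. ennreal ((cmod (S N t - S M t))\<^sup>2)) \<longlonglongrightarrow> ennreal ((cmod (S N t - f (of_real t)))\<^sup>2)" for t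
      by (intro tendsto_ennrealI tendsto_intros lim)
    then have "(\<integral>\<^sup>+t. ennreal ((cmod (S N t - f (of_real t)))\<^sup>2) \<partial>lborel) =
        (\<integral>\<^sup>+t. liminf (\<lambda>M. ennreal ((cmod (S N t - S M t))\<^sup>2)) \<partial>lborel)"
      by (intro nn_integral_cong lim_imp_Liminf[symmetric]) auto
    also have "\<dots> \<le> liminf (\<lambda>M. \<integral>\<^sup>+t. ennreal ((cmod (S N t - S M t))\<^sup>2) \<partial>lborel)"
      by (intro nn_integral_liminf) measurable
    also have "\<dots> \<le> liminf (\<lambda>M. ennreal (\<tau> N))"
    proof (rule Liminf_mono, use eventually_ge_at_top[of N] in eventually_elim)
      case (elim M)
      have "(\<integral>\<^sup>+t. ennreal ((cmod (S N t - S M t))\<^sup>2) \<partial>lborel) \<le> ennreal (C * (\<Sum>n\<in>{N..<M}. a n))"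
        unfolding norm_minus_commute[of "S N _"] diff[OF elim] C_def a_def
        by (rule sinc_deriv_combination_bounds(2)) simp
      also have "\<dots> \<le> ennreal (\<tau> N)" by (intro ennreal_leI tail elim)
      finally show ?case .
    qed
    also have "\<dots> = ennreal (\<tau> N)" by (simp add: Liminf_const)
    finally show ?thesis .
  qed
  have "(\<lambda>N. ennreal (\<tau> N)) \<longlonglongrightarrow> ennreal 0"
    by (intro tendsto_ennrealI \<tau>lim)
  then have up: "(\<lambda>N. ennreal (\<tau> N)) \<longlonglongrightarrow> 0" by (simp only: ennreal_0)
  have "L2_tendsto S (\<lambda>t. f (of_real t)) sequentially"
    unfolding L2_tendsto_def
    by (rule tendsto_sandwich[OF _ _ tendsto_const up])
       (rule always_eventually, rule allI, rule zero_le, rule always_eventually, rule allI, rule L2)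
  then show "converges_in_BL pi S (\<lambda>t. f (of_real t))"
    using SBL BL by (simp add: converges_in_BL_def)
qed

theorem proposition2p1:
  fixes f :: "complex \<Rightarrow> complex"
  assumes entire: "f holomorphic_on UNIV"
  shows "(\<forall>z u.
            (\<lambda>n. chromatic_deriv n f u * chromatic_deriv n (\<lambda>w. csinc (z - w)) u) sums f z \<and>
            (\<lambda>n. (- 1) ^ n * chromatic_deriv n f u * chromatic_deriv n csinc (z - u)) sums f z \<and>
            (\<lambda>n. chromatic_deriv n f u * of_real (sqrt (2 * real n + 1)) *
                 spherical_bessel_j n (of_real pi * (z - u))) sums f z) \<and>
         ((\<lambda>t::real. f (of_real t)) \<in> BL pi \<longrightarrow>
            (\<forall>u. \<forall>S \<in> {(\<lambda>n (t::real). chromatic_deriv n f u *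
                               chromatic_deriv n (\<lambda>w. csinc (of_real t - w)) u),
                      (\<lambda>n t. (- 1) ^ n * chromatic_deriv n f u *
                               chromatic_deriv n csinc (of_real t - u)),
                      (\<lambda>n t. chromatic_deriv n f u * of_real (sqrt (2 * real n + 1)) *
                               spherical_bessel_j n (of_real pi * (of_real t - u)))}.
               uniform_limit UNIV (\<lambda>N t. \<Sum>n<N. S n t) (\<lambda>t. f (of_real t)) sequentially \<and>
               converges_in_BL pi (\<lambda>N t. \<Sum>n<N. S n t) (\<lambda>t. f (of_real t))))"
proof -
  have 1: "chromatic_deriv n f u * chromatic_deriv n (\<lambda>w. csinc (z - w)) u =
      chromatic_deriv n f u * sinc_deriv n (z - u)" for n z u
    by (simp only: chromatic_deriv_csinc_reflect)
  have 2: "(- 1) ^ n * chromatic_deriv n f u * chromatic_deriv n csinc (z - u) =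
      chromatic_deriv n f u * sinc_deriv n (z - u)" for n z u
    by (simp add: chromatic_deriv_csinc minus_one_power_iff)
  have 3: "chromatic_deriv n f u * of_real (sqrt (2 * real n + 1)) * spherical_bessel_j n (of_real pi * (z - u)) =
      chromatic_deriv n f u * sinc_deriv n (z - u)" for n z u
    by (simp only: mult.assoc spherical_bessel_eq_sinc_deriv)
  have "(\<lambda>n. chromatic_deriv n f u * sinc_deriv n (z - u)) sums f z" for z u
    using chromatic_expansion[OF entire, of u "z - u"] by simp
  then show ?thesis
    unfolding 1 2 3 using BL_chromatic_expansion[OF entire] by simp
qed

end
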